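(* Suppose $u^0\in\dot H^{\frac{\log 3}{2\log 2}}_{\mathcal M}$ is odd, permutation symmetric, and $\sigma$-mirror symmetric. Then $u^0$ can be expressed in the form $$u^0(x)=-2\sum_{n=0}^{\infty}\psi_n(0)\sum_{k\in\mathcal M_n^+}v^k\sin(2\pi k\cdot x),\qquad \psi_n(0)\in\mathbb R.$$ These symmetries are preserved by the dynamics of the Fourier-restricted Euler equation: if $u\in C^1\big([0,T_{max});\dot H^{\frac{\log 3}{2\log 2}}_{\mathcal M}\big)$ is the unique solution of the Fourier-restricted Euler equation with initial data $u^0$ ($T_{max}$ being the maximal time of existence), then for all $0\le t<T_{max}$, $$u(x,t)=-2\sum_{n=0}^{\infty}\psi_n(t)\sum_{k\in\mathcal M_n^+}v^k\sin(2\pi k\cdot x).$$ Furthermore, for all $0\le t<T_{max}$ and all integers $n\ge0$, $$\partial_t\psi_n=\sqrt2\,\pi\,\beta_{n-1}(\sqrt3)^{n}\psi_{n-1}^2-\sqrt2\,\pi\,\beta_n(\sqrt3)^{n+1}\psi_n\psi_{n+1},$$ where $\beta_n=\big(1+\tfrac12(\tfrac34)^n\big)^{-1/2}$ for $n\ge0$ and $\psi_{-1}=\beta_{-1}:=0$. If $u^0$ is not identically zero, then this solution blows up in finite time with $$T_{max}\le\left(\left(\frac{3^{1/4}}{12(3^{1/4}-1)}\right)^{1/2}\|u^0\|_{L^2}-H(0)\right)\frac{6\sqrt3}{\pi\big(3^{3/8}-3^{5/16}\big)\|u^0\|_{L^2}^2},$$ where $H(0)=\sum_{n=0}^\infty(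\sqrt3)^{-n/4}\psi_n(0)$.
   Context: Function spaces: $\mathbb T^3=\mathbb R^3/\mathbb Z^3$, $\hat u(k)=\int_{\mathbb T^3}u(x)e^{-2\pi i k\cdot x}\,dx$ for $k\in\mathbb Z^3$. For $s\ge0$, $\dot H^s=\dot H^s(\mathbb T^3;\mathbb R^3)$ is the space of mean-zero $L^2$ vector fields with $\|u\|_{\dot H^s}^2=\sum_{k\ne0}(4\pi^2|k|^2)^s|\hat u(k)|^2<\infty$. Frequencies: let $\sigma=(1,1,1)$. For integers $m\ge0$ let $k^m=2^{2m}\sigma+3^m(1,0,-1)$, $h^m=2^{2m+1}\sigma+3^m(1,1,-2)$, $j^m=2^{2m+1}\sigma+3^m(2,-1,-1)$. For $v\in\mathbb R^3$, $\mathcal P[v]$ is the set of all vectors obtained by permuting the entries of $v$. Let $\mathcal M^+_{2m}=\mathcal P[k^m]$, $\mathcal M^+_{2m+1}=\mathcal P[h^m]\cup\mathcal P[j^m]$, $\mathcal M^+=\bigcup_{n\ge0}\mathcal M_n^+$, $\mathcal M=\mathcal M^+\cup(-\mathcal M^+)$. For $k\in\mathcal M$ let $P_k^\perp(\sigma)=\sigma-\frac{k\cdot\sigma}{|k|^2}k$ and $v^k=P_k^\perp(\sigma)/|P_k^\perp(\sigma)|$. Constraint space: $\dot H^s_{\mathcal M}$ is the set of $u\in\dot H^s(\mathbb T^3;\mathbb R^3)$ with $\operatorname{supp}\hat u\subset\mathcal M$ and $\hat u(k)\in\operatorname{span}\{v^k\}$ (complex multiples of $v^k$) for all $k\in\mathcal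 M$. The projection $\mathbb P_{\mathcal M}$ is given by $\widehat{\mathbb P_{\mathcal M}w}(k)=(v^k\cdot\hat w(k))v^k$ for $k\in\mathcal M$ and $0$ for $k\notin\mathcal M$; $(u\cdot\nabla)u=\nabla\cdot(u\otimes u)$ in the sense of distributions. The Fourier-restricted Euler equation is $\partial_tu+\mathbb P_{\mathcal M}((u\cdot\nabla)u)=0$. Symmetries: $u$ is odd if $u(-x)=-u(x)$; permutation symmetric if $u(Px)=Pu(x)$ for every permutation $P$ of $\{1,2,3\}$ acting on vectors by $(Pv)_i=v_{P(i)}$; $\sigma$-mirror symmetric if $u(x)=M_\sigma u(M_\sigma x)$ for all $x$, where $M_\sigma=I_3-\frac23\sigma\otimes\sigma$ and $u$ is extended periodically to $\mathbb R^3$. *)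

theory Defs
  imports "HOL-Analysis.Analysis"
begin

text \<open>
  A function on the torus is an everywhere \<open>\<int>\<^sup>3\<close>-periodic function on \<^typ>\<open>real^3\<close>. Elements of
  \<open>L\<^sup>2\<close> are represented by such functions, and equalities between them are required almost
  everywhere. Frequencies are elements of \<^typ>\<open>int^3\<close>.
\<close>

definition of_int_vec :: "int^3 \<Rightarrow> real^3" where
  "of_int_vec k = (\<chi> i. real_of_int (k $ i))"

definition of_real_vec :: "real^3 \<Rightarrow> complex^3" where
  "of_real_vec v = (\<chi> i. complex_of_real (v $ i))"

definition torus :: "(real^3) measure" where
  "torus = lebesgue_on (cbox 0 1)"

definition periodic :: "(real^3 \<Rightarrow> 'a) \<Rightarrow> bool" where
  "periodic f \<longleftrightarrow> (\<forall>x k. f (x + of_int_vec k) = f x)"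

definition L2_field :: "(real^3 \<Rightarrow> real^3) \<Rightarrow> bool" where
  "L2_field u \<longleftrightarrow> periodic u \<and> u \<in> borel_measurable lebesgue \<and>
     integrable torus (\<lambda>x. (norm (u x))\<^sup>2)"

definition L2_norm_field :: "(real^3 \<Rightarrow> real^3) \<Rightarrow> real" where
  "L2_norm_field u = sqrt (LINT x|torus. (norm (u x))\<^sup>2)"


text \<open>
  Distributions on the torus are linear functionals on smooth periodic test functions. They occur
  only through their values on derivatives of characters, so neither continuity nor the class of
  test functions is recorded in the type.
\<close>

type_synonym distr = "(real^3 \<Rightarrow> complex) \<Rightarrow> complex"

definition distr_of :: "(real^3 \<Rightarrow> real) \<Rightarrow> distr" where
  "distr_of f = (\<lambda>\<phi>. LINT x|torus. complex_of_real (f x) * \<phi> x)"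

definition partial_deriv :: "3 \<Rightarrow> (real^3 \<Rightarrow> complex) \<Rightarrow> real^3 \<Rightarrow> complex" where
  "partial_deriv j \<phi> x = frechet_derivative \<phi> (at x) (axis j 1)"

definition distr_partial :: "3 \<Rightarrow> distr \<Rightarrow> distr" where
  "distr_partial j T = (\<lambda>\<phi>. - T (partial_deriv j \<phi>))"

definition distr_fourier :: "distr \<Rightarrow> int^3 \<Rightarrow> complex" where
  "distr_fourier T k = T (\<lambda>x. exp (- (2 * pi * \<i> * complex_of_real (of_int_vec k \<bullet> x))))"

definition fourier :: "(real^3 \<Rightarrow> real^3) \<Rightarrow> int^3 \<Rightarrow> complex^3" where
  "fourier u k = (\<chi> i. distr_fourier (distr_of (\<lambda>x. u x $ i)) k)"

text \<open>The \<open>i\<close>-th component of \<open>(u \<cdot> \<nabla>) u = \<nabla> \<cdot> (u \<otimes> u)\<close>.\<close>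

definition convection :: "(real^3 \<Rightarrow> real^3) \<Rightarrow> 3 \<Rightarrow> distr" where
  "convection u i = (\<lambda>\<phi>. \<Sum>j\<in>UNIV. distr_partial j (distr_of (\<lambda>x. u x $ j * u x $ i)) \<phi>)"


definition Hs_term :: "real \<Rightarrow> (real^3 \<Rightarrow> real^3) \<Rightarrow> int^3 \<Rightarrow> real" where
  "Hs_term s u k = (4 * pi\<^sup>2 * (norm (of_int_vec k))\<^sup>2) powr s * (norm (fourier u k))\<^sup>2"

definition Hs :: "real \<Rightarrow> (real^3 \<Rightarrow> real^3) set" where
  "Hs s = {u. L2_field u \<and> (LINT x|torus. u x) = 0 \<and> Hs_term s u summable_on (- {0})}"

definition Hs_norm :: "real \<Rightarrow> (real^3 \<Rightarrow> real^3) \<Rightarrow> real" where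
  "Hs_norm s u = sqrt (\<Sum>\<^sub>\<infinity>k\<in>- {0}. Hs_term s u k)"


definition sigma :: "int^3" where
  "sigma = vector [1, 1, 1]"

definition freq_k :: "nat \<Rightarrow> int^3" where
  "freq_k m = 2 ^ (2 * m) *s sigma + 3 ^ m *s vector [1, 0, -1]"

definition freq_h :: "nat \<Rightarrow> int^3" where
  "freq_h m = 2 ^ (2 * m + 1) *s sigma + 3 ^ m *s vector [1, 1, -2]"

definition freq_j :: "nat \<Rightarrow> int^3" where
  "freq_j m = 2 ^ (2 * m + 1) *s sigma + 3 ^ m *s vector [2, -1, -1]"

definition permute_vec :: "(3 \<Rightarrow> 3) \<Rightarrow> 'a^3 \<Rightarrow> 'a^3" where
  "permute_vec p v = (\<chi> i. v $ p i)"

definition permutations_of_vec :: "'a^3 \<Rightarrow> ('a^3) set" where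
  "permutations_of_vec v = {permute_vec p v |p. bij p}"

definition shell :: "nat \<Rightarrow> (int^3) set" where
  "shell n = (if even n then permutations_of_vec (freq_k (n div 2))
     else permutations_of_vec (freq_h (n div 2)) \<union> permutations_of_vec (freq_j (n div 2)))"

definition M_plus :: "(int^3) set" where
  "M_plus = (\<Union>n. shell n)"

definition M_freq :: "(int^3) set" where
  "M_freq = M_plus \<union> uminus ` M_plus"

definition perp_sigma :: "int^3 \<Rightarrow> real^3" where
  "perp_sigma k = of_int_vec sigma -
     ((of_int_vec k \<bullet> of_int_vec sigma) / (norm (of_int_vec k))\<^sup>2) *\<^sub>R of_int_vec k"

definition v_dir :: "int^3 \<Rightarrow> real^3" where
  "v_dir k = (1 / norm (perp_sigma k)) *\<^sub>R perp_sigma k"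


definition HsM :: "real \<Rightarrow> (real^3 \<Rightarrow> real^3) set" where
  "HsM s = {u \<in> Hs s. (\<forall>k. k \<notin> M_freq \<longrightarrow> fourier u k = 0) \<and>
     (\<forall>k\<in>M_freq. \<exists>c::complex. fourier u k = c *s of_real_vec (v_dir k))}"

text \<open>
  The projection onto the constraint space, acting on Fourier coefficients. The product
  \<open>v\<^sup>k \<cdot> w\<close> is bilinear, without complex conjugation.
\<close>

definition proj_M :: "(int^3 \<Rightarrow> complex^3) \<Rightarrow> int^3 \<Rightarrow> complex^3" where
  "proj_M w k = (if k \<in> M_freq
     then (\<Sum>i\<in>UNIV. of_real_vec (v_dir k) $ i * w k $ i) *s of_real_vec (v_dir k) else 0)"


definition time_interval :: "ereal \<Rightarrow> real set" where
  "time_interval T = {t. 0 \<le> t \<and> ereal t < T}"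

text \<open>
  \<open>C1_HsM s T u u'\<close>: the curve \<open>u\<close> is in \<open>C\<^sup>1([0,T); HsM s)\<close> and \<open>u'\<close> is its time derivative
  (one-sided at \<open>t = 0\<close>), the limits being taken in the norm of \<open>Hs s\<close>.
\<close>

definition C1_HsM ::
    "real \<Rightarrow> ereal \<Rightarrow> (real \<Rightarrow> real^3 \<Rightarrow> real^3) \<Rightarrow> (real \<Rightarrow> real^3 \<Rightarrow> real^3) \<Rightarrow> bool" where
  "C1_HsM s T u u' \<longleftrightarrow> (\<forall>t\<in>time_interval T. u t \<in> HsM s \<and> u' t \<in> HsM s \<and>
     ((\<lambda>r. Hs_norm s (\<lambda>x. (1 / (r - t)) *\<^sub>R (u r x - u t x) - u' t x)) \<longlongrightarrow> 0)
       (at t within time_interval T) \<and>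
     ((\<lambda>r. Hs_norm s (\<lambda>x. u' r x - u' t x)) \<longlongrightarrow> 0) (at t within time_interval T))"

definition restricted_euler_solution ::
    "real \<Rightarrow> (real^3 \<Rightarrow> real^3) \<Rightarrow> ereal \<Rightarrow> (real \<Rightarrow> real^3 \<Rightarrow> real^3) \<Rightarrow> bool" where
  "restricted_euler_solution s u0 T u \<longleftrightarrow> 0 < T \<and>
     (\<exists>u'. C1_HsM s T u u' \<and>
       (\<forall>t\<in>time_interval T. \<forall>k.
          fourier (u' t) k + proj_M (\<lambda>l. \<chi> i. distr_fourier (convection (u t) i) l) k = 0)) \<and>
     (AE x in lebesgue. u 0 x = u0 x)"

definition unique_maximal_solution ::
    "real \<Rightarrow> (real^3 \<Rightarrow> real^3) \<Rightarrow> ereal \<Rightarrow> (real \<Rightarrow> real^3 \<Rightarrow> real^3) \<Rightarrow> bool" where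
  "unique_maximal_solution s u0 Tmax u \<longleftrightarrow> restricted_euler_solution s u0 Tmax u \<and>
     (\<forall>T w. restricted_euler_solution s u0 T w \<longrightarrow>
        T \<le> Tmax \<and> (\<forall>t\<in>time_interval T. AE x in lebesgue. w t x = u t x))"


definition odd_field :: "(real^3 \<Rightarrow> real^3) \<Rightarrow> bool" where
  "odd_field u \<longleftrightarrow> (AE x in lebesgue. u (- x) = - u x)"

definition permutation_symmetric :: "(real^3 \<Rightarrow> real^3) \<Rightarrow> bool" where
  "permutation_symmetric u \<longleftrightarrow>
     (\<forall>p. bij p \<longrightarrow> (AE x in lebesgue. u (permute_vec p x) = permute_vec p (u x)))"

definition M_sigma :: "real^3^3" where
  "M_sigma = (\<chi> i j. mat 1 $ i $ j - 2 / 3 * (of_int_vec sigma $ i * of_int_vec sigma $ j))"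

definition sigma_mirror_symmetric :: "(real^3 \<Rightarrow> real^3) \<Rightarrow> bool" where
  "sigma_mirror_symmetric u \<longleftrightarrow> (AE x in lebesgue. u x = M_sigma *v u (M_sigma *v x))"


definition shell_mode :: "nat \<Rightarrow> real^3 \<Rightarrow> real^3" where
  "shell_mode n x = (\<Sum>k\<in>shell n. sin (2 * pi * (of_int_vec k \<bullet> x)) *\<^sub>R v_dir k)"

text \<open>The series is required to converge to \<open>u\<close> both pointwise almost everywhere and in \<open>Hs s\<close>.\<close>

definition shell_expansion :: "real \<Rightarrow> (nat \<Rightarrow> real) \<Rightarrow> (real^3 \<Rightarrow> real^3) \<Rightarrow> bool" where
  "shell_expansion s a u \<longleftrightarrow>
     (AE x in lebesgue. summable (\<lambda>n. a n *\<^sub>R shell_mode n x) \<and>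
        u x = (-2) *\<^sub>R (\<Sum>n. a n *\<^sub>R shell_mode n x)) \<and>
     (\<lambda>N. Hs_norm s (\<lambda>x. u x - (-2) *\<^sub>R (\<Sum>n<N. a n *\<^sub>R shell_mode n x))) \<longlonglongrightarrow> 0"

definition beta :: "nat \<Rightarrow> real" where
  "beta n = (1 + 1 / 2 * (3 / 4) ^ n) powr (- 1 / 2)"

text \<open>The entry \<open>a\<^bsub>n-1\<^esub>\<close> of a sequence, with the convention \<open>a\<^bsub>-1\<^esub> = 0\<close>.\<close>

definition prev :: "(nat \<Rightarrow> real) \<Rightarrow> nat \<Rightarrow> real" where
  "prev a n = (case n of 0 \<Rightarrow> 0 | Suc m \<Rightarrow> a m)"

definition H_sum :: "(nat \<Rightarrow> real) \<Rightarrow> real" where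
  "H_sum a = (\<Sum>n. sqrt 3 powr (- real n / 4) * a n)"

end

theory Submission
  imports Defs
begin

text \<open>
  A field in the constraint space is determined by its scalar coefficients along \<open>v\<^sup>k\<close>, and in the
  critical space these are \<open>O(3\<^bsup>-n/2\<^esup>)\<close> on the \<open>n\<close>-th shell; hence every such field is almost everywhere
  the sum of an absolutely convergent series. As \<open>k \<bullet> \<sigma> = 3 \<cdot> 2\<^sup>n\<close> on the \<open>n\<close>-th shell, triads
  \<open>p + q = k\<close> couple only neighbouring shells and the nonlinearity is a finite sum for each \<open>k\<close>.
  Each of the three symmetries permutes the coefficients and maps solutions to solutions, so it is
  preserved by uniqueness, and a symmetric field has a single real amplitude per shell.
  For the resulting system of amplitudes the energy flux through the \<open>n\<close>-th shell tends to zero, so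
  that energy is conserved, whereas the weighted sum \<open>H\<close> grows at least linearly in time and is
  bounded by the energy.
\<close>

section \<open>Characters and Fourier uniqueness on the torus\<close>

text \<open>The critical exponent satisfies \<open>4 powr crit_exp = 3\<close>, so the weight of the
  n-th shell is comparable with \<open>3 ^ n\<close>. The energy flux, cubic in amplitudes of size
  \<open>3 powr (- n / 2)\<close> with one factor \<open>sqrt 3 ^ n\<close>, is therefore of order
  \<open>3 powr (- n)\<close>. Relative to \<open>2 ^ n *s sigma\<close> each shell is a regular
  hexagon orthogonal to \<open>sigma\<close>. From one shell to the next it is turned by 30 degrees
  and stretched by \<open>sqrt 3\<close>, which is what adding two adjacent vertices does. Hence a
  frequency is the sum of one unordered pair of the shell below, and has two partners in its own
  shell whose sum with it lies above. The weight of \<open>H\<close> is a compromise. It decays, so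
  that it is square summable and the energy controls \<open>H\<close>; it decays slowly enough that
  in the growth rate of \<open>H\<close> the diagonal coefficient \<open>3 powr (3/8)\<close>
  exceeds the coefficient \<open>3 powr (5/16)\<close> of the products of neighbours. The infinite
  sums for the energy and for \<open>H\<close> are never differentiated. Every estimate in time
  concerns a truncation with an explicit remainder, and the limit is taken last.\<close>

definition wave :: "int^3 \<Rightarrow> real^3 \<Rightarrow> complex" where
  "wave k x = exp (2 * pi * \<i> * complex_of_real (of_int_vec k \<bullet> x))"

lemma of_int_vec_nth [simp]: "of_int_vec k $ i = real_of_int (k $ i)"
  by (simp add: of_int_vec_def)

lemma of_int_vec_simps [simp]:
  "of_int_vec 0 = 0" "of_int_vec (p + q) = of_int_vec p + of_int_vec q"
  "of_int_vec (- p) = - of_int_vec p" "of_int_vec (p - q) = of_int_vec p - of_int_vec q"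
  by (simp_all add: vec_eq_iff)

lemma of_int_vec_eq_iff [simp]: "of_int_vec p = of_int_vec q \<longleftrightarrow> p = q"
  by (simp add: vec_eq_iff)

lemma of_real_vec_nth [simp]: "of_real_vec v $ i = complex_of_real (v $ i)"
  by (simp add: of_real_vec_def)

lemma wave_0 [simp]: "wave 0 x = 1"
  by (simp add: wave_def)

lemma wave_add: "wave (p + q) x = wave p x * wave q x"
  by (simp add: wave_def inner_add_left ring_distribs exp_add)

lemma wave_eq_cis: "wave k x = cis (2 * pi * (of_int_vec k \<bullet> x))"
  unfolding wave_def cis_conv_exp by (simp add: mult_ac)

lemma wave_uminus: "wave (- k) x = cnj (wave k x)"
  by (simp add: wave_eq_cis cis_cnj)

lemma norm_wave [simp]: "norm (wave k x) = 1"
  by (simp add: wave_eq_cis)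

lemma continuous_on_wave [continuous_intros]: "continuous_on S (wave k)"
  unfolding wave_def by (intro continuous_intros)

lemma wave_measurable [measurable]: "wave k \<in> borel_measurable borel"
  by (rule borel_measurable_continuous_onI) (rule continuous_on_wave)

lemma wave_periodic: "wave k (x + of_int_vec l) = wave k x"
proof -
  have "of_int_vec k \<bullet> of_int_vec l = of_int (\<Sum>i\<in>UNIV. k $ i * l $ i)"
    by (simp add: inner_vec_def)
  then have "cis (2 * pi * (of_int_vec k \<bullet> of_int_vec l)) = 1"
    by (metis cis_multiple_2pi Ints_of_int)
  then show ?thesis
    by (simp add: wave_eq_cis inner_add_right ring_distribs flip: cis_mult)
qed

lemma distr_fourier_wave: "distr_fourier T k = T (wave (- k))"
  by (simp add: distr_fourier_def wave_def[abs_def])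

lemma borel_measurable_torus: "f \<in> borel_measurable borel \<Longrightarrow> f \<in> borel_measurable torus"
  unfolding torus_def
  by (rule measurable_restrict_space1) (simp add: measurable_completion)

interpretation torus: finite_measure torus
  unfolding torus_def by (rule finite_measure_lebesgue_on) simp

lemma integrable_torus_bounded:
  fixes f :: "real^3 \<Rightarrow> 'b::{banach, second_countable_topology}"
  assumes "f \<in> borel_measurable torus" "\<And>x. norm (f x) \<le> B"
  shows "integrable torus f"
  using assms by (intro torus.integrable_const_bound[where B = B]) auto

lemma sets_torusI: "A \<in> sets lebesgue \<Longrightarrow> A \<subseteq> cbox 0 1 \<Longrightarrow> A \<in> sets torus"
  unfolding torus_def by (subst sets_restrict_space_iff) auto

lemma AE_lebesgue_iff: "(AE x in lebesgue. P x) \<longleftrightarrow> negligible {x. \<not> P x}"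
  by (simp add: completion.AE_iff_null_sets negligible_iff_null_sets)

lemma AE_torus_iff: "(AE x in torus. P x) \<longleftrightarrow> (AE x in lebesgue. x \<in> cbox 0 1 \<longrightarrow> P x)"
  unfolding torus_def by (subst AE_restrict_space_iff) auto

lemma compact_imp_sets_lebesgue: "compact K \<Longrightarrow> K \<in> sets lebesgue"
  by (simp add: borel_compact)

lemma integral_torus_lborel:
  fixes f :: "real^3 \<Rightarrow> 'b::{banach, second_countable_topology}"
  assumes [measurable]: "f \<in> borel_measurable borel"
  shows "(LINT x|torus. f x) = (LINT x|lborel. indicator (cbox 0 1) x *\<^sub>R f x)"
proof -
  have "(LINT x|torus. f x) = (LINT x|lebesgue. indicator (cbox 0 1) x *\<^sub>R f x)"
    unfolding torus_def by (rule integral_restrict_space) auto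
  also have "\<dots> = (LINT x|lborel. indicator (cbox 0 1) x *\<^sub>R f x)"
    by (rule integral_completion) simp
  finally show ?thesis .
qed

lemma integral_cis_unit_interval:
  "has_bochner_integral lborel (\<lambda>t::real. indicator {0..1} t *\<^sub>R cis (2 * pi * of_int m * t))
     (if m = 0 then 1 else 0)"
proof (cases "m = 0")
  case True
  have "has_bochner_integral lborel (\<lambda>t::real. indicator {0..1} t *\<^sub>R (1::complex))
     (measure lborel {0..1::real} *\<^sub>R 1)"
    by (intro has_bochner_integral_scaleR_left has_bochner_integral_indicator) auto
  with True show ?thesis by simp
next
  case False
  define F where "F t = cis (2 * pi * of_int m * t) / (2 * pi * \<i> * of_int m)" for t :: real
  have "has_bochner_integral lborel (\<lambda>t::real. indicator {0..1} t *\<^sub>R cis (2 * pi * of_int m * t))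
     (F 1 - F 0)"
  proof (rule has_bochner_integral_FTC_Icc)
    fix x :: real
    have "((\<lambda>z. exp (2 * pi * \<i> * of_int m * z) / (2 * pi * \<i> * of_int m))
      has_field_derivative exp (2 * pi * \<i> * of_int m * of_real x)) (at (of_real x))"
      using False by (auto intro!: derivative_eq_intros)
    from has_vector_derivative_real_field[OF this]
    show "(F has_vector_derivative cis (2 * pi * of_int m * x)) (at x within {0..1})"
      unfolding F_def cis_conv_exp by (simp add: mult_ac)
  qed (auto intro!: continuous_intros)
  moreover have "F 1 = F 0"
    using cis_multiple_2pi[of "of_int m"] by (simp add: F_def)
  ultimately show ?thesis using False by simp
qed

text \<open>Orthogonality by Fubini: Lebesgue measure is the image of a product over
  \<open>Basis\<close>, and the character on the unit cell factors into one-dimensional integrals,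
  one of which vanishes as soon as some coordinate of \<open>k\<close> is nonzero.\<close>

lemma integral_wave: "(LINT x|torus. wave k x) = (if k = 0 then 1 else 0)"
proof -
  define g where "g b t = indicator {0..1} t *\<^sub>R cis (2 * pi * (of_int_vec k \<bullet> b) * t)"
    for b :: "real^3" and t :: real
  have *: "has_bochner_integral lborel (g b) (if of_int_vec k \<bullet> b = 0 then 1 else 0)"
    if "b \<in> Basis" for b
  proof -
    from that obtain i where "b = axis i 1" by (auto simp: Basis_vec_def)
    then show ?thesis
      using integral_cis_unit_interval[of "k $ i"] by (simp add: g_def[abs_def] inner_axis)
  qed
  interpret P: product_sigma_finite "\<lambda>b::real^3. (lborel :: real measure)"
    by standard
  have "(LINT x|torus. wave k x) = (LINT x|lborel. indicator (cbox 0 1) x *\<^sub>R wave k x)"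
    by (rule integral_torus_lborel) measurable
  also have "\<dots> = (LINT f|(\<Pi>\<^sub>M b\<in>Basis. lborel). indicator (cbox 0 1) (\<Sum>b\<in>Basis. f b *\<^sub>R b)
      *\<^sub>R wave k (\<Sum>b\<in>Basis. f b *\<^sub>R b :: real^3))"
    by (subst lborel_eq, rule integral_distr) measurable
  also have "\<dots> = (LINT f|(\<Pi>\<^sub>M b\<in>Basis. lborel). (\<Prod>b\<in>Basis. g b (f b)))"
  proof (rule Bochner_Integration.integral_cong[OF refl])
    fix f :: "real^3 \<Rightarrow> real"
    let ?x = "\<Sum>b\<in>Basis. f b *\<^sub>R b"
    have b: "?x \<bullet> b = f b" if "b \<in> Basis" for b
      using that by simp
    have 1: "(1::real^3) \<bullet> b = 1" if "b \<in> Basis" for b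
      using that by (auto simp: Basis_vec_def inner_axis)
    have w: "wave k ?x = (\<Prod>b\<in>Basis. cis (2 * pi * (of_int_vec k \<bullet> b) * f b))"
      by (simp add: wave_def cis_conv_exp inner_sum_right sum_distrib_left exp_sum[symmetric] mult_ac)
    have "indicator (cbox 0 1) ?x = (\<Prod>b\<in>Basis. indicator {0..1} (f b) :: real)"
    proof (cases "?x \<in> cbox 0 1")
      case True
      then have "f b \<in> {0..1}" if "b \<in> Basis" for b
        using that b[OF that] 1[OF that] by (auto simp: mem_box simp del: inner_sum_left_Basis)
      with True show ?thesis by simp
    next
      case False
      then obtain c where c: "c \<in> Basis" "f c \<notin> {0..1}"
        using b 1 by (auto simp: mem_box simp del: inner_sum_left_Basis)
      then show ?thesis using False
        by (metis (mono_tags, lifting) finite_Basis indicator_simps(2) prod_zero_iff)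
    qed
    with w show "indicator (cbox 0 1) ?x *\<^sub>R wave k ?x = (\<Prod>b\<in>Basis. g b (f b))"
      by (simp add: g_def prod.distrib scaleR_conv_of_real)
  qed
  also have "\<dots> = (\<Prod>b\<in>Basis. integral\<^sup>L lborel (g b))"
    by (rule P.product_integral_prod) (use * in \<open>auto simp: has_bochner_integral_iff\<close>)
  also have "\<dots> = (\<Prod>b\<in>Basis. if of_int_vec k \<bullet> (b::real^3) = 0 then 1 else 0)"
    by (rule prod.cong[OF refl]) (use * in \<open>auto simp: has_bochner_integral_iff\<close>)
  also have "\<dots> = (if k = 0 then 1 else 0)"
  proof (cases "k = 0")
    case False
    then obtain i where "k $ i \<noteq> 0" by (auto simp: vec_eq_iff)
    then have "of_int_vec k \<bullet> axis i 1 \<noteq> 0" "axis i 1 \<in> (Basis :: (real^3) set)"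
      by (auto simp: inner_axis)
    then have "(\<Prod>b\<in>Basis. if of_int_vec k \<bullet> (b::real^3) = 0 then 1 else 0) = (0::complex)"
      by (intro prod_zero) auto
    with False show ?thesis by simp
  qed auto
  finally show ?thesis .
qed

section \<open>Trigonometric polynomials and uniqueness of Fourier coefficients\<close>

inductive trig_poly :: "(real^3 \<Rightarrow> complex) \<Rightarrow> bool" where
  wave: "trig_poly (wave k)"
| scale: "trig_poly f \<Longrightarrow> trig_poly (\<lambda>x. c * f x)"
| add: "trig_poly f \<Longrightarrow> trig_poly g \<Longrightarrow> trig_poly (\<lambda>x. f x + g x)"

lemma trig_poly_const: "trig_poly (\<lambda>x. c)"
  using trig_poly.scale[OF trig_poly.wave[of 0], of c] by simp

lemma trig_poly_wave_mult: "trig_poly g \<Longrightarrow> trig_poly (\<lambda>x. wave k x * g x)"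
proof (induction rule: trig_poly.induct)
  case (wave l)
  then show ?case using trig_poly.wave[of "k + l"] by (simp add: wave_add[abs_def])
next
  case (scale f c)
  then show ?case using trig_poly.scale[OF scale.IH, of c] by (simp add: mult_ac)
next
  case (add f g)
  then show ?case using trig_poly.add[OF add.IH] by (simp add: ring_distribs)
qed

lemma trig_poly_mult: "trig_poly f \<Longrightarrow> trig_poly g \<Longrightarrow> trig_poly (\<lambda>x. f x * g x)"
proof (induction rule: trig_poly.induct)
  case (wave k)
  then show ?case by (rule trig_poly_wave_mult)
next
  case (scale f c)
  then show ?case using trig_poly.scale[of "\<lambda>x. f x * g x" c] by (simp add: mult_ac)
next
  case (add f f')
  then show ?case using trig_poly.add[of "\<lambda>x. f x * g x" "\<lambda>x. f' x * g x"] by (simp add: ring_distribs)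
qed

lemma trig_poly_sum: "finite I \<Longrightarrow> (\<And>i. i \<in> I \<Longrightarrow> trig_poly (f i)) \<Longrightarrow> trig_poly (\<lambda>x. \<Sum>i\<in>I. f i x)"
  by (induction I rule: finite_induct) (auto intro: trig_poly_const trig_poly.add)

text \<open>The embedding of the torus into \<open>\<real>\<^sup>3 \<times> \<real>\<^sup>3\<close>, which turns polynomials into trigonometric
  polynomials and makes the Stone--Weierstrass theorem applicable.\<close>

definition torus_embed :: "real^3 \<Rightarrow> (real^3) \<times> (real^3)" where
  "torus_embed x = (\<chi> i. cos (2 * pi * x $ i), \<chi> i. sin (2 * pi * x $ i))"

text \<open>Products are covered because characters multiply to characters. A linear functional is a
  combination of the coordinates of \<open>torus_embed\<close>, and these are cosines and sines,
  that is, combinations of two opposite waves.\<close>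

lemma trig_poly_polynomial:
  assumes "real_polynomial_function p"
  shows "trig_poly (\<lambda>x. complex_of_real (p (torus_embed x)))"
  using assms
proof (induction rule: real_polynomial_function.induct)
  case (linear f)
  have *: "trig_poly (\<lambda>x. complex_of_real (torus_embed x \<bullet> b))" if "b \<in> Basis" for b
  proof -
    have inner: "of_int_vec (axis i 1) \<bullet> (x::real^3) = x $ i" for i x
    proof -
      have "of_int_vec (axis i 1) = axis i 1" by (simp add: vec_eq_iff axis_def)
      then show ?thesis by (simp add: inner_axis')
    qed
    have c: "complex_of_real (cos (2 * pi * x $ i)) =
        1/2 * wave (axis i 1) x + 1/2 * wave (- axis i 1) x" for x i
      by (simp add: wave_eq_cis complex_eq_iff inner)
    have s: "complex_of_real (sin (2 * pi * x $ i)) =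
        (-\<i>/2) * wave (axis i 1) x + (\<i>/2) * wave (- axis i 1) x" for x i
      by (simp add: wave_eq_cis complex_eq_iff inner)
    from that consider i where "b = (axis i 1, 0)" | i where "b = (0, axis i 1)"
      by (auto simp: Basis_prod_def Basis_vec_def)
    then show ?thesis
    proof cases
      case (1 i)
      then have "(\<lambda>x. complex_of_real (torus_embed x \<bullet> b)) = (\<lambda>x. complex_of_real (cos (2 * pi * x $ i)))"
        by (simp add: torus_embed_def inner_axis)
      then show ?thesis by (simp only: c) (intro trig_poly.intros)
    next
      case (2 i)
      then have "(\<lambda>x. complex_of_real (torus_embed x \<bullet> b)) = (\<lambda>x. complex_of_real (sin (2 * pi * x $ i)))"
        by (simp add: torus_embed_def inner_axis)
      then show ?thesis by (simp only: s) (intro trig_poly.intros)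
    qed
  qed
  have eq: "f y = (\<Sum>b\<in>Basis. (y \<bullet> b) * f b)" for y
  proof -
    have "f y = f (\<Sum>b\<in>Basis. (y \<bullet> b) *\<^sub>R b)" by (simp add: euclidean_representation)
    also have "\<dots> = (\<Sum>b\<in>Basis. (y \<bullet> b) * f b)"
      using bounded_linear.linear[OF linear] by (simp add: linear_sum linear_scale)
    finally show ?thesis .
  qed
  have "(\<lambda>x. complex_of_real (f (torus_embed x))) =
      (\<lambda>x. \<Sum>b\<in>Basis. of_real (f b) * complex_of_real (torus_embed x \<bullet> b))"
    by (rule ext, subst eq) (simp add: mult.commute)
  then show ?case by (auto intro!: trig_poly_sum trig_poly.scale *)
next
  case (const c)
  then show ?case by (rule trig_poly_const)
next
  case (add f g)
  then show ?case using trig_poly.add by auto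
next
  case (mult f g)
  then show ?case using trig_poly_mult by auto
qed

lemma continuous_on_torus_embed: "continuous_on S torus_embed"
  unfolding torus_embed_def by (intro continuous_intros continuous_on_vec_lambda)

text \<open>The open cell is essential: opposite faces of the closed one have the same image. The
  faces form a null set.\<close>

lemma inj_on_torus_embed: "inj_on torus_embed (box 0 1)"
proof (rule inj_onI)
  fix x y assume x: "x \<in> box 0 1" and y: "y \<in> box 0 1" and e: "torus_embed x = torus_embed y"
  show "x = y"
  proof (rule vec_eq_iff[THEN iffD2], rule allI)
    fix i
    have "sin (2 * pi * x $ i) = sin (2 * pi * y $ i)" "cos (2 * pi * x $ i) = cos (2 * pi * y $ i)"
      using e by (auto simp: torus_embed_def vec_eq_iff)
    then obtain n :: int where "2 * pi * x $ i = 2 * pi * y $ i + 2 * pi * n"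
      using sin_cos_eq_iff[of "2 * pi * x $ i" "2 * pi * y $ i"] by auto
    then have "2 * pi * (x $ i - y $ i - n) = 0" by (simp add: algebra_simps)
    then have n: "x $ i - y $ i = n" by simp
    have "0 < x $ i" "x $ i < 1" "0 < y $ i" "y $ i < 1"
      using x y by (auto simp: mem_box_cart)
    then have "\<bar>real_of_int n\<bar> < 1" using n by linarith
    then have "n = 0" by linarith
    then show "x $ i = y $ i" using n by simp
  qed
qed

lemma AE_torus_box: "AE x in torus. x \<in> box 0 1"
proof -
  have "negligible (cbox 0 1 - box 0 (1::real^3))"
    by (rule negligible_frontier_interval)
  then have "AE x in lebesgue. x \<notin> cbox 0 1 - box 0 (1::real^3)"
    unfolding negligible_iff_null_sets by (rule AE_not_in)
  then have "AE x in lebesgue. x \<in> cbox 0 1 \<longrightarrow> x \<in> box 0 (1::real^3)"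
    by eventually_elim auto
  then show ?thesis unfolding AE_torus_iff .
qed

lemma integral_trig_poly_eq_0:
  fixes h :: "real^3 \<Rightarrow> real" and f :: "real^3 \<Rightarrow> complex"
  assumes h: "integrable torus h" and z: "\<And>k. (LINT x|torus. h x * wave k x) = 0" and f: "trig_poly f"
  shows "f \<in> borel_measurable torus \<and> integrable torus (\<lambda>x. h x * f x) \<and> (LINT x|torus. h x * f x) = 0"
  using f
proof (induction rule: trig_poly.induct)
  case (wave k)
  have [measurable]: "h \<in> borel_measurable torus" "wave k \<in> borel_measurable torus"
    using h by (auto intro: borel_measurable_torus)
  have "integrable torus (\<lambda>x. h x * wave k x)"
    by (rule Bochner_Integration.integrable_bound[OF h]) (auto simp: norm_mult)
  then show ?case using z by simp
next
  case (scale f c)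
  have "(\<lambda>x. h x * (c * f x)) = (\<lambda>x. c * (h x * f x))" by (simp add: mult_ac)
  with scale show ?case by (auto intro!: borel_measurable_times)
next
  case (add f g)
  then show ?case by (auto simp: ring_distribs intro!: borel_measurable_add)
qed

text \<open>The indicator of \<open>K\<close> is, on the open cell, a pointwise limit of
  trigonometric polynomials: ramps around the embedded image of \<open>K\<close> are approximated by
  Stone--Weierstrass. As \<open>K\<close> avoids the faces of the cell, the embedding separates it
  from all other points of the open cell, and dominated convergence applies.\<close>

lemma integral_compact_eq_0:
  fixes h :: "real^3 \<Rightarrow> real"
  assumes h: "integrable torus h" and z: "\<And>k. (LINT x|torus. h x * wave k x) = 0"
    and K: "compact K" "K \<subseteq> box 0 1"
  shows "(LINT x|torus. h x * indicator K x) = 0"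
proof (cases "K = {}")
  case False
  let ?E = torus_embed
  define F where "F n y = max 0 (1 - real n * infdist y (?E ` K))" for n y
  have comp: "compact (?E ` cbox 0 1)" "compact (?E ` K)"
    using K by (auto intro!: compact_continuous_image continuous_on_torus_embed)
  have "\<exists>p. real_polynomial_function p \<and> (\<forall>y\<in>?E ` cbox 0 1. \<bar>F n y - p y\<bar> < 1 / Suc n)" for n
  proof -
    have "continuous_on (?E ` cbox 0 1) (F n)" unfolding F_def by (intro continuous_intros)
    then obtain p where "real_polynomial_function p"
      "\<And>y. y \<in> ?E ` cbox 0 1 \<Longrightarrow> \<bar>F n y - p y\<bar> < 1 / Suc n"
      by (rule Stone_Weierstrass_real_polynomial_function[OF comp(1), of "F n" "1 / Suc n"]) auto
    then show ?thesis by blast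
  qed
  then obtain p where p: "\<And>n. real_polynomial_function (p n)"
    "\<And>n y. y \<in> ?E ` cbox 0 1 \<Longrightarrow> \<bar>F n y - p n y\<bar> < 1 / Suc n" by metis
  have F01: "0 \<le> F n y" "F n y \<le> 1" for n y unfolding F_def using infdist_nonneg[of y] by auto
  have zero: "(LINT x|torus. h x * p n (?E x)) = 0"
    and meas: "(\<lambda>x. p n (?E x)) \<in> borel_measurable torus" for n
  proof -
    note * = integral_trig_poly_eq_0[OF h z trig_poly_polynomial[OF p(1)]]
    have "(LINT x|torus. complex_of_real (h x * p n (?E x))) = 0" using *[of n] by simp
    then have "of_real (LINT x|torus. h x * p n (?E x)) = (0::complex)" 
      by (simp only: integral_complex_of_real)
    then show "(LINT x|torus. h x * p n (?E x)) = 0" by simp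
    have "(\<lambda>x. Re (complex_of_real (p n (?E x)))) \<in> borel_measurable torus"
      by (rule measurable_compose[OF conjunct1[OF *] borel_measurable_Re])
    then show "(\<lambda>x. p n (?E x)) \<in> borel_measurable torus" by simp
  qed
  have Klim: "(\<lambda>n. p n (?E x)) \<longlonglongrightarrow> indicator K x" if x: "x \<in> box 0 1" for x
  proof -
    have "x \<in> cbox 0 1" using x box_subset_cbox by blast
    then have "(\<lambda>n. p n (?E x) - F n (?E x)) \<longlonglongrightarrow> 0"
      using p(2)[of "?E x"]
      by (intro tendsto_rabs_zero_cancel[OF tendsto_sandwich[OF _ _ tendsto_const LIMSEQ_Suc[OF lim_1_over_n]]])
         (auto intro!: always_eventually simp: abs_minus_commute less_imp_le)
    moreover have "(\<lambda>n. F n (?E x)) \<longlonglongrightarrow> indicator K x"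
    proof (cases "x \<in> K")
      case True
      then show ?thesis by (simp add: F_def)
    next
      case False
      have "?E x \<notin> ?E ` K" using False x K(2) inj_on_torus_embed by (auto dest: inj_onD)
      then have d: "infdist (?E x) (?E ` K) > 0"
        using comp(2) \<open>K \<noteq> {}\<close>
        by (simp add: infdist_pos_not_in_closed compact_imp_closed)
      obtain N where N: "real N * infdist (?E x) (?E ` K) > 1"
        using reals_Archimedean3[OF d] by blast
      have "F n (?E x) = 0" if "n \<ge> N" for n
      proof -
        have "real N * infdist (?E x) (?E ` K) \<le> real n * infdist (?E x) (?E ` K)"
          using that d by (intro mult_right_mono) auto
        then show ?thesis using N by (simp add: F_def)
      qed
      then have "(\<lambda>n. F n (?E x)) \<longlonglongrightarrow> 0"
        by (intro tendsto_eventually) (auto simp: eventually_sequentially)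
      with False show ?thesis by simp
    qed
    ultimately show ?thesis using tendsto_add by fastforce
  qed
  have [measurable]: "h \<in> borel_measurable torus" "K \<in> sets torus"
    using h K box_subset_cbox[of 0 "1::real^3"] by (auto intro!: sets_torusI compact_imp_sets_lebesgue)
  note [measurable] = meas
  have "(\<lambda>n. LINT x|torus. h x * p n (?E x)) \<longlonglongrightarrow> (LINT x|torus. h x * indicator K x)"
  \<comment> \<open>The factor 2: \<open>F\<close> takes values between 0 and 1, and the polynomial
    differs from it by less than 1.\<close>
  proof (rule integral_dominated_convergence[where w = "\<lambda>x. 2 * \<bar>h x\<bar>"])
    show "integrable torus (\<lambda>x. 2 * \<bar>h x\<bar>)" using h by simp
    show "AE x in torus. (\<lambda>n. h x * p n (?E x)) \<longlonglongrightarrow> h x * indicator K x"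
      using AE_torus_box by eventually_elim (intro tendsto_intros Klim)
    show "AE x in torus. norm (h x * p n (?E x)) \<le> 2 * \<bar>h x\<bar>" for n
      using AE_torus_box
    proof eventually_elim
      case (elim x)
      then have "?E x \<in> ?E ` cbox 0 1" using box_subset_cbox by blast
      from p(2)[OF this, of n] F01[of n "?E x"] have "\<bar>p n (?E x)\<bar> \<le> 2"
        by (smt (verit, best) divide_le_eq_1_pos of_nat_0_less_iff of_nat_1 of_nat_le_iff Suc_leI zero_less_Suc One_nat_def)
      then show ?case using mult_left_mono[of "\<bar>p n (?E x)\<bar>" 2 "\<bar>h x\<bar>"]
        by (simp add: abs_mult mult_ac)
    qed
  qed measurable
  then show ?thesis by (simp add: zero LIMSEQ_const_iff)
qed simp

text \<open>Up to a null set the positivity set is a countable union of compact sets. On each of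
  them \<open>h\<close> is positive with integral 0, so each is negligible.\<close>

lemma negligible_positive_part:
  fixes h :: "real^3 \<Rightarrow> real"
  assumes h: "integrable torus h" and z: "\<And>k. (LINT x|torus. h x * wave k x) = 0"
  shows "negligible {x \<in> box 0 1. h x > 0}"
proof -
  let ?A = "{x \<in> box 0 1. h x > 0}"
  have hm [measurable]: "h \<in> borel_measurable torus" using h by auto
  have "{x \<in> space torus. x \<in> box 0 1 \<and> h x > 0} \<in> sets torus"
  proof -
    have [measurable]: "box 0 1 \<in> sets torus"
      using box_subset_cbox[of 0 "1::real^3"] by (auto intro!: sets_torusI)
    show ?thesis by measurable
  qed
  moreover have "{x \<in> space torus. x \<in> box 0 1 \<and> h x > 0} = ?A"
    using box_subset_cbox[of 0 1] by (auto simp: torus_def)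
  ultimately have "?A \<in> sets torus" by simp
  then have A: "?A \<in> sets lebesgue"
    unfolding torus_def by (subst (asm) sets_restrict_space_iff) auto
  obtain C N where C: "fsigma C" "N \<in> null_sets lebesgue" "C \<union> N = ?A"
    by (rule lebesgue_set_almost_fsigma[OF A])
  then obtain F :: "nat \<Rightarrow> (real^3) set" where F: "range F \<subseteq> Collect compact" "C = \<Union>(range F)"
    using C(1) unfolding fsigma_Union_compact by blast
  have "negligible (F n)" for n
  proof -
    have K: "compact (F n)" "F n \<subseteq> box 0 1" "\<And>x. x \<in> F n \<Longrightarrow> h x > 0"
      using F C by auto
    have [measurable]: "F n \<in> sets torus"
      using K(1,2) box_subset_cbox[of 0 "1::real^3"]
      by (auto intro!: sets_torusI compact_imp_sets_lebesgue)
    have "(LINT x|torus. h x * indicator (F n) x) = 0"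
      by (rule integral_compact_eq_0[OF h z K(1,2)])
    moreover have "integrable torus (\<lambda>x. h x * indicator (F n) x)"
      by (rule integrable_real_mult_indicator) (use h in auto)
    ultimately have "AE x in torus. h x * indicator (F n) x = 0"
      using K(3) by (subst (asm) integral_nonneg_eq_0_iff_AE) (auto simp: indicator_def intro!: AE_I2 less_imp_le)
    then have "AE x in torus. x \<notin> F n"
      by eventually_elim (use K(3) in \<open>force simp: indicator_def\<close>)
    then have "AE x in lebesgue. x \<in> cbox 0 1 \<longrightarrow> x \<notin> F n"
      unfolding AE_torus_iff .
    then have "AE x in lebesgue. x \<notin> F n"
      by eventually_elim (use K(2) box_subset_cbox[of 0 1] in auto)
    then show ?thesis
      by (simp add: AE_lebesgue_iff)
  qed
  then have "negligible C" unfolding F(2) by (intro negligible_countable_Union) auto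
  then show ?thesis using C(2,3) by (metis negligible_Un negligible_iff_null_sets)
qed

lemma fourier_uniqueness:
  fixes h :: "real^3 \<Rightarrow> real"
  assumes h: "integrable torus h" and z: "\<And>k. (LINT x|torus. h x * wave k x) = 0"
  shows "AE x in torus. h x = 0"
proof -
  have "negligible {x \<in> box 0 1. h x > 0}" using h z by (rule negligible_positive_part)
  moreover have "negligible {x \<in> box 0 1. - h x > 0}"
    by (rule negligible_positive_part) (use h z in auto)
  ultimately have "AE x in lebesgue. x \<notin> {x \<in> box 0 1. h x > 0} \<union> {x \<in> box 0 1. - h x > 0}"
    by (simp only: AE_lebesgue_iff not_not Collect_mem_eq negligible_Un)
  then have "AE x in torus. x \<notin> {x \<in> box 0 1. h x > 0} \<union> {x \<in> box 0 1. - h x > 0}"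
    unfolding AE_torus_iff by eventually_elim auto
  then show ?thesis using AE_torus_box by eventually_elim auto
qed

text \<open>The exceptional set is covered by the countably many integer translates of its part in
  the unit cell.\<close>

lemma AE_torus_imp_AE_lebesgue:
  assumes AE: "AE x in torus. P x" and per: "\<And>x k. P (x + of_int_vec k) \<longleftrightarrow> P x"
  shows "AE x in lebesgue. P x"
proof -
  have N: "negligible {x \<in> cbox 0 1. \<not> P x}"
    using AE unfolding AE_torus_iff AE_lebesgue_iff by simp
  have "negligible (\<Union>k. (+) (of_int_vec k) ` {x \<in> cbox 0 1. \<not> P x})"
    by (intro negligible_countable_Union countableI_type countable_image)
       (use N in \<open>auto simp: negligible_translation\<close>)
  moreover have "{x. \<not> P x} \<subseteq> (\<Union>k. (+) (of_int_vec k) ` {x \<in> cbox 0 1. \<not> P x})"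
  proof
    fix x assume "x \<in> {x. \<not> P x}"
    define k :: "int^3" where "k = (\<chi> i. \<lfloor>x $ i\<rfloor>)"
    have "x = of_int_vec k + (x - of_int_vec k)" by simp
    moreover have "x - of_int_vec k \<in> cbox 0 1"
      by (auto simp: mem_box_cart k_def) linarith+
    moreover have "\<not> P (x - of_int_vec k)"
      using \<open>x \<in> _\<close> per[of "x - of_int_vec k" k] by simp
    ultimately show "x \<in> (\<Union>k. (+) (of_int_vec k) ` {x \<in> cbox 0 1. \<not> P x})" by blast
  qed
  ultimately have "negligible {x. \<not> P x}" by (rule negligible_subset)
  then show ?thesis by (simp add: AE_lebesgue_iff)
qed

section \<open>Frequency shells and triads\<close>

definition pm_shell :: "nat \<Rightarrow> (int^3) set" where
  "pm_shell n = shell n \<union> uminus ` shell n"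

text \<open>In the plane orthogonal to \<open>sigma\<close> the two lists are the short and the long
  roots of a system of type G2. Written out, they let the simplifier decide membership.\<close>

definition shell_dirs :: "nat \<Rightarrow> (int^3) set" where
  "shell_dirs n = (if even n
     then {vector [1,0,-1], vector [1,-1,0], vector [0,1,-1], vector [0,-1,1], vector [-1,0,1], vector [-1,1,0]}
     else {vector [1,1,-2], vector [1,-2,1], vector [-2,1,1], vector [2,-1,-1], vector [-1,2,-1], vector [-1,-1,2]})"

text \<open>Integer division lets one formula serve both parities: the exponent of 3 is
  \<open>m\<close> for \<open>n = 2 * m\<close> as well as for \<open>n = 2 * m + 1\<close>.\<close>

definition shell_point :: "nat \<Rightarrow> int^3 \<Rightarrow> int^3" where
  "shell_point n d = 2 ^ n *s sigma + 3 ^ (n div 2) *s d"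

lemma vec3_eq_iff: "(x::'a^3) = y \<longleftrightarrow> x $ 1 = y $ 1 \<and> x $ 2 = y $ 2 \<and> x $ 3 = y $ 3"
  by (simp add: vec_eq_iff forall_3)

lemma permutations_of_vec_eq:
  "permutations_of_vec v = {vector [v$1, v$2, v$3], vector [v$1, v$3, v$2], vector [v$2, v$1, v$3],
     vector [v$2, v$3, v$1], vector [v$3, v$1, v$2], vector [v$3, v$2, v$1]}" (is "_ = ?R")
proof (intro equalityI subsetI)
  fix w assume "w \<in> permutations_of_vec v"
  then obtain p where p: "bij p" "w = permute_vec p v" by (auto simp: permutations_of_vec_def)
  then have "p 1 \<noteq> p 2" "p 1 \<noteq> p 3" "p 2 \<noteq> p 3" by (simp_all add: inj_eq[OF bij_is_inj])
  moreover have "w = vector [v $ p 1, v $ p 2, v $ p 3]"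
    by (simp add: p(2) permute_vec_def vec3_eq_iff)
  ultimately show "w \<in> ?R"
    using exhaust_3[of "p 1"] exhaust_3[of "p 2"] exhaust_3[of "p 3"] by (elim disjE) simp_all
next
  have *: "vector [v$a, v$b, v$c] \<in> permutations_of_vec v" if "a \<noteq> b" "a \<noteq> c" "b \<noteq> c" for a b c
  proof -
    define p :: "3 \<Rightarrow> 3" where "p i = (if i = 1 then a else if i = 2 then b else c)" for i
    have "inj p" using that by (auto simp: inj_def p_def forall_3)
    then have "bij p" by (simp add: bij_def finite_UNIV_inj_surj)
    moreover have "vector [v$a, v$b, v$c] = permute_vec p v"
      by (simp add: permute_vec_def vec3_eq_iff p_def)
    ultimately show ?thesis unfolding permutations_of_vec_def by blast
  qed
  fix w assume "w \<in> ?R"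
  then show "w \<in> permutations_of_vec v" by (auto intro!: *)
qed

lemma shell_eq: "shell n = shell_point n ` shell_dirs n"
proof (cases "even n")
  case True
  then have "2 * (n div 2) = n" by simp
  with True show ?thesis
    by (auto simp: shell_def shell_dirs_def shell_point_def permutations_of_vec_eq freq_k_def sigma_def
        vec3_eq_iff)
next
  case False
  then have "Suc (2 * (n div 2)) = n" by simp
  with False show ?thesis
    by (auto simp: shell_def shell_dirs_def shell_point_def permutations_of_vec_eq freq_h_def freq_j_def
        sigma_def vec3_eq_iff)
qed

lemma inj_shell_point: "inj (shell_point n)"
  by (auto simp: inj_def shell_point_def vec3_eq_iff)

lemma card_shell: "card (shell n) = 6"
  unfolding shell_eq card_image[OF inj_on_subset[OF inj_shell_point subset_UNIV]]
  by (simp add: shell_dirs_def vec3_eq_iff)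

lemma finite_shell [simp]: "finite (shell n)"
  by (simp add: shell_eq shell_dirs_def)

lemma finite_pm_shell [simp]: "finite (pm_shell n)"
  by (simp add: pm_shell_def)

lemma shell_dirs_props:
  assumes "d \<in> shell_dirs n"
  shows "d $ 1 + d $ 2 + d $ 3 = 0"
    and "(d $ 1)\<^sup>2 + (d $ 2)\<^sup>2 + (d $ 3)\<^sup>2 = (if even n then 2 else 6)"
  using assms by (auto simp: shell_dirs_def split: if_splits)

definition knorm2 :: "nat \<Rightarrow> real" where
  "knorm2 n = 3 * 4 ^ n + 2 * 3 ^ n"

lemma knorm2_pos: "knorm2 n > 0"
  by (simp add: knorm2_def add_pos_pos)

lemma shell_total: "k \<in> shell n \<Longrightarrow> k $ 1 + k $ 2 + k $ 3 = 3 * 2 ^ n"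
  using shell_dirs_props(1)
  by (force simp: shell_eq shell_point_def sigma_def simp flip: distrib_left)

lemma shell_inner_sigma:
  assumes "k \<in> shell n"
  shows "of_int_vec k \<bullet> of_int_vec sigma = 3 * 2 ^ n"
proof -
  have "of_int_vec k \<bullet> of_int_vec sigma = of_int (k $ 1 + k $ 2 + k $ 3)"
    by (simp add: inner_vec_def sum_3 sigma_def)
  then show ?thesis using shell_total[OF assms] by simp
qed

lemma shell_inner_self:
  assumes "k \<in> shell n"
  shows "of_int_vec k \<bullet> of_int_vec k = knorm2 n"
proof -
  obtain d where d: "d \<in> shell_dirs n" "k = shell_point n d" using assms by (auto simp: shell_eq)
  define e :: int where "e = 3 ^ (n div 2)"
  \<comment> \<open>The factor 3 that \<open>n div 2\<close> loses for odd \<open>n\<close> is made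
    up by the longer displacements, of squared length 6 instead of 2.\<close>
  have e: "e\<^sup>2 * (if even n then 2 else 6) = 2 * 3 ^ n"
  proof (cases "even n")
    case True
    then have "e\<^sup>2 = 3 ^ n" unfolding e_def by (simp flip: power_mult)
    then show ?thesis using True by simp
  next
    case False
    then have "n = Suc (2 * (n div 2))" by simp
    then have "(3::int) ^ n = 3 * e\<^sup>2" unfolding e_def by (metis power_Suc power_mult mult.commute)
    then show ?thesis using False by simp
  qed
  have "of_int_vec k \<bullet> of_int_vec k = of_int (k $ 1 * k $ 1 + k $ 2 * k $ 2 + k $ 3 * k $ 3)"
    by (simp add: inner_vec_def sum_3)
  also have "k $ 1 * k $ 1 + k $ 2 * k $ 2 + k $ 3 * k $ 3 =
      3 * (2 ^ n)\<^sup>2 + 2 * 2 ^ n * e * (d $ 1 + d $ 2 + d $ 3) +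
      e\<^sup>2 * ((d $ 1)\<^sup>2 + (d $ 2)\<^sup>2 + (d $ 3)\<^sup>2)"
    by (simp add: d(2) shell_point_def sigma_def e_def[symmetric] power2_eq_square algebra_simps)
  also have "\<dots> = 3 * 4 ^ n + 2 * 3 ^ n"
    by (simp only: shell_dirs_props[OF d(1)] e) (simp flip: power_mult power_mult_distrib add: power2_eq_square)
  finally show ?thesis by (simp add: knorm2_def)
qed

lemma pm_shell_norm:
  assumes "k \<in> pm_shell n"
  shows "(norm (of_int_vec k))\<^sup>2 = knorm2 n"
  using assms by (auto simp: pm_shell_def power2_norm_eq_inner shell_inner_self)

lemma pm_shell_total_abs:
  assumes "k \<in> pm_shell n"
  shows "\<bar>k $ 1 + k $ 2 + k $ 3\<bar> = 3 * 2 ^ n"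
proof -
  have "k \<in> shell n \<or> - k \<in> shell n" using assms by (auto simp: pm_shell_def)
  then have "k $ 1 + k $ 2 + k $ 3 = 3 * 2 ^ n \<or> - (k $ 1 + k $ 2 + k $ 3) = 3 * 2 ^ n"
    using shell_total[of k n] shell_total[of "- k" n] by auto
  moreover have "(0::int) < 2 ^ n" by simp
  ultimately show ?thesis by linarith
qed

lemma pm_shell_uminus [simp]: "- k \<in> pm_shell n \<longleftrightarrow> k \<in> pm_shell n"
  by (auto simp: pm_shell_def image_iff) (metis minus_minus)+

lemma M_freq_eq: "M_freq = (\<Union>n. pm_shell n)"
  by (auto simp: M_freq_def M_plus_def pm_shell_def)

lemma M_freq_uminus [simp]: "- k \<in> M_freq \<longleftrightarrow> k \<in> M_freq"
  by (simp add: M_freq_eq)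

lemma M_freqI: "k \<in> pm_shell n \<Longrightarrow> k \<in> M_freq"
  by (auto simp: M_freq_eq)

lemma shell_subset_pm: "k \<in> shell n \<Longrightarrow> k \<in> pm_shell n"
  by (simp add: pm_shell_def)

lemma pm_shell_disjoint:
  assumes "k \<in> pm_shell m" "k \<in> pm_shell n"
  shows "m = n"
proof -
  have "(2::int) ^ m = 2 ^ n"
    using assms[THEN pm_shell_total_abs] by simp
  then show ?thesis by (simp add: power_inject_exp)
qed

lemma shell_uminus_disjoint: "k \<in> shell m \<Longrightarrow> - k \<notin> shell n"
proof
  assume k: "k \<in> shell m" "- k \<in> shell n"
  then have "k $ 1 + k $ 2 + k $ 3 = 3 * 2 ^ m" "- (k $ 1 + k $ 2 + k $ 3) = 3 * 2 ^ n"
    using shell_total[OF k(1)] shell_total[OF k(2)] by auto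
  then show False using zero_less_power[of "2::int" m] zero_less_power[of "2::int" n] by linarith
qed

lemma zero_notin_M [simp]: "0 \<notin> M_freq"
  using pm_shell_total_abs[of 0] by (auto simp: M_freq_eq)

section \<open>Triads and their finiteness\<close>

lemma pow2_triad_bound:
  fixes x y z :: int
  assumes "x + y = z" "\<bar>x\<bar> = 3 * 2 ^ a" "\<bar>y\<bar> = 3 * 2 ^ b" "\<bar>z\<bar> = 3 * 2 ^ c"
  shows "a \<le> Suc c"
proof (rule ccontr)
  assume "\<not> a \<le> Suc c"
  then have "Suc (Suc c) \<le> a" by simp
  then have ca: "(2::int) ^ Suc (Suc c) \<le> 2 ^ a" by (intro power_increasing) auto
  have c0: "(0::int) < 2 ^ b" "(0::int) < 2 ^ c" by simp_all
  have cases: "x = 3 * 2 ^ a \<or> x = - (3 * 2 ^ a)" "y = 3 * 2 ^ b \<or> y = - (3 * 2 ^ b)"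
    "z = 3 * 2 ^ c \<or> z = - (3 * 2 ^ c)"
    using assms(2-4) by linarith+
  \<comment> \<open>Equal powers give 0 or a doubling, different ones leave at least half of the
    larger. Neither has modulus \<open>3 * 2 ^ c\<close> when \<open>a\<close> is at least
    \<open>c + 2\<close>.\<close>
  consider "b = a" | "Suc b \<le> a" | "Suc a \<le> b" by linarith
  then show False
  proof cases
    case 1
    then show ?thesis using assms(1) cases ca c0 unfolding power_Suc 1 by (elim disjE; linarith)
  next
    case 2
    then have "(2::int) ^ Suc b \<le> 2 ^ a" by (intro power_increasing) auto
    then show ?thesis using assms(1) cases ca c0 unfolding power_Suc by (elim disjE; linarith)
  next
    case 3
    then have "(2::int) ^ Suc a \<le> 2 ^ b" by (intro power_increasing) auto
    then show ?thesis using assms(1) cases ca c0 unfolding power_Suc by (elim disjE; linarith)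
  qed
qed

lemma triad_shell_bound:
  assumes "p \<in> pm_shell a" "q \<in> pm_shell b" "p + q \<in> pm_shell c"
  shows "a \<le> Suc c" "b \<le> Suc c"
proof -
  note * = assms[THEN pm_shell_total_abs]
  show "a \<le> Suc c" by (rule pow2_triad_bound[OF _ *]) simp
  show "b \<le> Suc c" by (rule pow2_triad_bound[OF _ *(2,1,3)]) simp
qed

definition triads :: "int^3 \<Rightarrow> ((int^3) \<times> (int^3)) set" where
  "triads k = {(p, q). p \<in> M_freq \<and> q \<in> M_freq \<and> p + q = k}"

definition freqs_below :: "nat \<Rightarrow> (int^3) set" where
  "freqs_below N = (\<Union>n<N. pm_shell n)"

lemma finite_freqs_below [simp]: "finite (freqs_below N)"
  by (simp add: freqs_below_def)

lemma freqs_below_M: "k \<in> freqs_below N \<Longrightarrow> k \<in> M_freq"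
  by (auto simp: freqs_below_def M_freq_eq)

lemma freqs_below_uminus [simp]: "- k \<in> freqs_below N \<longleftrightarrow> k \<in> freqs_below N"
  by (auto simp: freqs_below_def)

lemma pm_shell_freqs_below: "k \<in> pm_shell n \<Longrightarrow> k \<in> freqs_below N \<longleftrightarrow> n < N"
  using pm_shell_disjoint by (auto simp: freqs_below_def)

text \<open>A cutoff that includes the shell \<open>n + 1\<close> already captures every triad at
  \<open>k\<close>, so truncated convolutions are eventually constant in \<open>N\<close>.\<close>

lemma triads_eq:
  assumes "k \<in> pm_shell n" "n + 2 \<le> N"
  shows "triads k = {(p, q) \<in> freqs_below N \<times> freqs_below N. p + q = k}"
proof -
  have "p \<in> freqs_below N \<and> q \<in> freqs_below N"
    if pq: "p \<in> M_freq" "q \<in> M_freq" "p + q = k" for p q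
  proof -
    obtain a b where ab: "p \<in> pm_shell a" "q \<in> pm_shell b" using pq by (auto simp: M_freq_eq)
    with triad_shell_bound[of p a q b n] assms pq
    show ?thesis by (simp add: pm_shell_freqs_below)
  qed
  then show ?thesis by (auto simp: triads_def dest: freqs_below_M)
qed

text \<open>For \<open>a < b\<close> the sum lies strictly between \<open>2 ^ b\<close> and
  \<open>2 ^ Suc b\<close>, hence is not a power of 2.\<close>

lemma pow2_sum_eq:
  assumes "(2::int) ^ a + 2 ^ b = 2 ^ c"
  shows "b = a \<and> c = Suc a"
proof -
  have less: False if "(2::int) ^ a + 2 ^ b = 2 ^ c" "a < b" for a b c :: nat
  proof -
    have "(2::int) ^ Suc a \<le> 2 ^ b" using that by (intro power_increasing) auto
    moreover have "(0::int) < 2 ^ a" by simp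
    ultimately have "(2::int) ^ b < 2 ^ c" "(2::int) ^ c < 2 ^ Suc b"
      using that(1) unfolding power_Suc by linarith+
    then have "b < c" "c < Suc b" by (auto simp only: power_strict_increasing_iff one_less_numeral_iff semiring_norm)
    then show False by simp
  qed
  have "a = b" using less[of a b c] less[of b a c] assms by (metis add.commute linorder_neqE_nat)
  then have "(2::int) ^ Suc a = 2 ^ c" using assms by simp
  then show ?thesis using \<open>a = b\<close> by (simp add: power_inject_exp del: power_Suc)
qed

text \<open>The coordinate sums turn each sign pattern of \<open>p\<close> and \<open>q\<close> into
  an equation between powers of 2 with positive terms, to which \<open>pow2_sum_eq\<close> applies.
  Two negative signs would give a vanishing sum of positive numbers.\<close>

lemma triad_cases:
  assumes k: "k \<in> shell n" and pq: "p \<in> M_freq" "q \<in> M_freq" "p + q = k"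
  shows "(\<exists>m. n = Suc m \<and> p \<in> shell m \<and> q \<in> shell m)
    \<or> (p \<in> shell (Suc n) \<and> - q \<in> shell n) \<or> (q \<in> shell (Suc n) \<and> - p \<in> shell n)"
proof -
  obtain a where a: "p \<in> shell a \<or> - p \<in> shell a"
    using pq(1) by (fastforce simp: M_freq_def M_plus_def)
  obtain b where b: "q \<in> shell b \<or> - q \<in> shell b"
    using pq(2) by (fastforce simp: M_freq_def M_plus_def)
  have tot: "p $ 1 + p $ 2 + p $ 3 + (q $ 1 + q $ 2 + q $ 3) = 3 * 2 ^ n"
    using shell_total[OF k] pq(3) by (auto simp: vec3_eq_iff)
  have t: "l $ 1 + l $ 2 + l $ 3 = - 3 * 2 ^ c" if "- l \<in> shell c" for l :: "int^3" and c
    using shell_total[OF that] by simp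
  consider "p \<in> shell a" "q \<in> shell b" | "p \<in> shell a" "- q \<in> shell b"
    | "- p \<in> shell a" "q \<in> shell b" | "- p \<in> shell a" "- q \<in> shell b"
    using a b by blast
  then show ?thesis
  proof cases
    case 1
    then have "(2::int) ^ a + 2 ^ b = 2 ^ n" using tot shell_total by simp
    from pow2_sum_eq[OF this] 1 show ?thesis by blast
  next
    case 2
    then have "(2::int) ^ b + 2 ^ n = 2 ^ a" using tot shell_total[OF 2(1)] t[OF 2(2)] by simp
    from pow2_sum_eq[OF this] 2 show ?thesis by blast
  next
    case 3
    then have "(2::int) ^ a + 2 ^ n = 2 ^ b" using tot shell_total[OF 3(2)] t[OF 3(1)] by simp
    from pow2_sum_eq[OF this] 3 show ?thesis by blast
  next
    case 4
    then have "(2::int) ^ a + 2 ^ b + 2 ^ n = 0" using tot t[OF 4(1)] t[OF 4(2)] by simp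
    moreover have "(0::int) < 2 ^ a" "(0::int) < 2 ^ b" "(0::int) < 2 ^ n" by simp_all
    ultimately show ?thesis by linarith
  qed
qed

text \<open>For a symmetric field the coefficient at this one frequency determines the whole shell,
  so the nonlinearity is evaluated only here.\<close>

definition shell_rep :: "nat \<Rightarrow> int^3" where
  "shell_rep n = shell_point n (if even n then vector [1,0,-1] else vector [1,1,-2])"

lemma shell_rep_in_shell: "shell_rep n \<in> shell n"
  by (auto simp: shell_rep_def shell_eq shell_dirs_def)

lemma filter_insert: "{d \<in> insert a S. P d} = (if P a then insert a {d \<in> S. P d} else {d \<in> S. P d})"
  by auto

text \<open>The minuend is the displacement of \<open>shell_rep (Suc m)\<close>, measured in units
  of \<open>3 ^ (m div 2)\<close>. The factor 3 for odd \<open>m\<close> reflects that the integer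
  quotient has increased by 1.\<close>

lemma shell_dirs_diff:
  "{d \<in> shell_dirs m. (if even m then vector [1,1,-2] else 3 *s vector [1,0,-1]) - d \<in> shell_dirs m} =
   (if even m then {vector [1,0,-1], vector [0,1,-1]} else {vector [2,-1,-1], vector [1,1,-2]})"
  by (cases "even m"; simp only: shell_dirs_def filter_insert if_True if_False;
      simp add: vec3_eq_iff insert_commute)

text \<open>A vertex of the next hexagon is the sum of exactly one pair of adjacent vertices of this
  one; the pair is counted in both orders.\<close>

lemma card_shell_diff: "card {p \<in> shell m. shell_rep (Suc m) - p \<in> shell m} = 2"
proof -
  let ?D = "{d \<in> shell_dirs m. (if even m then vector [1,1,-2] else 3 *s vector [1,0,-1]) - d \<in> shell_dirs m}"
  have pt: "shell_rep (Suc m) - shell_point m d =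
      shell_point m ((if even m then vector [1,1,-2] else 3 *s vector [1,0,-1]) - d)" for d
  proof (cases "even m")
    case True
    then have "Suc m div 2 = m div 2" by simp
    with True show ?thesis by (simp add: shell_rep_def shell_point_def vec3_eq_iff sigma_def algebra_simps)
  next
    case False
    then have "Suc m div 2 = Suc (m div 2)" by simp
    with False show ?thesis by (simp add: shell_rep_def shell_point_def vec3_eq_iff sigma_def algebra_simps)
  qed
  have "{p \<in> shell m. shell_rep (Suc m) - p \<in> shell m} = shell_point m ` ?D"
    by (auto simp: shell_eq pt dest!: injD[OF inj_shell_point] intro!: imageI)
  then have "card {p \<in> shell m. shell_rep (Suc m) - p \<in> shell m} = card ?D"
    by (simp add: card_image inj_on_subset[OF inj_shell_point])
  also have "\<dots> = 2" unfolding shell_dirs_diff by (simp add: vec3_eq_iff)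
  finally show ?thesis .
qed

lemma shell_dirs_add:
  "{d \<in> shell_dirs n. 
      (if even n then vector [1,0,-1] else vector [1,1,-2]) + d \<in>
        (\<lambda>d'. if even n then d' else 3 *s d') ` shell_dirs (Suc n)} =
   (if even n then {vector [1,-1,0], vector [0,1,-1]} else {vector [2,-1,-1], vector [-1,2,-1]})"
  by (cases "even n"; simp only: shell_dirs_def filter_insert if_True if_False even_Suc;
      simp add: vec3_eq_iff insert_commute)

text \<open>Only the two neighbours of a vertex in its hexagon give a sum of the length required in
  the next one.\<close>

lemma card_shell_add: "card {q \<in> shell n. shell_rep n + q \<in> shell (Suc n)} = 2"
proof -
  let ?P = "\<lambda>d d'. (if even n then vector [1,0,-1] else vector [1,1,-2]) + d = (if even n then d' else 3 *s d')"
  let ?D = "{d \<in> shell_dirs n.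
      (if even n then vector [1,0,-1] else vector [1,1,-2]) + d \<in>
        (\<lambda>d'. if even n then d' else 3 *s d') ` shell_dirs (Suc n)}"
  have cancel: "(3::int) ^ e *s x = 3 ^ e *s y \<longleftrightarrow> x = y" for e and x y :: "int^3"
    by (simp add: vec3_eq_iff)
  have pt1: "shell_rep n + shell_point n d = 2 ^ Suc n *s sigma +
      3 ^ (n div 2) *s ((if even n then vector [1,0,-1] else vector [1,1,-2]) + d)" for d
    by (simp add: shell_rep_def shell_point_def vec3_eq_iff sigma_def algebra_simps)
  have pt2: "shell_point (Suc n) d' = 2 ^ Suc n *s sigma +
      3 ^ (n div 2) *s (if even n then d' else 3 *s d')" for d'
    by (cases "even n") (simp_all add: shell_point_def vec3_eq_iff)
  have pt: "shell_rep n + shell_point n d = shell_point (Suc n) d' \<longleftrightarrow> ?P d d'" for d d'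
    unfolding pt1 pt2 by (simp only: add_left_cancel cancel)
  have "shell_rep n + shell_point n d \<in> shell (Suc n) \<longleftrightarrow> d \<in> {d.
      (if even n then vector [1,0,-1] else vector [1,1,-2]) + d \<in>
        (\<lambda>d'. if even n then d' else 3 *s d') ` shell_dirs (Suc n)}" for d
    unfolding shell_eq image_iff pt by blast
  then have "{q \<in> shell n. shell_rep n + q \<in> shell (Suc n)} = shell_point n ` ?D"
    unfolding shell_eq[of n] by blast
  then have "card {q \<in> shell n. shell_rep n + q \<in> shell (Suc n)} = card ?D"
    by (simp add: card_image inj_on_subset[OF inj_shell_point])
  also have "\<dots> = 2" unfolding shell_dirs_add by (simp add: vec3_eq_iff)
  finally show ?thesis .
qed

section \<open>Directions of the modes and the coupling within a triad\<close>

abbreviation sigma_vec :: "real^3" where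
  "sigma_vec \<equiv> of_int_vec sigma"

text \<open>The reciprocal of \<open>norm (perp_sigma k)\<close> for \<open>k\<close> on the n-th
  shell.\<close>

definition dir_coeff :: "nat \<Rightarrow> real" where
  "dir_coeff n = sqrt (knorm2 n / (6 * 3 ^ n))"

lemma knorm2_frac: "3 - 9 * 4 ^ n / knorm2 n = 6 * 3 ^ n / knorm2 n"
proof -
  have "3 * knorm2 n - 9 * 4 ^ n = 6 * 3 ^ n" by (simp add: knorm2_def)
  then show ?thesis using knorm2_pos[of n] by (simp add: field_simps)
qed

lemma sigma_inner_sigma: "sigma_vec \<bullet> sigma_vec = 3"
  by (simp add: inner_vec_def sum_3 sigma_def)

lemma perp_sigma_uminus: "perp_sigma (- k) = perp_sigma k"
  by (simp add: perp_sigma_def)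

lemma v_dir_uminus [simp]: "v_dir (- k) = v_dir k"
  by (simp add: v_dir_def perp_sigma_uminus)

lemma v_dir_shell:
  assumes "k \<in> shell n"
  shows "v_dir k = dir_coeff n *\<^sub>R (sigma_vec - (3 * 2 ^ n / knorm2 n) *\<^sub>R of_int_vec k)"
proof -
  have p: "perp_sigma k = sigma_vec - (3 * 2 ^ n / knorm2 n) *\<^sub>R of_int_vec k"
    using assms by (simp add: perp_sigma_def shell_inner_sigma pm_shell_norm[OF shell_subset_pm])
  have "(norm (perp_sigma k))\<^sup>2 = 3 - 9 * 4 ^ n / knorm2 n"
    using assms knorm2_pos[of n]
    by (simp add: p power2_norm_eq_inner inner_diff_left inner_diff_right sigma_inner_sigma
        shell_inner_sigma shell_inner_self inner_commute[of sigma_vec "of_int_vec k"])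
      (simp add: field_simps flip: power_mult_distrib)
  also have "\<dots> = 6 * 3 ^ n / knorm2 n" by (rule knorm2_frac)
  finally have "norm (perp_sigma k) = sqrt (6 * 3 ^ n / knorm2 n)"
    by (metis norm_ge_zero real_sqrt_unique)
  then have "1 / norm (perp_sigma k) = dir_coeff n"
    by (simp add: dir_coeff_def real_sqrt_divide)
  then show ?thesis by (simp add: v_dir_def p)
qed

lemma norm_v_dir:
  assumes "k \<in> M_freq"
  shows "norm (v_dir k) = 1"
proof -
  have *: "norm (v_dir k) = 1" if k: "k \<in> shell n" for k n
  proof -
    have "v_dir k \<bullet> v_dir k = (dir_coeff n)\<^sup>2 * (3 - 9 * 4 ^ n / knorm2 n)"
      using k knorm2_pos[of n]
      by (simp add: v_dir_shell[OF k] inner_diff_left inner_diff_right sigma_inner_sigma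
          shell_inner_sigma shell_inner_self inner_commute[of sigma_vec "of_int_vec k"])
        (simp add: field_simps power2_eq_square flip: power_mult_distrib)
    also have "\<dots> = 1"
      using knorm2_pos[of n] by (simp add: knorm2_frac dir_coeff_def)
    finally show ?thesis by (simp add: norm_eq_1)
  qed
  from assms obtain n where "k \<in> shell n \<or> - k \<in> shell n"
    by (fastforce simp: M_freq_def M_plus_def)
  then show ?thesis using *[of k n] *[of "- k" n] by auto
qed

lemma dir_coeff_pos: "dir_coeff n > 0"
  using knorm2_pos[of n] by (simp add: dir_coeff_def)

lemma inner_v_dir_self:
  assumes "k \<in> shell n"
  shows "of_int_vec k \<bullet> v_dir k = 0"
  using assms knorm2_pos[of n]
  by (simp add: v_dir_shell inner_diff_right shell_inner_self shell_inner_sigma)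

text \<open>In a triad \<open>p + q = k\<close> with \<open>p, q\<close> on one shell and \<open>k\<close> on the next one, all inner products
  are determined by the lengths \<open>knorm2\<close>.\<close>

lemma triad_inner:
  assumes "p \<in> shell m" "q \<in> shell m" "p + q \<in> shell (Suc m)"
  shows "of_int_vec (p + q) \<bullet> of_int_vec q = knorm2 (Suc m) / 2"
    and "of_int_vec (p + q) \<bullet> of_int_vec p = knorm2 (Suc m) / 2"
proof -
  note * = assms[THEN shell_inner_self]
  show "of_int_vec (p + q) \<bullet> of_int_vec q = knorm2 (Suc m) / 2"
    "of_int_vec (p + q) \<bullet> of_int_vec p = knorm2 (Suc m) / 2"
    using * by (simp_all add: inner_add_left inner_add_right inner_commute[of "of_int_vec q" "of_int_vec p"])
qed

text \<open>In the difference of the two terms of \<open>v_dir_shell\<close> the powers of 4 cancel,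
  because \<open>2 * knorm2 m - knorm2 (Suc m) / 2 = 3 ^ m\<close>.\<close>

lemma triad_inner_v_dir_low:
  assumes "p \<in> shell m" "q \<in> shell m" "p + q \<in> shell (Suc m)"
  shows "of_int_vec (p + q) \<bullet> v_dir q = dir_coeff m * (3 * 6 ^ m / knorm2 m)"
proof -
  have "of_int_vec (p + q) \<bullet> v_dir q =
      dir_coeff m * (3 * 2 ^ Suc m - 3 * 2 ^ m / knorm2 m * (knorm2 (Suc m) / 2))"
    unfolding v_dir_shell[OF assms(2)] inner_scaleR_right inner_diff_right
      triad_inner(1)[OF assms] shell_inner_sigma[OF assms(3)] by simp
  also have "3 * 2 ^ Suc m - 3 * 2 ^ m / knorm2 m * (knorm2 (Suc m) / 2) = 3 * 6 ^ m / knorm2 m"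
    using knorm2_pos[of m] by (simp add: field_simps) (simp add: knorm2_def algebra_simps flip: power_mult_distrib)
  finally show ?thesis .
qed

text \<open>As \<open>p\<close> and \<open>q\<close> agree in length and in their product with
  \<open>sigma_vec\<close>, the difference \<open>p - q\<close> is orthogonal to
  \<open>p + q\<close> and to \<open>sigma_vec\<close>, hence to \<open>v_dir (p + q)\<close>; so is
  \<open>p + q\<close> itself. This annihilates one of the two orderings of a triad that reaches
  into the shell above.\<close>

lemma triad_inner_v_dir_high:
  assumes "p \<in> shell m" "q \<in> shell m" "p + q \<in> shell (Suc m)"
  shows "of_int_vec p \<bullet> v_dir (p + q) = 0"
proof -
  have "of_int_vec p \<bullet> v_dir (p + q) =
      dir_coeff (Suc m) * (3 * 2 ^ m - 3 * 2 ^ Suc m / knorm2 (Suc m) * (knorm2 (Suc m) / 2))"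
    unfolding v_dir_shell[OF assms(3)] inner_scaleR_right inner_diff_right
      inner_commute[of "of_int_vec p" "of_int_vec (p + q)"]
      triad_inner(2)[OF assms] shell_inner_sigma[OF assms(1)] by simp
  then show ?thesis using knorm2_pos[of "Suc m"] by simp
qed

lemma beta_eq: "beta n = 1 / sqrt (1 + 1 / 2 * (3 / 4) ^ n)"
proof -
  have "1 + 1 / 2 * (3 / 4) ^ n \<ge> (0::real)" by simp
  then show ?thesis
    unfolding beta_def minus_divide_left[symmetric] powr_minus_divide by (simp add: powr_half_sqrt)
qed

text \<open>All factors are explicit in the two lengths. The factor \<open>beta m\<close> originates
  in \<open>knorm2 (Suc m) = 12 * 4 ^ m * (1 + 1 / 2 * (3 / 4) ^ m)\<close>, whose square root
  enters through \<open>dir_coeff (Suc m)\<close>.\<close>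

lemma triad_coupling:
  assumes "p \<in> shell m" "q \<in> shell m" "p + q \<in> shell (Suc m)"
  shows "(of_int_vec (p + q) \<bullet> v_dir q) * (v_dir (p + q) \<bullet> v_dir p) =
    sqrt 3 ^ Suc m / (2 * sqrt 2) * beta m"
proof -
  let ?K = "knorm2 m" and ?L = "knorm2 (Suc m)"
  note K = knorm2_pos[of m] knorm2_pos[of "Suc m"]
  \<comment> \<open>The preceding formula with the roles of \<open>p\<close> and \<open>q\<close>
    exchanged.\<close>
  have comm: "of_int_vec (q + p) \<bullet> v_dir p = dir_coeff m * (3 * 6 ^ m / ?K)"
    using assms by (intro triad_inner_v_dir_low) (simp_all add: add.commute)
  have sig: "sigma_vec \<bullet> v_dir p = dir_coeff m * (6 * 3 ^ m / ?K)"
  proof -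
    have "sigma_vec \<bullet> v_dir p = dir_coeff m * (3 - 3 * 2 ^ m / ?K * (3 * 2 ^ m))"
      unfolding v_dir_shell[OF assms(1)] inner_scaleR_right inner_diff_right
        inner_commute[of sigma_vec "of_int_vec p"] shell_inner_sigma[OF assms(1)] sigma_inner_sigma by simp
    also have "3 - 3 * 2 ^ m / ?K * (3 * 2 ^ m) = 6 * 3 ^ m / ?K"
      using K by (simp add: field_simps) (simp add: knorm2_def flip: power_mult_distrib)
    finally show ?thesis .
  qed
  have "v_dir (p + q) \<bullet> v_dir p = dir_coeff (Suc m) *
      (dir_coeff m * (6 * 3 ^ m / ?K) - 3 * 2 ^ Suc m / ?L * (dir_coeff m * (3 * 6 ^ m / ?K)))"
    unfolding v_dir_shell[OF assms(3)] inner_scaleR_left inner_diff_left sig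
    using comm by (simp add: add.commute)
  also have "\<dots> = dir_coeff (Suc m) * dir_coeff m * (18 * 3 ^ m / ?L)"
  proof -
    have "6 * 3 ^ m / ?K - 3 * 2 ^ Suc m / ?L * (3 * 6 ^ m / ?K) = 6 * 3 ^ m * (?L - 3 * 4 ^ m) / (?K * ?L)"
      using K by (simp add: field_simps flip: power_mult_distrib)
    also have "?L - 3 * 4 ^ m = 3 * ?K" by (simp add: knorm2_def)
    finally have "6 * 3 ^ m / ?K - 3 * 2 ^ Suc m / ?L * (3 * 6 ^ m / ?K) = 18 * 3 ^ m / ?L"
      using K by simp
    then show ?thesis by (metis (no_types, opaque_lifting) mult.assoc mult.left_commute right_diff_distrib)
  qed
  finally have "(of_int_vec (p + q) \<bullet> v_dir q) * (v_dir (p + q) \<bullet> v_dir p) =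
      (dir_coeff m)\<^sup>2 * dir_coeff (Suc m) * (3 * 6 ^ m / ?K) * (18 * 3 ^ m / ?L)"
    unfolding triad_inner_v_dir_low[OF assms] by (simp add: power2_eq_square mult_ac)
  also have "(dir_coeff m)\<^sup>2 = ?K / (6 * 3 ^ m)"
    using K by (simp add: dir_coeff_def)
  also have "?K / (6 * 3 ^ m) * dir_coeff (Suc m) * (3 * 6 ^ m / ?K) * (18 * 3 ^ m / ?L) =
      9 * 6 ^ m * dir_coeff (Suc m) / ?L"
    using K by (simp add: field_simps)
  also have "\<dots> = sqrt 3 ^ Suc m / (2 * sqrt 2) * beta m"
  \<comment> \<open>Both sides are nonnegative products of rational expressions and square roots, so
    it is enough to compare squares.\<close>
  proof (rule power2_eq_imp_eq)
    have L: "?L = 12 * 4 ^ m * (1 + 1 / 2 * (3 / 4) ^ m)"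
      by (simp add: knorm2_def field_simps)
    have pos: "1 + 1 / 2 * (3 / 4) ^ m > (0::real)" by (simp add: add_pos_pos)
    have "(9 * 6 ^ m * dir_coeff (Suc m) / ?L)\<^sup>2 = (9 * 6 ^ m)\<^sup>2 / (6 * 3 ^ Suc m * ?L)"
      using K by (simp add: dir_coeff_def power_mult_distrib power_divide) (simp add: field_simps power2_eq_square)
    also have "\<dots> = 3 * 3 ^ m / 8 / (1 + 1 / 2 * (3 / 4) ^ m)"
    proof -
      have "(6 ^ m)\<^sup>2 = (3 ^ m * 3 ^ m * 4 ^ m :: real)"
        by (simp add: power2_eq_square flip: power_mult_distrib)
      then show ?thesis unfolding L using pos by (simp add: power_mult_distrib divide_simps)
    qed
    also have "\<dots> = (sqrt 3 ^ Suc m / (2 * sqrt 2) * beta m)\<^sup>2"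
    proof -
      have "(sqrt 3 ^ Suc m)\<^sup>2 = (3::real) ^ Suc m"
        by (metis power_commutes power_mult real_sqrt_pow2 mult.commute zero_le_numeral)
      then show ?thesis using pos by (simp add: beta_eq power_mult_distrib power_divide)
    qed
    finally show "(9 * 6 ^ m * dir_coeff (Suc m) / ?L)\<^sup>2 = (sqrt 3 ^ Suc m / (2 * sqrt 2) * beta m)\<^sup>2" .
  qed (use dir_coeff_pos[of "Suc m"] K in \<open>auto simp: beta_eq\<close>)
  finally show ?thesis .
qed

section \<open>Fields with restricted Fourier support\<close>

lemma fourier_nth: "fourier u k $ i = (LINT x|torus. complex_of_real (u x $ i) * wave (- k) x)"
  by (simp add: fourier_def distr_fourier_wave distr_of_def)

lemma wave_measurable_torus [measurable]: "wave k \<in> borel_measurable torus"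
  by (rule borel_measurable_torus) simp

lemma L2_field_measurable:
  assumes "L2_field u"
  shows "u \<in> borel_measurable torus"
  using assms unfolding L2_field_def torus_def by (intro measurable_restrict_space1) auto

lemma measurable_vec_nth [measurable]: "(\<lambda>x::real^'n. x $ i) \<in> borel_measurable borel"
  by (intro borel_measurable_continuous_onI continuous_intros)

lemma L2_field_nth_measurable:
  assumes "L2_field u"
  shows "(\<lambda>x. u x $ i) \<in> borel_measurable torus"
  using L2_field_measurable[OF assms] by measurable

lemma L2_field_mult_integrable:
  assumes "L2_field u"
  shows "integrable torus (\<lambda>x. u x $ i * u x $ j)"
proof (rule Bochner_Integration.integrable_bound)
  show "integrable torus (\<lambda>x. (norm (u x))\<^sup>2)" using assms by (simp add: L2_field_def)
  show "(\<lambda>x. u x $ i * u x $ j) \<in> borel_measurable torus"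
    using L2_field_nth_measurable[OF assms] by measurable
  have "\<bar>u x $ i\<bar> * \<bar>u x $ j\<bar> \<le> norm (u x) * norm (u x)" for x
    by (intro mult_mono component_le_norm_cart) auto
  then show "AE x in torus. norm (u x $ i * u x $ j) \<le> norm ((norm (u x))\<^sup>2)"
    by (simp add: abs_mult power2_eq_square)
qed

lemma L2_field_nth_integrable:
  assumes "L2_field u"
  shows "integrable torus (\<lambda>x. u x $ i)"
proof (rule Bochner_Integration.integrable_bound)
  show "integrable torus (\<lambda>x. 1 + u x $ i * u x $ i)"
    by (intro Bochner_Integration.integrable_add L2_field_mult_integrable[OF assms] torus.integrable_const)
  show "(\<lambda>x. u x $ i) \<in> borel_measurable torus" by (rule L2_field_nth_measurable[OF assms])
  have "\<bar>t\<bar> \<le> 1 + t * t" for t :: real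
    using zero_le_power2[of "\<bar>t\<bar> - 1"] abs_ge_zero[of t] by (simp add: power2_eq_square algebra_simps)
  then show "AE x in torus. norm (u x $ i) \<le> norm (1 + u x $ i * u x $ i)"
    by (simp add: abs_of_nonneg)
qed

lemma integrable_mult_wave:
  assumes "integrable torus f"
  shows "integrable torus (\<lambda>x. complex_of_real (f x) * wave k x)"
proof (rule Bochner_Integration.integrable_bound[OF assms])
  show "(\<lambda>x. complex_of_real (f x) * wave k x) \<in> borel_measurable torus"
    using borel_measurable_integrable[OF assms] by measurable
qed (auto simp: norm_mult)

lemma L2_field_scaleR:
  assumes "L2_field u"
  shows "L2_field (\<lambda>x. c *\<^sub>R u x)"
  using assms by (auto simp: L2_field_def periodic_def power_mult_distrib)

lemma norm_diff_square_le:
  fixes a b :: "'a::real_inner"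
  shows "(norm (a - b))\<^sup>2 \<le> 2 * (norm a)\<^sup>2 + 2 * (norm b)\<^sup>2"
proof -
  have "(norm (a - b))\<^sup>2 + (norm (a + b))\<^sup>2 = 2 * (norm a)\<^sup>2 + 2 * (norm b)\<^sup>2"
    by (simp add: power2_norm_eq_inner inner_diff inner_add inner_commute)
  then show ?thesis using zero_le_power2[of "norm (a + b)"] by linarith
qed

lemma L2_field_diff:
  assumes "L2_field u" "L2_field v"
  shows "L2_field (\<lambda>x. u x - v x)"
proof -
  have "integrable torus (\<lambda>x. (norm (u x - v x))\<^sup>2)"
  proof (rule Bochner_Integration.integrable_bound)
    show "integrable torus (\<lambda>x. 2 * (norm (u x))\<^sup>2 + 2 * (norm (v x))\<^sup>2)"
      using assms by (simp add: L2_field_def)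
    show "(\<lambda>x. (norm (u x - v x))\<^sup>2) \<in> borel_measurable torus"
      using assms[THEN L2_field_measurable] by measurable
    show "AE x in torus. norm ((norm (u x - v x))\<^sup>2) \<le> norm (2 * (norm (u x))\<^sup>2 + 2 * (norm (v x))\<^sup>2)"
      by (simp add: norm_diff_square_le)
  qed
  then show ?thesis using assms by (auto simp: L2_field_def periodic_def intro: borel_measurable_diff)
qed

lemma fourier_scaleR: "fourier (\<lambda>x. c *\<^sub>R u x) k = complex_of_real c *s fourier u k"
  by (simp add: vec_eq_iff fourier_nth mult.assoc)

lemma fourier_diff:
  assumes "L2_field u" "L2_field v"
  shows "fourier (\<lambda>x. u x - v x) k = fourier u k - fourier v k"
  using integrable_mult_wave[OF L2_field_nth_integrable[OF assms(1)]]
    integrable_mult_wave[OF L2_field_nth_integrable[OF assms(2)]]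
  by (simp add: vec_eq_iff fourier_nth left_diff_distrib)

lemma fourier_uminus: "fourier u (- k) $ i = cnj (fourier u k $ i)"
proof -
  have "cnj (fourier u k $ i) = (LINT x|torus. cnj (complex_of_real (u x $ i) * wave (- k) x))"
    unfolding fourier_nth by (rule Bochner_Integration.integral_cnj[symmetric])
  then show ?thesis by (simp add: fourier_nth wave_uminus del: Bochner_Integration.integral_cnj)
qed

lemma fourier_cong_AE:
  assumes "L2_field u" "L2_field v" "AE x in torus. u x = v x"
  shows "fourier u k = fourier v k"
proof -
  have "(LINT x|torus. complex_of_real (u x $ i) * wave (- k) x) =
      (LINT x|torus. complex_of_real (v x $ i) * wave (- k) x)" for i
    using assms(1,2)[THEN L2_field_nth_measurable, of i] assms(3)
    by (intro integral_cong_AE) auto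
  then show ?thesis by (simp add: vec_eq_iff fourier_nth)
qed

lemma AE_lebesgue_imp_torus:
  assumes "AE x in lebesgue. P x"
  shows "AE x in torus. P x"
  unfolding AE_torus_iff using assms by eventually_elim simp

text \<open>The product is bilinear as in \<open>proj_M\<close>. Since \<open>v_dir k\<close> is a
  real unit vector for \<open>k\<close> in \<open>M_freq\<close>, it recovers the scalar in front of
  \<open>v_dir k\<close>.\<close>

definition coef :: "(real^3 \<Rightarrow> real^3) \<Rightarrow> int^3 \<Rightarrow> complex" where
  "coef u k = (\<Sum>i\<in>UNIV. complex_of_real (v_dir k $ i) * fourier u k $ i)"

definition crit_exp :: real where
  "crit_exp = ln 3 / (2 * ln 2)"

lemma v_dir_unit:
  assumes "k \<in> M_freq"
  shows "(\<Sum>i\<in>UNIV. complex_of_real (v_dir k $ i) * complex_of_real (v_dir k $ i)) = 1"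
proof -
  have "(\<Sum>i\<in>UNIV. v_dir k $ i * v_dir k $ i) = 1"
    using norm_v_dir[OF assms] by (simp add: norm_eq_1 inner_vec_def)
  moreover have "(\<Sum>i\<in>UNIV. complex_of_real (v_dir k $ i) * complex_of_real (v_dir k $ i)) =
      complex_of_real (\<Sum>i\<in>UNIV. v_dir k $ i * v_dir k $ i)" by simp
  ultimately show ?thesis by simp
qed

lemma v_dir_coef:
  assumes "k \<in> M_freq" "fourier u k = c *s of_real_vec (v_dir k)"
  shows "coef u k = c"
proof -
  have "coef u k = c * (\<Sum>i\<in>UNIV. complex_of_real (v_dir k $ i) * complex_of_real (v_dir k $ i))"
    unfolding coef_def assms(2) sum_distrib_left by (intro sum.cong) (simp_all add: mult_ac)
  then show ?thesis using v_dir_unit[OF assms(1)] by simp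
qed

lemma HsM_L2: "u \<in> HsM s \<Longrightarrow> L2_field u"
  by (simp add: HsM_def Hs_def)

lemma HsM_fourier:
  assumes "u \<in> HsM s"
  shows "fourier u k = (if k \<in> M_freq then coef u k *s of_real_vec (v_dir k) else 0)"
proof (cases "k \<in> M_freq")
  case True
  then obtain c where c: "fourier u k = c *s of_real_vec (v_dir k)"
    using assms by (auto simp: HsM_def)
  show ?thesis using True c v_dir_coef[OF True c] by simp
next
  case False
  then show ?thesis using assms by (simp add: HsM_def)
qed

lemma norm_of_real_vec: "norm (of_real_vec v) = norm v"
  by (simp add: norm_vec_def L2_set_def)

lemma norm_vector_scale_complex: "norm (c *s (v::complex^3)) = norm c * norm v"
  by (simp add: norm_vec_def L2_set_def norm_mult power_mult_distrib real_sqrt_mult flip: sum_distrib_left)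

lemma HsM_norm_fourier:
  assumes "u \<in> HsM s" "k \<in> M_freq"
  shows "norm (fourier u k) = norm (coef u k)"
  using assms by (simp add: HsM_fourier[of u s] norm_vector_scale_complex norm_of_real_vec norm_v_dir)

lemma coef_uminus: "coef u (- k) = cnj (coef u k)"
  by (simp add: coef_def fourier_uminus)

lemma coef_scaleR: "coef (\<lambda>x. c *\<^sub>R u x) k = complex_of_real c * coef u k"
  by (simp add: coef_def fourier_scaleR sum_distrib_left mult_ac)

lemma coef_diff: "L2_field u \<Longrightarrow> L2_field v \<Longrightarrow> coef (\<lambda>x. u x - v x) k = coef u k - coef v k"
  by (simp add: coef_def fourier_diff right_diff_distrib sum_subtractf)

lemma Hs_term_nonneg: "Hs_term s u k \<ge> 0"
  by (simp add: Hs_term_def)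

lemma HsM_Hs_term:
  assumes "u \<in> HsM s" "k \<in> pm_shell n"
  shows "Hs_term s u k = (4 * pi\<^sup>2 * knorm2 n) powr s * (norm (coef u k))\<^sup>2"
  using assms by (simp add: Hs_term_def pm_shell_norm HsM_norm_fourier[OF assms(1) M_freqI])

lemma HsM_Hs_term_0:
  assumes "u \<in> HsM s" "k \<notin> M_freq"
  shows "Hs_term s u k = 0"
  using assms by (simp add: Hs_term_def HsM_fourier[of u s])

text \<open>The critical exponent is the one with \<open>4 powr crit_exp = 3\<close>, and a squared
  length on the n-th shell is at least \<open>4 ^ n\<close>.\<close>

lemma weight_ge: "3 ^ n \<le> (4 * pi\<^sup>2 * knorm2 n) powr crit_exp"
proof -
  have c: "crit_exp \<ge> 0" by (simp add: crit_exp_def)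
  have "(4::real) powr crit_exp = 3"
  proof -
    have "ln (4::real) = 2 * ln 2" using ln_realpow[of 2 2] by simp
    then show ?thesis by (simp add: powr_def crit_exp_def)
  qed
  then have "3 ^ n = ((4::real) powr crit_exp) powr real n" by (simp add: powr_realpow)
  also have "\<dots> = (4 ^ n) powr crit_exp"
    by (simp add: powr_powr mult.commute flip: powr_realpow)
  also have "\<dots> \<le> (4 * pi\<^sup>2 * knorm2 n) powr crit_exp"
  proof (rule powr_mono2[OF c])
    have "1 \<le> pi\<^sup>2" using pi_gt3 by (simp add: one_le_power)
    then have "1 * knorm2 n \<le> 4 * pi\<^sup>2 * knorm2 n"
      using knorm2_pos[of n] by (intro mult_right_mono) auto
    moreover have "(4::real) ^ n \<le> knorm2 n"
      unfolding knorm2_def by (smt (verit) zero_le_power)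
    ultimately show "4 ^ n \<le> 4 * pi\<^sup>2 * knorm2 n" by linarith
  qed simp
  finally show ?thesis .
qed

lemma HsM_summable: "u \<in> HsM s \<Longrightarrow> Hs_term s u summable_on (- {0})"
  by (simp add: HsM_def Hs_def)

lemma Hs_norm_nonneg: "Hs_norm s u \<ge> 0"
  by (simp add: Hs_norm_def infsum_nonneg Hs_term_nonneg)

lemma sqrt3_power_square: "(sqrt 3 ^ n)\<^sup>2 = 3 ^ n"
proof -
  have "(sqrt 3 ^ n)\<^sup>2 = ((sqrt 3)\<^sup>2) ^ n" by (simp only: power_mult[symmetric] mult.commute)
  then show ?thesis by simp
qed

text \<open>A single term of the sum defining the norm is at most the whole sum. The decay of
  coefficients and amplitudes used later rests on this estimate.\<close>

lemma coef_le_Hs_norm: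
  assumes u: "u \<in> HsM crit_exp" and k: "k \<in> pm_shell n"
  shows "norm (coef u k) * sqrt 3 ^ n \<le> Hs_norm crit_exp u"
proof (rule power2_le_imp_le)
  have "(norm (coef u k) * sqrt 3 ^ n)\<^sup>2 = 3 ^ n * (norm (coef u k))\<^sup>2"
    by (simp add: power_mult_distrib sqrt3_power_square)
  also have "\<dots> \<le> Hs_term crit_exp u k"
    unfolding HsM_Hs_term[OF assms] by (intro mult_right_mono weight_ge) auto
  also have "\<dots> = infsum (Hs_term crit_exp u) {k}" by simp
  also have "\<dots> \<le> infsum (Hs_term crit_exp u) (- {0})"
    using M_freqI[OF k] HsM_summable[OF u] by (intro infsum_mono_neutral) (auto simp: Hs_term_nonneg)
  also have "\<dots> = (Hs_norm crit_exp u)\<^sup>2"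
    by (simp add: Hs_norm_def infsum_nonneg Hs_term_nonneg)
  finally show "(norm (coef u k) * sqrt 3 ^ n)\<^sup>2 \<le> (Hs_norm crit_exp u)\<^sup>2" .
qed (rule Hs_norm_nonneg)

lemma integral_vec_nth:
  fixes f :: "'a \<Rightarrow> real^'n"
  assumes "integrable M f"
  shows "integral\<^sup>L M f $ i = (LINT x|M. f x $ i)"
  using integral_bounded_linear[OF bounded_linear_vec_nth assms] by simp

lemma L2_field_integrable:
  assumes "L2_field u"
  shows "integrable torus u"
proof (rule Bochner_Integration.integrable_bound)
  show "integrable torus (\<lambda>x. \<Sum>i\<in>UNIV. \<bar>u x $ i\<bar>)"
    using L2_field_nth_integrable[OF assms] by simp
  show "u \<in> borel_measurable torus" by (rule L2_field_measurable[OF assms])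
  show "AE x in torus. norm (u x) \<le> norm (\<Sum>i\<in>UNIV. \<bar>u x $ i\<bar>)"
    by (intro AE_I2) (simp add: norm_le_l1_cart sum_nonneg)
qed

lemma integral_eq_fourier_0:
  assumes "L2_field u"
  shows "(LINT x|torus. u x) = 0 \<longleftrightarrow> fourier u 0 = 0"
  by (simp add: vec_eq_iff fourier_nth integral_vec_nth[OF L2_field_integrable[OF assms]])

lemma HsM_intro:
  assumes "L2_field u"
    and "\<And>k. fourier u k = (if k \<in> M_freq then c k *s of_real_vec (v_dir k) else 0)"
    and "Hs_term s u summable_on (- {0})"
  shows "u \<in> HsM s"
  using assms integral_eq_fourier_0[OF assms(1)] by (auto simp: HsM_def Hs_def)

lemma HsM_scaleR:
  assumes "u \<in> HsM s"
  shows "(\<lambda>x. c *\<^sub>R u x) \<in> HsM s"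
proof (rule HsM_intro[where c = "\<lambda>k. of_real c * coef u k"])
  have "Hs_term s (\<lambda>x. c *\<^sub>R u x) = (\<lambda>k. c\<^sup>2 * Hs_term s u k)"
    by (simp add: fun_eq_iff Hs_term_def fourier_scaleR norm_vector_scale_complex power_mult_distrib)
  then show "Hs_term s (\<lambda>x. c *\<^sub>R u x) summable_on - {0}"
    using HsM_summable[OF assms] by (simp add: summable_on_cmult_right)
  show "fourier (\<lambda>x. c *\<^sub>R u x) k =
      (if k \<in> M_freq then (of_real c * coef u k) *s of_real_vec (v_dir k) else 0)" for k
    using HsM_fourier[OF assms] by (simp add: fourier_scaleR)
qed (intro L2_field_scaleR HsM_L2[OF assms])

lemma HsM_diff:
  assumes "u \<in> HsM s" "v \<in> HsM s"
  shows "(\<lambda>x. u x - v x) \<in> HsM s"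
proof (rule HsM_intro[where c = "\<lambda>k. coef u k - coef v k"])
  note L = assms[THEN HsM_L2]
  show "L2_field (\<lambda>x. u x - v x)" by (rule L2_field_diff[OF L])
  show "fourier (\<lambda>x. u x - v x) k =
      (if k \<in> M_freq then (coef u k - coef v k) *s of_real_vec (v_dir k) else 0)" for k
    using HsM_fourier[OF assms(1)] HsM_fourier[OF assms(2)]
    by (simp add: fourier_diff[OF L] vector_sub_rdistrib)
  have "Hs_term s (\<lambda>x. u x - v x) k \<le> 2 * Hs_term s u k + 2 * Hs_term s v k" for k
  proof -
    have "(4 * pi\<^sup>2 * (norm (of_int_vec k))\<^sup>2) powr s * (norm (fourier u k - fourier v k))\<^sup>2
      \<le> (4 * pi\<^sup>2 * (norm (of_int_vec k))\<^sup>2) powr s * (2 * (norm (fourier u k))\<^sup>2 + 2 * (norm (fourier v k))\<^sup>2)"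
      by (intro mult_left_mono norm_diff_square_le) auto
    then show ?thesis by (simp add: Hs_term_def fourier_diff[OF L] algebra_simps)
  qed
  moreover have "(\<lambda>k. 2 * Hs_term s u k + 2 * Hs_term s v k) summable_on - {0}"
    by (intro summable_on_add summable_on_cmult_right assms[THEN HsM_summable])
  ultimately show "Hs_term s (\<lambda>x. u x - v x) summable_on - {0}"
    by (rule_tac summable_on_comparison_test) (auto simp: Hs_term_nonneg)
qed

section \<open>Synthesis of a field from its coefficients\<close>

definition admissible :: "(int^3 \<Rightarrow> complex) \<Rightarrow> bool" where
  "admissible \<phi> \<longleftrightarrow> (\<forall>k\<in>M_freq. \<phi> (- k) = cnj (\<phi> k)) \<and>
     (\<exists>B. \<forall>n. \<forall>k\<in>pm_shell n. norm (\<phi> k) * sqrt 3 ^ n \<le> B)"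

text \<open>The real part keeps the values in real vectors. For \<open>admissible\<close>
  coefficients the terms at \<open>k\<close> and \<open>- k\<close> are conjugate, so the full
  complex sum has the same value.\<close>

definition shell_sum :: "(int^3 \<Rightarrow> complex) \<Rightarrow> nat \<Rightarrow> real^3 \<Rightarrow> real^3" where
  "shell_sum \<phi> n x = (\<Sum>k\<in>pm_shell n. Re (\<phi> k * wave k x) *\<^sub>R v_dir k)"

text \<open>The inverse Fourier transform. For \<open>admissible\<close> coefficients it is a
  bounded, everywhere defined Borel representative on which symmetries can be checked shell by
  shell.\<close>

definition synth :: "(int^3 \<Rightarrow> complex) \<Rightarrow> real^3 \<Rightarrow> real^3" where
  "synth \<phi> x = (\<Sum>n. shell_sum \<phi> n x)"

definition psum :: "(int^3 \<Rightarrow> complex) \<Rightarrow> nat \<Rightarrow> real^3 \<Rightarrow> real^3" where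
  "psum \<phi> N x = (\<Sum>n<N. shell_sum \<phi> n x)"

lemma psum_eq: "psum \<phi> N x = (\<Sum>k\<in>freqs_below N. Re (\<phi> k * wave k x) *\<^sub>R v_dir k)"
  unfolding psum_def shell_sum_def freqs_below_def
  using pm_shell_disjoint by (subst sum.UNION_disjoint) auto

lemma coef_admissible:
  assumes "u \<in> HsM crit_exp"
  shows "admissible (coef u)"
  using coef_le_Hs_norm[OF assms] by (auto simp: admissible_def coef_uminus)

lemma card_pm_shell: "card (pm_shell n) = 12"
proof -
  have "card (pm_shell n) = card (shell n) + card (uminus ` shell n)"
    unfolding pm_shell_def using shell_uminus_disjoint by (intro card_Un_disjoint) auto
  also have "card (uminus ` shell n) = card (shell n)" by (intro card_image) (auto simp: inj_on_def)
  finally show ?thesis by (simp add: card_shell)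
qed

lemma summable_inv_sqrt3: "summable (\<lambda>n. c * (1 / sqrt 3) ^ n)"
  by (intro summable_mult summable_geometric) simp

lemma norm_shell_sum_le:
  assumes "\<And>n k. k \<in> pm_shell n \<Longrightarrow> norm (\<phi> k) * sqrt 3 ^ n \<le> B"
  shows "norm (shell_sum \<phi> n x) \<le> 12 * B * (1 / sqrt 3) ^ n"
proof -
  have "norm (shell_sum \<phi> n x) \<le> (\<Sum>k\<in>pm_shell n. B * (1 / sqrt 3) ^ n)"
    unfolding shell_sum_def
  proof (rule sum_norm_le)
    fix k assume k: "k \<in> pm_shell n"
    have "\<bar>Re (\<phi> k * wave k x)\<bar> \<le> norm (\<phi> k * wave k x)" by (rule abs_Re_le_cmod)
    also have "\<dots> = norm (\<phi> k)" by (simp add: norm_mult)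
    also have "\<dots> \<le> B * (1 / sqrt 3) ^ n"
      using assms[OF k] by (simp add: power_one_over field_simps)
    finally show "norm (Re (\<phi> k * wave k x) *\<^sub>R v_dir k) \<le> B * (1 / sqrt 3) ^ n"
      using norm_v_dir[OF M_freqI[OF k]] by simp
  qed
  then show ?thesis by (simp add: card_pm_shell)
qed

lemma shell_sum_summable:
  assumes "admissible \<phi>"
  shows "summable (\<lambda>n. shell_sum \<phi> n x)"
proof -
  obtain B where "\<And>n k. k \<in> pm_shell n \<Longrightarrow> norm (\<phi> k) * sqrt 3 ^ n \<le> B"
    using assms by (auto simp: admissible_def)
  from norm_shell_sum_le[of \<phi> B, OF this] show ?thesis
    by (intro summable_comparison_test'[OF summable_inv_sqrt3[of "12 * B"], of 0]) auto
qed

lemma psum_tendsto: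
  assumes "admissible \<phi>"
  shows "(\<lambda>N. psum \<phi> N x) \<longlonglongrightarrow> synth \<phi> x"
  unfolding psum_def synth_def by (rule summable_LIMSEQ[OF shell_sum_summable[OF assms]])

lemma psum_bounded:
  assumes "admissible \<phi>"
  obtains C where "\<And>N x. norm (psum \<phi> N x) \<le> C"
proof -
  obtain B where B: "\<And>n k. k \<in> pm_shell n \<Longrightarrow> norm (\<phi> k) * sqrt 3 ^ n \<le> B"
    using assms by (auto simp: admissible_def)
  have "norm (psum \<phi> N x) \<le> (\<Sum>n. 12 * B * (1 / sqrt 3) ^ n)" for N x
  proof -
    have "norm (psum \<phi> N x) \<le> (\<Sum>n<N. 12 * B * (1 / sqrt 3) ^ n)"
      unfolding psum_def by (rule sum_norm_le) (rule norm_shell_sum_le[OF B])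
    also have "\<dots> \<le> (\<Sum>n. 12 * B * (1 / sqrt 3) ^ n)"
    proof (intro sum_le_suminf summable_inv_sqrt3)
      show "0 \<le> 12 * B * (1 / sqrt 3) ^ n" for n
        using norm_shell_sum_le[of \<phi> B, OF B] norm_ge_zero by (meson order_trans)
    qed auto
    finally show ?thesis .
  qed
  then show ?thesis using that by blast
qed

lemma psum_measurable [measurable]: "psum \<phi> N \<in> borel_measurable borel"
  unfolding psum_def shell_sum_def by measurable

lemma synth_measurable:
  assumes "admissible \<phi>"
  shows "synth \<phi> \<in> borel_measurable borel"
  by (rule borel_measurable_LIMSEQ_metric[OF psum_measurable psum_tendsto[OF assms]])

lemma synth_bounded:
  assumes "admissible \<phi>"
  obtains C where "\<And>x. norm (synth \<phi> x) \<le> C"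
proof -
  obtain C where C: "\<And>N x. norm (psum \<phi> N x) \<le> C" using psum_bounded[OF assms] by blast
  have "norm (synth \<phi> x) \<le> C" for x
    by (rule LIMSEQ_le_const2[OF tendsto_norm[OF psum_tendsto[OF assms]]]) (use C in auto)
  then show ?thesis using that by blast
qed

lemma synth_periodic: "periodic (synth \<phi>)"
  by (simp add: periodic_def synth_def shell_sum_def wave_periodic)

lemma L2_field_bounded:
  assumes [measurable]: "f \<in> borel_measurable borel" and "periodic f" "\<And>x. norm (f x) \<le> C"
  shows "L2_field f"
  unfolding L2_field_def
proof (intro conjI)
  show "f \<in> borel_measurable lebesgue" by (simp add: measurable_completion)
  show "integrable torus (\<lambda>x. (norm (f x))\<^sup>2)"
  proof (rule integrable_torus_bounded)
    show "(\<lambda>x. (norm (f x))\<^sup>2) \<in> borel_measurable torus" by (rule borel_measurable_torus) measurable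
    show "norm ((norm (f x))\<^sup>2) \<le> C\<^sup>2" for x using assms(3)[of x] by (simp add: power_mono)
  qed
qed fact

lemma L2_field_synth: "admissible \<phi> \<Longrightarrow> L2_field (synth \<phi>)"
  using synth_bounded[of \<phi>] L2_field_bounded[OF synth_measurable synth_periodic] by metis

lemma integral_torus_limit:
  fixes F :: "nat \<Rightarrow> real^3 \<Rightarrow> 'b::{banach, second_countable_topology}"
  assumes "\<And>N. F N \<in> borel_measurable borel" "\<And>N x. norm (F N x) \<le> B" "\<And>x. (\<lambda>N. F N x) \<longlonglongrightarrow> f x"
  shows "(\<lambda>N. LINT x|torus. F N x) \<longlonglongrightarrow> (LINT x|torus. f x)"
proof (rule integral_dominated_convergence[where w = "\<lambda>x. B"])
  show "f \<in> borel_measurable torus"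
    by (intro borel_measurable_torus borel_measurable_LIMSEQ_metric[OF assms(1,3)])
  show "F N \<in> borel_measurable torus" for N
    by (intro borel_measurable_torus assms(1))
qed (use assms in auto)

text \<open>Passing from \<open>p\<close> to \<open>- p\<close> conjugates each term of the complex
  sum and permutes the terms, so the sum is real and taking real parts changes nothing.\<close>

lemma complex_psum:
  assumes "admissible \<phi>"
  shows "complex_of_real (psum \<phi> N x $ i) =
    (\<Sum>p\<in>freqs_below N. (\<phi> p * complex_of_real (v_dir p $ i)) * wave p x)"
proof -
  let ?f = "\<lambda>p. \<phi> p * complex_of_real (v_dir p $ i) * wave p x"
  have cnj: "(\<Sum>p\<in>freqs_below N. cnj (?f p)) = (\<Sum>p\<in>freqs_below N. ?f p)"
    by (rule sum.reindex_bij_witness[of _ uminus uminus])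
       (use assms in \<open>auto simp: wave_uminus admissible_def dest: freqs_below_M\<close>)
  have "complex_of_real (psum \<phi> N x $ i) = (\<Sum>p\<in>freqs_below N. complex_of_real (Re (?f p)))"
    by (simp add: psum_eq algebra_simps)
  also have "\<dots> = (\<Sum>p\<in>freqs_below N. (?f p + cnj (?f p)) / 2)"
    by (intro sum.cong refl) (simp only: complex_add_cnj, simp)
  also have "\<dots> = ((\<Sum>p\<in>freqs_below N. ?f p) + (\<Sum>p\<in>freqs_below N. cnj (?f p))) / 2"
    by (simp add: sum.distrib flip: sum_divide_distrib)
  also have "\<dots> = (\<Sum>p\<in>freqs_below N. ?f p)" unfolding cnj by simp
  finally show ?thesis .
qed

lemma integrable_wave [simp]: "integrable torus (wave k)"
  by (rule integrable_torus_bounded[where B = 1]) auto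

lemma fourier_psum:
  assumes "admissible \<phi>"
  shows "(LINT x|torus. complex_of_real (psum \<phi> N x $ i) * wave (- k) x) =
    (if k \<in> freqs_below N then \<phi> k * complex_of_real (v_dir k $ i) else 0)"
proof -
  have "(LINT x|torus. complex_of_real (psum \<phi> N x $ i) * wave (- k) x) =
     (LINT x|torus. (\<Sum>p\<in>freqs_below N. (\<phi> p * complex_of_real (v_dir p $ i)) * wave (p + - k) x))"
    unfolding complex_psum[OF assms] sum_distrib_right wave_add by (simp add: mult_ac)
  also have "\<dots> = (\<Sum>p\<in>freqs_below N. (\<phi> p * complex_of_real (v_dir p $ i)) * (if p = k then 1 else 0))"
    by (subst Bochner_Integration.integral_sum) (auto simp: integral_wave)
  also have "\<dots> = (\<Sum>p\<in>freqs_below N. if p = k then \<phi> p * complex_of_real (v_dir p $ i) else 0)"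
    by (intro sum.cong) auto
  also have "\<dots> = (if k \<in> freqs_below N then \<phi> k * complex_of_real (v_dir k $ i) else 0)"
    by (simp only: sum.delta' sum.delta finite_freqs_below)
  finally show ?thesis .
qed

lemma fourier_psum_mult:
  assumes "admissible \<phi>"
  shows "(LINT x|torus. complex_of_real (psum \<phi> N x $ i * psum \<phi> N x $ j) * wave (- k) x) =
    (\<Sum>(p, q)\<in>{(p, q) \<in> freqs_below N \<times> freqs_below N. p + q = k}.
       (\<phi> p * complex_of_real (v_dir p $ i)) * (\<phi> q * complex_of_real (v_dir q $ j)))"
proof -
  let ?a = "\<lambda>i p. \<phi> p * complex_of_real (v_dir p $ i)"
  have "complex_of_real (psum \<phi> N x $ i * psum \<phi> N x $ j) * wave (- k) x =
     (\<Sum>(p, q)\<in>freqs_below N \<times> freqs_below N. (?a i p * ?a j q) * wave (p + q + - k) x)" for x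
    unfolding of_real_mult complex_psum[OF assms] sum_product
    unfolding sum.cartesian_product sum_distrib_right wave_add
    by (simp add: case_prod_beta mult_ac)
  then have "(LINT x|torus. complex_of_real (psum \<phi> N x $ i * psum \<phi> N x $ j) * wave (- k) x) =
     (\<Sum>pq\<in>freqs_below N \<times> freqs_below N.
        (LINT x|torus. (?a i (fst pq) * ?a j (snd pq)) * wave (fst pq + snd pq + - k) x))"
    by (simp only: case_prod_beta) (subst Bochner_Integration.integral_sum, auto simp: case_prod_beta)
  also have "\<dots> = (\<Sum>pq\<in>freqs_below N \<times> freqs_below N.
      if fst pq + snd pq = k then ?a i (fst pq) * ?a j (snd pq) else 0)"
    by (intro sum.cong refl) (auto simp: integral_wave)
  also have "\<dots> = (\<Sum>pq\<in>{pq \<in> freqs_below N \<times> freqs_below N. fst pq + snd pq = k}. ?a i (fst pq) * ?a j (snd pq))"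
    by (intro sum.inter_filter[symmetric]) auto
  also have "{pq \<in> freqs_below N \<times> freqs_below N. fst pq + snd pq = k} =
      {(p, q) \<in> freqs_below N \<times> freqs_below N. p + q = k}" by auto
  finally show ?thesis by (simp add: case_prod_beta)
qed

lemma fourier_synth:
  assumes "admissible \<phi>"
  shows "fourier (synth \<phi>) k = (if k \<in> M_freq then \<phi> k *s of_real_vec (v_dir k) else 0)"
proof -
  obtain C where C: "\<And>N x. norm (psum \<phi> N x) \<le> C" using psum_bounded[OF assms] by blast
  have "fourier (synth \<phi>) k $ i = (if k \<in> M_freq then \<phi> k * complex_of_real (v_dir k $ i) else 0)" for i
  proof (rule LIMSEQ_unique)
    show "(\<lambda>N. LINT x|torus. complex_of_real (psum \<phi> N x $ i) * wave (- k) x) \<longlonglongrightarrow> fourier (synth \<phi>) k $ i"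
      unfolding fourier_nth
    proof (rule integral_torus_limit)
      show "norm (complex_of_real (psum \<phi> N x $ i) * wave (- k) x) \<le> C" for N x
        using order_trans[OF component_le_norm_cart C] by (simp add: norm_mult)
      show "(\<lambda>N. complex_of_real (psum \<phi> N x $ i) * wave (- k) x) \<longlonglongrightarrow>
          complex_of_real (synth \<phi> x $ i) * wave (- k) x" for x
        by (intro tendsto_intros psum_tendsto assms)
    qed measurable
    show "(\<lambda>N. LINT x|torus. complex_of_real (psum \<phi> N x $ i) * wave (- k) x) \<longlonglongrightarrow>
        (if k \<in> M_freq then \<phi> k * complex_of_real (v_dir k $ i) else 0)"
    proof (cases "k \<in> M_freq")
      case True
      then obtain n where "k \<in> pm_shell n" by (auto simp: M_freq_eq)
      then have "k \<in> freqs_below N" if "N > n" for N using that by (simp add: pm_shell_freqs_below)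
      then show ?thesis unfolding fourier_psum[OF assms]
        using True by (intro tendsto_eventually eventually_sequentiallyI[of "Suc n"]) auto
    next
      case False
      then have "k \<notin> freqs_below N" for N using freqs_below_M by blast
      then show ?thesis unfolding fourier_psum[OF assms] using False by simp
    qed
  qed
  then show ?thesis by (simp add: vec_eq_iff)
qed

lemma coef_synth:
  assumes "admissible \<phi>" "k \<in> M_freq"
  shows "coef (synth \<phi>) k = \<phi> k"
  using assms by (intro v_dir_coef) (simp_all add: fourier_synth)

text \<open>The integrals of the truncations converge by bounded convergence, while the truncated
  convolutions no longer change once \<open>N\<close> reaches \<open>n + 2\<close>.\<close>

lemma fourier_synth_mult:
  assumes "admissible \<phi>" "k \<in> M_freq"
  shows "(LINT x|torus. complex_of_real (synth \<phi> x $ i * synth \<phi> x $ j) * wave (- k) x) =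
    (\<Sum>(p, q)\<in>triads k. (\<phi> p * complex_of_real (v_dir p $ i)) * (\<phi> q * complex_of_real (v_dir q $ j)))"
proof (rule LIMSEQ_unique)
  obtain C where C: "\<And>N x. norm (psum \<phi> N x) \<le> C" using psum_bounded[OF assms(1)] by blast
  show "(\<lambda>N. LINT x|torus. complex_of_real (psum \<phi> N x $ i * psum \<phi> N x $ j) * wave (- k) x) \<longlonglongrightarrow>
    (LINT x|torus. complex_of_real (synth \<phi> x $ i * synth \<phi> x $ j) * wave (- k) x)"
  proof (rule integral_torus_limit)
    have *: "\<bar>psum \<phi> N x $ i\<bar> * \<bar>psum \<phi> N x $ j\<bar> \<le> C * C" for N x
      using order_trans[OF component_le_norm_cart C[of N x]] order_trans[OF norm_ge_zero C[of N x]]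
      by (intro mult_mono) auto
    show "norm (complex_of_real (psum \<phi> N x $ i * psum \<phi> N x $ j) * wave (- k) x) \<le> C * C" for N x
      using *[of N x] by (simp add: norm_mult)
    show "(\<lambda>N. complex_of_real (psum \<phi> N x $ i * psum \<phi> N x $ j) * wave (- k) x) \<longlonglongrightarrow>
        complex_of_real (synth \<phi> x $ i * synth \<phi> x $ j) * wave (- k) x" for x
      by (intro tendsto_intros psum_tendsto assms)
  qed measurable
  obtain n where n: "k \<in> pm_shell n" using assms(2) by (auto simp: M_freq_eq)
  show "(\<lambda>N. LINT x|torus. complex_of_real (psum \<phi> N x $ i * psum \<phi> N x $ j) * wave (- k) x) \<longlonglongrightarrow>
    (\<Sum>(p, q)\<in>triads k. (\<phi> p * complex_of_real (v_dir p $ i)) * (\<phi> q * complex_of_real (v_dir q $ j)))"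
    unfolding fourier_psum_mult[OF assms(1)]
    by (intro tendsto_eventually eventually_sequentiallyI[of "n + 2"]) (simp only: triads_eq[OF n])
qed

text \<open>Parseval, read off from the zero mode of the products of components: the condition
  \<open>p + q = 0\<close> couples \<open>p\<close> with \<open>- p\<close>, and the directions are
  unit vectors.\<close>

lemma norm2_psum_integral:
  assumes "admissible \<phi>"
  shows "(LINT x|torus. (norm (psum \<phi> N x))\<^sup>2) = (\<Sum>k\<in>freqs_below N. (norm (\<phi> k))\<^sup>2)"
proof -
  let ?a = "\<lambda>i p. \<phi> p * complex_of_real (v_dir p $ i)"
  obtain C where C: "\<And>N x. norm (psum \<phi> N x) \<le> C" using psum_bounded[OF assms(1)] by blast
  have int: "integrable torus (\<lambda>x. psum \<phi> N x $ i * psum \<phi> N x $ i)" for i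
  proof (rule L2_field_mult_integrable[OF L2_field_bounded[OF _ _ C]])
    show "periodic (psum \<phi> N)" by (simp add: periodic_def psum_eq wave_periodic)
  qed measurable
  have "complex_of_real (LINT x|torus. (norm (psum \<phi> N x))\<^sup>2) =
      complex_of_real (LINT x|torus. (\<Sum>i\<in>UNIV. psum \<phi> N x $ i * psum \<phi> N x $ i))"
    by (simp add: power2_norm_eq_inner inner_vec_def)
  also have "\<dots> = (\<Sum>i\<in>UNIV. complex_of_real (LINT x|torus. psum \<phi> N x $ i * psum \<phi> N x $ i))"
    using int by simp
  also have "\<dots> = (\<Sum>i\<in>UNIV. (LINT x|torus. complex_of_real (psum \<phi> N x $ i * psum \<phi> N x $ i) * wave (- 0) x))"
    by (simp del: of_real_mult)
  also have "\<dots> = (\<Sum>i\<in>UNIV. \<Sum>(p, q)\<in>{(p, q) \<in> freqs_below N \<times> freqs_below N. p + q = 0}. ?a i p * ?a i q)"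
    by (simp only: fourier_psum_mult[OF assms])
  also have "\<dots> = (\<Sum>i\<in>UNIV. \<Sum>p\<in>freqs_below N. ?a i p * ?a i (- p))"
    by (intro sum.cong refl sum.reindex_bij_witness[of _ "\<lambda>p. (p, - p)" fst])
       (auto simp: add_eq_0_iff)
  also have "\<dots> = (\<Sum>p\<in>freqs_below N. \<phi> p * cnj (\<phi> p) *
      (\<Sum>i\<in>UNIV. complex_of_real (v_dir p $ i) * complex_of_real (v_dir p $ i)))"
    using assms by (subst sum.swap, intro sum.cong refl)
      (auto simp: admissible_def sum_distrib_left mult_ac dest!: freqs_below_M)
  also have "\<dots> = (\<Sum>p\<in>freqs_below N. complex_of_real ((norm (\<phi> p))\<^sup>2))"
    by (intro sum.cong refl) (simp only: v_dir_unit[OF freqs_below_M] complex_norm_square mult_1_right)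
  finally show ?thesis by (simp only: of_real_sum[symmetric] of_real_eq_iff)
qed

lemma norm2_synth_integral:
  assumes "admissible \<phi>"
  shows "(\<lambda>N. \<Sum>k\<in>freqs_below N. (norm (\<phi> k))\<^sup>2) \<longlonglongrightarrow> (LINT x|torus. (norm (synth \<phi> x))\<^sup>2)"
proof -
  obtain C where C: "\<And>N x. norm (psum \<phi> N x) \<le> C" using psum_bounded[OF assms(1)] by blast
  have "(\<lambda>N. LINT x|torus. (norm (psum \<phi> N x))\<^sup>2) \<longlonglongrightarrow> (LINT x|torus. (norm (synth \<phi> x))\<^sup>2)"
  proof (rule integral_torus_limit)
    show "norm ((norm (psum \<phi> N x))\<^sup>2) \<le> C\<^sup>2" for N x using C by (simp add: power_mono)
    show "(\<lambda>N. (norm (psum \<phi> N x))\<^sup>2) \<longlonglongrightarrow> (norm (synth \<phi> x))\<^sup>2" for x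
      by (intro tendsto_intros psum_tendsto assms)
  qed measurable
  then show ?thesis by (simp only: norm2_psum_integral[OF assms])
qed

lemma L2_field_fourier_eq_imp_AE:
  assumes u: "L2_field u" and v: "L2_field v" and eq: "\<And>k. fourier u k = fourier v k"
  shows "AE x in lebesgue. u x = v x"
proof -
  have "AE x in torus. u x $ i = v x $ i" for i
  proof -
    note int = L2_field_nth_integrable[OF u, of i] L2_field_nth_integrable[OF v, of i]
    have "(LINT x|torus. complex_of_real (u x $ i - v x $ i) * wave k x) = 0" for k
    proof -
      have "(LINT x|torus. complex_of_real (u x $ i - v x $ i) * wave k x) =
          fourier u (- k) $ i - fourier v (- k) $ i"
        using int[THEN integrable_mult_wave, of k] by (simp add: fourier_nth left_diff_distrib)
      then show ?thesis by (simp add: eq)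
    qed
    from fourier_uniqueness[OF _ this] int have "AE x in torus. u x $ i - v x $ i = 0" by simp
    then show ?thesis by eventually_elim simp
  qed
  then have "AE x in torus. \<forall>i. u x $ i = v x $ i" by (simp add: AE_all_countable)
  then have "AE x in torus. u x = v x" by eventually_elim (simp add: vec_eq_iff)
  then show ?thesis
    by (rule AE_torus_imp_AE_lebesgue) (use u v in \<open>simp add: L2_field_def periodic_def\<close>)
qed

text \<open>Both sides have the same Fourier coefficients. Through this representative the
  convection term and the symmetries of \<open>u\<close> are expressed by its coefficients.\<close>

lemma HsM_eq_synth:
  assumes "u \<in> HsM crit_exp"
  shows "AE x in lebesgue. u x = synth (coef u) x"
  by (rule L2_field_fourier_eq_imp_AE[OF HsM_L2[OF assms] L2_field_synth[OF coef_admissible[OF assms]]])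
     (simp add: fourier_synth[OF coef_admissible[OF assms]] HsM_fourier[OF assms])

section \<open>The Euler nonlinearity in terms of coefficients\<close>

lemma has_derivative_wave:
  "(wave k has_derivative (\<lambda>h. wave k x * (2 * pi * \<i> * complex_of_real (of_int_vec k \<bullet> h)))) (at x)"
proof -
  have "bounded_linear (\<lambda>h. 2 * pi * \<i> * complex_of_real (of_int_vec k \<bullet> h))"
    by (intro bounded_linear_const_mult bounded_linear_compose[OF bounded_linear_of_real]
        bounded_linear_inner_right)
  from has_derivative_compose[OF bounded_linear_imp_has_derivative[OF this]
      DERIV_exp[unfolded has_field_derivative_def]]
  show ?thesis unfolding wave_def by simp
qed

lemma partial_deriv_wave: "partial_deriv j (wave k) x = 2 * pi * \<i> * of_int (k $ j) * wave k x"
  unfolding partial_deriv_def frechet_derivative_at[OF has_derivative_wave, symmetric]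
  by (simp add: inner_axis)

text \<open>The scalar along \<open>v_dir k\<close> of minus the projected convection term. The
  divergence acts on the whole product, so it is \<open>k\<close>, not \<open>p\<close>, that meets
  \<open>v_dir q\<close>.\<close>

definition nonlin :: "(int^3 \<Rightarrow> complex) \<Rightarrow> int^3 \<Rightarrow> complex" where
  "nonlin \<phi> k = - 2 * pi * \<i> *
     (\<Sum>(p, q)\<in>triads k. complex_of_real ((of_int_vec k \<bullet> v_dir q) * (v_dir k \<bullet> v_dir p)) * \<phi> p * \<phi> q)"

lemma fourier_convection:
  assumes u: "u \<in> HsM crit_exp" and k: "k \<in> M_freq"
  shows "distr_fourier (convection u i) k = 2 * pi * \<i> *
    (\<Sum>j\<in>UNIV. of_int (k $ j) * (\<Sum>(p, q)\<in>triads k. (coef u p * complex_of_real (v_dir p $ i)) *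
       (coef u q * complex_of_real (v_dir q $ j))))"
proof -
  let ?g = "synth (coef u)"
  note adm = coef_admissible[OF u]
  have "distr_fourier (convection u i) k =
     (\<Sum>j\<in>UNIV. 2 * pi * \<i> * of_int (k $ j) * (LINT x|torus. complex_of_real (u x $ i * u x $ j) * wave (- k) x))"
  proof -
    \<comment> \<open>The sign comes from the exponent \<open>- k\<close> of the test character; it
      cancels against the sign in \<open>distr_partial\<close>.\<close>
    have "(LINT x|torus. complex_of_real (u x $ j * u x $ i) * partial_deriv j (wave (- k)) x) =
        - (2 * pi * \<i> * of_int (k $ j) * (LINT x|torus. complex_of_real (u x $ i * u x $ j) * wave (- k) x))" for j
    proof -
      have "(LINT x|torus. complex_of_real (u x $ j * u x $ i) * partial_deriv j (wave (- k)) x) =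
        (LINT x|torus. (- (2 * pi * \<i> * of_int (k $ j))) * (complex_of_real (u x $ i * u x $ j) * wave (- k) x))"
        by (intro Bochner_Integration.integral_cong refl) (simp add: partial_deriv_wave mult_ac)
      then show ?thesis by (simp del: of_real_mult)
    qed
    then show ?thesis
      by (simp add: distr_fourier_wave convection_def distr_partial_def distr_of_def del: of_real_mult)
  qed
  also have "\<dots> = (\<Sum>j\<in>UNIV. 2 * pi * \<i> * of_int (k $ j) *
      (LINT x|torus. complex_of_real (?g x $ i * ?g x $ j) * wave (- k) x))"
  proof (intro sum.cong refl arg_cong2[where f = "(*)"] integral_cong_AE)
    show "AE x in torus. complex_of_real (u x $ i * u x $ j) * wave (- k) x =
        complex_of_real (?g x $ i * ?g x $ j) * wave (- k) x" for j
      using AE_lebesgue_imp_torus[OF HsM_eq_synth[OF u]] by eventually_elim simp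
  qed (use L2_field_nth_measurable[OF HsM_L2[OF u]] L2_field_nth_measurable[OF L2_field_synth[OF adm]] in measurable)
  also have "\<dots> = (\<Sum>j\<in>UNIV. 2 * pi * \<i> * of_int (k $ j) *
      (\<Sum>(p, q)\<in>triads k. (coef u p * complex_of_real (v_dir p $ i)) * (coef u q * complex_of_real (v_dir q $ j))))"
    by (simp only: fourier_synth_mult[OF adm k])
  finally show ?thesis by (simp only: sum_distrib_left mult.assoc)
qed

text \<open>Once the finite sums are interchanged, the sums over the components \<open>i\<close> and
  \<open>j\<close> separate into the two inner products of the coupling factor.\<close>

lemma proj_convection:
  assumes u: "u \<in> HsM crit_exp" and k: "k \<in> M_freq"
  shows "proj_M (\<lambda>l. \<chi> i. distr_fourier (convection u i) l) k = (- nonlin (coef u) k) *s of_real_vec (v_dir k)"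
proof -
  have "(\<Sum>i\<in>UNIV. of_real_vec (v_dir k) $ i * distr_fourier (convection u i) k) = - nonlin (coef u) k"
  proof -
    have "(\<Sum>i\<in>UNIV. of_real_vec (v_dir k) $ i * distr_fourier (convection u i) k) =
      2 * pi * \<i> * (\<Sum>i\<in>UNIV. \<Sum>j\<in>UNIV. \<Sum>pq\<in>triads k. complex_of_real (v_dir k $ i) * of_int (k $ j) *
        (coef u (fst pq) * complex_of_real (v_dir (fst pq) $ i)) * (coef u (snd pq) * complex_of_real (v_dir (snd pq) $ j)))"
      by (simp add: fourier_convection[OF assms] sum_distrib_left case_prod_beta mult_ac)
    also have "\<dots> = 2 * pi * \<i> * (\<Sum>i\<in>UNIV. \<Sum>pq\<in>triads k. \<Sum>j\<in>UNIV. complex_of_real (v_dir k $ i) * of_int (k $ j) *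
        (coef u (fst pq) * complex_of_real (v_dir (fst pq) $ i)) * (coef u (snd pq) * complex_of_real (v_dir (snd pq) $ j)))"
      by (intro arg_cong2[where f = "(*)"] refl sum.cong sum.swap)
    also have "\<dots> = 2 * pi * \<i> * (\<Sum>pq\<in>triads k. \<Sum>i\<in>UNIV. \<Sum>j\<in>UNIV. complex_of_real (v_dir k $ i) * of_int (k $ j) *
        (coef u (fst pq) * complex_of_real (v_dir (fst pq) $ i)) * (coef u (snd pq) * complex_of_real (v_dir (snd pq) $ j)))"
      by (intro arg_cong2[where f = "(*)"] refl sum.swap)
    also have "\<dots> = 2 * pi * \<i> * (\<Sum>pq\<in>triads k. complex_of_real
       ((of_int_vec k \<bullet> v_dir (snd pq)) * (v_dir k \<bullet> v_dir (fst pq))) * coef u (fst pq) * coef u (snd pq))"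
    proof (intro arg_cong2[where f = "(*)"] refl sum.cong)
      fix pq
      have eq: "complex_of_real ((of_int_vec k \<bullet> v_dir (snd pq)) * (v_dir k \<bullet> v_dir (fst pq))) =
         (\<Sum>i\<in>UNIV. complex_of_real (v_dir k $ i) * complex_of_real (v_dir (fst pq) $ i)) *
         (\<Sum>j\<in>UNIV. of_int (k $ j) * complex_of_real (v_dir (snd pq) $ j))"
        by (simp add: inner_vec_def)
      show "(\<Sum>i\<in>UNIV. \<Sum>j\<in>UNIV. complex_of_real (v_dir k $ i) * of_int (k $ j) *
        (coef u (fst pq) * complex_of_real (v_dir (fst pq) $ i)) * (coef u (snd pq) * complex_of_real (v_dir (snd pq) $ j))) =
        complex_of_real ((of_int_vec k \<bullet> v_dir (snd pq)) * (v_dir k \<bullet> v_dir (fst pq))) * coef u (fst pq) * coef u (snd pq)"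
        by (simp only: eq) (simp only: sum_product, simp only: sum_distrib_right, simp add: mult_ac)
    qed
    finally show ?thesis by (simp add: nonlin_def case_prod_beta)
  qed
  then show ?thesis using k by (simp add: proj_M_def)
qed

text \<open>On \<open>M_freq\<close> both terms are multiples of the nonzero vector
  \<open>v_dir k\<close>, and elsewhere both vanish, so the vector equation is a system of scalar
  identities.\<close>

lemma equation_iff:
  assumes u: "u \<in> HsM crit_exp" and u': "u' \<in> HsM crit_exp"
  shows "(\<forall>k. fourier u' k + proj_M (\<lambda>l. \<chi> i. distr_fourier (convection u i) l) k = 0) \<longleftrightarrow>
    (\<forall>k\<in>M_freq. coef u' k = nonlin (coef u) k)"
proof -
  have "fourier u' k + proj_M (\<lambda>l. \<chi> i. distr_fourier (convection u i) l) k = 0 \<longleftrightarrow>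
      (k \<in> M_freq \<longrightarrow> coef u' k = nonlin (coef u) k)" for k
  proof (cases "k \<in> M_freq")
    case True
    have "of_real_vec (v_dir k) \<noteq> 0"
      using norm_v_dir[OF True] norm_of_real_vec[of "v_dir k"] by auto
    moreover have "fourier u' k + proj_M (\<lambda>l. \<chi> i. distr_fourier (convection u i) l) k =
        (coef u' k - nonlin (coef u) k) *s of_real_vec (v_dir k)"
      using True by (simp add: HsM_fourier[OF u'] proj_convection[OF u] vec_eq_iff algebra_simps)
    ultimately show ?thesis using True by (simp only: vector_mul_eq_0) simp
  next
    case False
    then show ?thesis by (simp add: HsM_fourier[OF u'] proj_M_def)
  qed
  then show ?thesis by blast
qed

section \<open>Symmetries\<close>

lemma shell_sum_cong: "(\<And>k. k \<in> M_freq \<Longrightarrow> \<phi> k = \<phi>' k) \<Longrightarrow> shell_sum \<phi> n x = shell_sum \<phi>' n x"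
  unfolding shell_sum_def by (intro sum.cong refl) (simp add: M_freqI)

lemma synth_cong: "(\<And>k. k \<in> M_freq \<Longrightarrow> \<phi> k = \<phi>' k) \<Longrightarrow> synth \<phi> x = synth \<phi>' x"
  unfolding synth_def by (simp add: shell_sum_cong[of \<phi> \<phi>'])

lemma M_freq_pm_shell: "k \<in> M_freq \<Longrightarrow> \<exists>n. k \<in> pm_shell n"
  by (auto simp: M_freq_eq)

lemma coef_cong_AE:
  assumes "L2_field u" "L2_field v" "AE x in lebesgue. u x = v x"
  shows "coef u k = coef v k"
  using fourier_cong_AE[OF assms(1,2) AE_lebesgue_imp_torus[OF assms(3)]] by (simp add: coef_def)

lemma mem_time_interval_eventually: "\<forall>\<^sub>F r in at t within S. r \<in> S"
  by (simp add: eventually_at_filter)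

text \<open>The isometry \<open>A\<close> need not preserve the lattice \<open>\<int>\<^sup>3\<close> (\<open>M_sigma\<close> does not), so \<open>u \<circ> A\<close> is
  periodic only because of the restricted Fourier support.\<close>

locale shell_symmetry =
  fixes A :: "real^3 \<Rightarrow> real^3" and a :: "int^3 \<Rightarrow> int^3" and e :: real
  assumes orth: "orthogonal_transformation A"
    and A_sigma: "A sigma_vec = e *\<^sub>R sigma_vec"
    and e_square: "e * e = 1"
    and a_shell: "k \<in> pm_shell n \<Longrightarrow> a k \<in> pm_shell n"
    and a_A: "k \<in> pm_shell n \<Longrightarrow> of_int_vec (a k) = A (of_int_vec k)"
begin

lemma linear_A: "linear A"
  using orth by (rule orthogonal_transformation_linear)

lemma A_inner [simp]: "A x \<bullet> A y = x \<bullet> y"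
  using orth by (simp add: orthogonal_transformation_def)

lemma norm_A [simp]: "norm (A x) = norm x"
  by (simp add: norm_eq_sqrt_inner)

lemma A_inj: "A x = A y \<longleftrightarrow> x = y"
  using orthogonal_transformation_inj[OF orth] by (simp add: inj_eq)

lemma e_abs: "\<bar>e\<bar> = 1"
  using e_square by (metis abs_mult_self_eq abs_1 abs_square_eq_1 power2_eq_square)

lemma a_M: "k \<in> M_freq \<Longrightarrow> a k \<in> M_freq"
  using a_shell by (auto simp: M_freq_eq)

lemma a_A_M: "k \<in> M_freq \<Longrightarrow> of_int_vec (a k) = A (of_int_vec k)"
  using a_A by (auto simp: M_freq_eq)

lemma a_inj: "inj_on a M_freq"
  by (rule inj_onI) (metis a_A_M A_inj of_int_vec_eq_iff)

lemma a_bij_shell: "bij_betw a (pm_shell n) (pm_shell n)"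
proof -
  have "inj_on a (pm_shell n)" by (rule inj_on_subset[OF a_inj]) (auto intro: M_freqI)
  then show ?thesis
    using a_shell by (simp add: bij_betw_def endo_inj_surj image_subset_iff)
qed

lemma a_bij: "bij_betw a M_freq M_freq"
proof -
  have "a ` M_freq = M_freq"
    using a_bij_shell unfolding M_freq_eq image_UN by (simp add: bij_betw_def)
  then show ?thesis using a_inj by (simp add: bij_betw_def)
qed

lemma a_uminus: "k \<in> M_freq \<Longrightarrow> a (- k) = - a k"
  using a_A_M[of k] a_A_M[of "- k"] linear_A
  by (metis M_freq_uminus linear_neg of_int_vec_eq_iff of_int_vec_simps(3))

lemma perp_sigma_a:
  assumes "k \<in> M_freq"
  shows "perp_sigma (a k) = e *\<^sub>R A (perp_sigma k)"
proof -
  have "A (of_int_vec k) \<bullet> sigma_vec = e * (A (of_int_vec k) \<bullet> A sigma_vec)"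
    unfolding A_sigma using e_square by (simp flip: mult.assoc)
  then have "A (of_int_vec k) \<bullet> sigma_vec = e * (of_int_vec k \<bullet> sigma_vec)" by simp
  moreover have "e *\<^sub>R A sigma_vec = sigma_vec" unfolding A_sigma using e_square by simp
  ultimately show ?thesis
    using linear_A
    by (simp add: perp_sigma_def a_A_M[OF assms] linear_diff linear_scale scaleR_diff_right)
qed

lemma v_dir_a:
  assumes "k \<in> M_freq"
  shows "v_dir (a k) = e *\<^sub>R A (v_dir k)"
  using linear_A
  by (simp add: v_dir_def perp_sigma_a[OF assms] linear_scale e_abs scaleR_left_commute[of e])

lemma inner_v_dir_a:
  assumes "k \<in> M_freq" "q \<in> M_freq"
  shows "of_int_vec (a k) \<bullet> v_dir (a q) = e * (of_int_vec k \<bullet> v_dir q)"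
    and "v_dir (a k) \<bullet> v_dir (a q) = v_dir k \<bullet> v_dir q"
  using e_square by (simp_all add: a_A_M v_dir_a assms flip: mult.assoc)

text \<open>\<open>A\<close> is linear and injective and agrees with \<open>a\<close> on
  \<open>M_freq\<close>, so the relation \<open>p + q = k\<close> is both preserved and
  reflected.\<close>

lemma triads_a:
  assumes "k \<in> M_freq"
  shows "bij_betw (map_prod a a) (triads k) (triads (a k))"
  unfolding bij_betw_def
proof
  show "inj_on (map_prod a a) (triads k)"
    using a_inj by (auto simp: inj_on_def triads_def)
  show "map_prod a a ` triads k = triads (a k)"
  proof (intro equalityI subsetI)
    fix pq assume "pq \<in> map_prod a a ` triads k"
    then obtain p q where pq: "pq = (a p, a q)" "p \<in> M_freq" "q \<in> M_freq" "p + q = k"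
      by (auto simp: triads_def)
    have "of_int_vec (a p) + of_int_vec (a q) = of_int_vec (a k)"
      using assms pq(2-) linear_A by (auto simp: a_A_M linear_add)
    then have "a p + a q = a k"
      by (simp only: of_int_vec_simps(2)[symmetric] of_int_vec_eq_iff)
    then show "pq \<in> triads (a k)" using pq a_M by (simp add: triads_def)
  next
    fix pq assume "pq \<in> triads (a k)"
    then obtain p q where pq: "pq = (a p, a q)" "p \<in> M_freq" "q \<in> M_freq" "a p + a q = a k"
      using a_bij by (auto simp: triads_def bij_betw_def) (metis imageE)
    then have "of_int_vec (a p) + of_int_vec (a q) = of_int_vec (a k)"
      by (metis of_int_vec_simps(2))
    then have "A (of_int_vec (p + q)) = A (of_int_vec k)"
      using assms pq(2,3) linear_A by (simp add: a_A_M linear_add)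
    then have "p + q = k" unfolding A_inj of_int_vec_eq_iff .
    then show "pq \<in> map_prod a a ` triads k"
      using pq by (auto simp: triads_def intro!: image_eqI[of _ _ "(p, q)"])
  qed
qed

text \<open>If \<open>\<phi>\<close> belongs to \<open>u\<close>, these are the coefficients of the
  inverse of \<open>A\<close> applied to \<open>u (A x)\<close>, see \<open>A_synth\<close>. The
  sign \<open>e\<close> enters because \<open>v_dir\<close> is built from \<open>sigma\<close>,
  which \<open>A\<close> maps to \<open>e\<close> times itself.\<close>

definition twist :: "(int^3 \<Rightarrow> complex) \<Rightarrow> int^3 \<Rightarrow> complex" where
  "twist \<phi> k = complex_of_real e * \<phi> (a k)"

lemma norm_twist: "norm (twist \<phi> k) = norm (\<phi> (a k))"
  by (simp add: twist_def norm_mult e_abs)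

lemma admissible_twist: "admissible \<phi> \<Longrightarrow> admissible (twist \<phi>)"
  unfolding admissible_def
proof (elim conjE exE, intro conjI)
  fix B assume "\<forall>k\<in>M_freq. \<phi> (- k) = cnj (\<phi> k)" "\<forall>n. \<forall>k\<in>pm_shell n. norm (\<phi> k) * sqrt 3 ^ n \<le> B"
  then show "\<forall>k\<in>M_freq. twist \<phi> (- k) = cnj (twist \<phi> k)"
    "\<exists>B. \<forall>n. \<forall>k\<in>pm_shell n. norm (twist \<phi> k) * sqrt 3 ^ n \<le> B"
    using a_shell a_M by (auto simp: twist_def a_uminus norm_mult e_abs intro!: exI[of _ B])
qed

text \<open>Under \<open>a\<close> the factor of \<open>k\<close> and \<open>v_dir q\<close> picks
  up one sign \<open>e\<close>, the product of two directions none, and the two twisted coefficients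
  contribute \<open>e * e = 1\<close>.\<close>

lemma nonlin_twist:
  assumes "k \<in> M_freq"
  shows "nonlin (twist \<phi>) k = complex_of_real e * nonlin \<phi> (a k)"
proof -
  let ?g = "\<lambda>\<phi> k pq. complex_of_real ((of_int_vec k \<bullet> v_dir (snd pq)) * (v_dir k \<bullet> v_dir (fst pq))) * \<phi> (fst pq) * \<phi> (snd pq)"
  have ee: "complex_of_real e * complex_of_real e = 1" using e_square by (metis of_real_1 of_real_mult)
  have "(\<Sum>pq\<in>triads (a k). ?g \<phi> (a k) pq) = (\<Sum>pq\<in>triads k. ?g \<phi> (a k) (map_prod a a pq))"
    by (rule sum.reindex_bij_betw[OF triads_a[OF assms], symmetric])
  also have "\<dots> = (\<Sum>pq\<in>triads k. complex_of_real e * ?g (twist \<phi>) k pq)"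
  proof (intro sum.cong refl)
    fix pq assume "pq \<in> triads k"
    then have "fst pq \<in> M_freq" "snd pq \<in> M_freq" by (auto simp: triads_def)
    then have "?g \<phi> (a k) (map_prod a a pq) =
        complex_of_real e * complex_of_real ((of_int_vec k \<bullet> v_dir (snd pq)) * (v_dir k \<bullet> v_dir (fst pq)))
          * (\<phi> (a (fst pq)) * \<phi> (a (snd pq)))"
      using assms by (simp add: inner_v_dir_a)
    also have "\<dots> = complex_of_real e * complex_of_real ((of_int_vec k \<bullet> v_dir (snd pq)) * (v_dir k \<bullet> v_dir (fst pq)))
          * (complex_of_real e * complex_of_real e) * (\<phi> (a (fst pq)) * \<phi> (a (snd pq)))"
      unfolding ee by simp
    finally show "?g \<phi> (a k) (map_prod a a pq) = complex_of_real e * ?g (twist \<phi>) k pq"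
      by (simp add: twist_def mult_ac)
  qed
  finally have "(\<Sum>pq\<in>triads (a k). ?g \<phi> (a k) pq) = complex_of_real e * (\<Sum>pq\<in>triads k. ?g (twist \<phi>) k pq)"
    by (simp add: sum_distrib_left)
  then have "complex_of_real e * (\<Sum>pq\<in>triads (a k). ?g \<phi> (a k) pq) =
      (complex_of_real e * complex_of_real e) * (\<Sum>pq\<in>triads k. ?g (twist \<phi>) k pq)"
    by (simp only: mult.assoc)
  then have "(\<Sum>pq\<in>triads k. ?g (twist \<phi>) k pq) = complex_of_real e * (\<Sum>pq\<in>triads (a k). ?g \<phi> (a k) pq)"
    unfolding ee by simp
  then show ?thesis by (simp add: nonlin_def case_prod_beta)
qed

lemma A_shell_sum: "A (shell_sum (twist \<phi>) n x) = shell_sum \<phi> n (A x)"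
proof -
  have "A (shell_sum (twist \<phi>) n x) = (\<Sum>k\<in>pm_shell n. Re (twist \<phi> k * wave k x) *\<^sub>R A (v_dir k))"
    using linear_A by (simp add: shell_sum_def linear_sum linear_scale)
  also have "\<dots> = (\<Sum>k\<in>pm_shell n. Re (\<phi> (a k) * wave (a k) (A x)) *\<^sub>R v_dir (a k))"
  proof (intro sum.cong refl)
    fix k assume k: "k \<in> pm_shell n"
    have "wave (a k) (A x) = wave k x" using k by (simp add: wave_def a_A)
    then show "Re (twist \<phi> k * wave k x) *\<^sub>R A (v_dir k) = Re (\<phi> (a k) * wave (a k) (A x)) *\<^sub>R v_dir (a k)"
      using k by (simp add: v_dir_a M_freqI twist_def mult.assoc)
  qed
  also have "\<dots> = shell_sum \<phi> n (A x)"
    unfolding shell_sum_def by (rule sum.reindex_bij_betw[OF a_bij_shell])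
  finally show ?thesis .
qed

lemma A_synth:
  assumes "admissible \<phi>"
  shows "A (synth (twist \<phi>) x) = synth \<phi> (A x)"
  unfolding synth_def
  by (subst bounded_linear.suminf[OF linear_conv_bounded_linear[THEN iffD1, OF linear_A]
        shell_sum_summable[OF admissible_twist[OF assms]]])
     (simp add: A_shell_sum)

lemma AE_compose_A:
  assumes "AE x in lebesgue. P x"
  shows "AE x in lebesgue. P (A x)"
proof -
  have "negligible (inv A ` {x. \<not> P x})"
    using assms orthogonal_transformation_linear[OF orthogonal_transformation_inv[OF orth]]
    by (intro negligible_differentiable_image_negligible linear_imp_differentiable_on)
       (simp_all add: AE_lebesgue_iff)
  moreover have "{x. \<not> P (A x)} \<subseteq> inv A ` {x. \<not> P x}"
    using orthogonal_transformation_inj[OF orth] by (auto intro!: image_eqI[of _ _ "A _"])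
  ultimately show ?thesis unfolding AE_lebesgue_iff by (rule negligible_subset)
qed

text \<open>As \<open>A\<close> need not map the torus to itself, it cannot simply be substituted in
  the Fourier integral. Instead the symmetry is transferred to the series, and the coefficients of
  two almost everywhere equal series are compared.\<close>

lemma coef_symmetric:
  assumes u: "u \<in> HsM crit_exp" and sym: "AE x in lebesgue. u (A x) = A (u x)" and k: "k \<in> M_freq"
  shows "coef u k = twist (coef u) k"
proof -
  note adm = coef_admissible[OF u]
  have "AE x in lebesgue. synth (twist (coef u)) x = synth (coef u) x"
    using HsM_eq_synth[OF u] AE_compose_A[OF HsM_eq_synth[OF u]] sym
  proof eventually_elim
    case (elim x)
    then have "A (synth (twist (coef u)) x) = A (synth (coef u) x)" by (simp add: A_synth[OF adm])
    then show ?case by (simp add: A_inj)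
  qed
  from coef_cong_AE[OF L2_field_synth[OF admissible_twist[OF adm]] L2_field_synth[OF adm] this, of k]
  show ?thesis by (simp add: coef_synth adm admissible_twist k)
qed

lemma coef_symmetric_imp:
  assumes u: "u \<in> HsM crit_exp" and sym: "\<And>k. k \<in> M_freq \<Longrightarrow> coef u k = twist (coef u) k"
  shows "AE x in lebesgue. u (A x) = A (u x)"
  using HsM_eq_synth[OF u] AE_compose_A[OF HsM_eq_synth[OF u]]
proof eventually_elim
  case (elim x)
  then show ?case
    by (simp add: A_synth[OF coef_admissible[OF u], symmetric] synth_cong[OF sym, symmetric])
qed

lemma Hs_term_twist:
  assumes "u \<in> HsM s" "w \<in> HsM s" "\<And>k. k \<in> M_freq \<Longrightarrow> coef w k = twist (coef u) k" "k \<in> M_freq"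
  shows "Hs_term s w k = Hs_term s u (a k)"
proof -
  obtain n where n: "k \<in> pm_shell n" using M_freq_pm_shell[OF assms(4)] by blast
  then show ?thesis
    using assms by (simp add: HsM_Hs_term[OF _ n] HsM_Hs_term[OF _ a_shell[OF n]] norm_twist)
qed

text \<open>The weight depends only on the shell, which \<open>a\<close> preserves, so the sum
  defining the norm is merely rearranged.\<close>

lemma Hs_norm_twist:
  assumes "u \<in> HsM s" "w \<in> HsM s" "\<And>k. k \<in> M_freq \<Longrightarrow> coef w k = twist (coef u) k"
  shows "Hs_norm s w = Hs_norm s u"
proof -
  have M: "infsum (Hs_term s f) (- {0}) = infsum (Hs_term s f) M_freq" if "f \<in> HsM s" for f
    using HsM_Hs_term_0[OF that] by (intro infsum_cong_neutral) auto
  have "infsum (Hs_term s w) M_freq = infsum (\<lambda>k. Hs_term s u (a k)) M_freq"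
    using Hs_term_twist[OF assms] by (intro infsum_cong) auto
  also have "\<dots> = infsum (Hs_term s u) M_freq"
    by (rule infsum_reindex_bij_betw[OF a_bij])
  finally show ?thesis using M[OF assms(1)] M[OF assms(2)] by (simp add: Hs_norm_def)
qed

lemma synth_twist_HsM:
  assumes u: "u \<in> HsM crit_exp"
  shows "synth (twist (coef u)) \<in> HsM crit_exp"
proof (rule HsM_intro[OF L2_field_synth])
  show adm: "admissible (twist (coef u))" by (rule admissible_twist[OF coef_admissible[OF u]])
  show F: "fourier (synth (twist (coef u))) k =
      (if k \<in> M_freq then twist (coef u) k *s of_real_vec (v_dir k) else 0)" for k
    by (rule fourier_synth[OF adm])
  have "Hs_term crit_exp u summable_on M_freq"
    by (rule summable_on_subset_banach[OF HsM_summable[OF u]]) auto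
  then have "(\<lambda>k. Hs_term crit_exp u (a k)) summable_on M_freq"
    by (rule summable_on_reindex_bij_betw[OF a_bij, THEN iffD2])
  moreover have "Hs_term crit_exp (synth (twist (coef u))) k = Hs_term crit_exp u (a k)"
    if k: "k \<in> M_freq" for k
  proof -
    obtain n where n: "k \<in> pm_shell n" using M_freq_pm_shell[OF k] by blast
    then show ?thesis using k a_M[OF k]
      by (simp add: Hs_term_def F HsM_fourier[OF u] pm_shell_norm[OF n] pm_shell_norm[OF a_shell[OF n]]
          norm_vector_scale_complex norm_of_real_vec norm_v_dir norm_twist)
  qed
  ultimately have "Hs_term crit_exp (synth (twist (coef u))) summable_on M_freq"
    by (simp cong: summable_on_cong)
  moreover have "Hs_term crit_exp (synth (twist (coef u))) k = 0" if "k \<notin> M_freq" for k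
    using that by (simp add: Hs_term_def F)
  ultimately show "Hs_term crit_exp (synth (twist (coef u))) summable_on - {0}"
    by (subst summable_on_cong_neutral[of M_freq _ _ "Hs_term crit_exp (synth (twist (coef u)))"]) auto
qed

lemma coef_synth_twist:
  assumes "u \<in> HsM crit_exp" "k \<in> M_freq"
  shows "coef (synth (twist (coef u))) k = twist (coef u) k"
  using assms by (intro coef_synth admissible_twist coef_admissible)

text \<open>The twist is linear and isometric for the norm, so difference quotients converge as
  before. It commutes with the nonlinearity by \<open>nonlin_twist\<close>, and it fixes the
  coefficients of the symmetric initial field.\<close>

lemma solution_twist:
  assumes u0: "u0 \<in> HsM crit_exp" and sym: "AE x in lebesgue. u0 (A x) = A (u0 x)"
    and sol: "restricted_euler_solution crit_exp u0 T u"
  shows "restricted_euler_solution crit_exp u0 T (\<lambda>t. synth (twist (coef (u t))))"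
proof -
  let ?I = "time_interval T" and ?w = "\<lambda>v::real \<Rightarrow> real^3 \<Rightarrow> real^3. \<lambda>t. synth (twist (coef (v t)))"
  obtain u' where T: "0 < T" and C1: "C1_HsM crit_exp T u u'"
    and eq: "\<And>t k. t \<in> ?I \<Longrightarrow>
      fourier (u' t) k + proj_M (\<lambda>l. \<chi> i. distr_fourier (convection (u t) i) l) k = 0"
    and init: "AE x in lebesgue. u 0 x = u0 x"
    using sol by (auto simp: restricted_euler_solution_def)
  have H: "u t \<in> HsM crit_exp" "u' t \<in> HsM crit_exp" if "t \<in> ?I" for t
    using C1 that by (auto simp: C1_HsM_def)
  note W = H(1)[THEN synth_twist_HsM] H(2)[THEN synth_twist_HsM]
  note cW = coef_synth_twist[OF H(1)] coef_synth_twist[OF H(2)]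
  have 0: "0 \<in> ?I" using T by (simp add: time_interval_def zero_ereal_def)
  have "C1_HsM crit_exp T (?w u) (?w u')"
    unfolding C1_HsM_def
  proof (intro ballI conjI)
    fix t assume t: "t \<in> ?I"
    show "?w u t \<in> HsM crit_exp" "?w u' t \<in> HsM crit_exp" using W t by auto
    have "\<forall>\<^sub>F r in at t within ?I.
       Hs_norm crit_exp (\<lambda>x. (1 / (r - t)) *\<^sub>R (u r x - u t x) - u' t x) =
       Hs_norm crit_exp (\<lambda>x. (1 / (r - t)) *\<^sub>R (?w u r x - ?w u t x) - ?w u' t x)"
      using mem_time_interval_eventually
    proof eventually_elim
      case (elim r)
      show ?case
        using elim t
        by (intro Hs_norm_twist[symmetric] HsM_diff HsM_scaleR H W)
           (simp_all add: coef_diff coef_scaleR L2_field_diff L2_field_scaleR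
             HsM_L2[OF H(1)] HsM_L2[OF H(2)] HsM_L2[OF W(1)] HsM_L2[OF W(2)] cW
             twist_def, simp_all add: algebra_simps)
    qed
    from Lim_transform_eventually[OF _ this] C1 t
    show "((\<lambda>r. Hs_norm crit_exp (\<lambda>x. (1 / (r - t)) *\<^sub>R (?w u r x - ?w u t x) - ?w u' t x)) \<longlongrightarrow> 0) (at t within ?I)"
      by (auto simp: C1_HsM_def)
    have "\<forall>\<^sub>F r in at t within ?I.
       Hs_norm crit_exp (\<lambda>x. u' r x - u' t x) = Hs_norm crit_exp (\<lambda>x. ?w u' r x - ?w u' t x)"
      using mem_time_interval_eventually
    proof eventually_elim
      case (elim r)
      show ?case
        using elim t
        by (intro Hs_norm_twist[symmetric] HsM_diff H W)
           (simp_all add: coef_diff HsM_L2[OF H(2)] HsM_L2[OF W(2)] cW twist_def algebra_simps)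
    qed
    from Lim_transform_eventually[OF _ this] C1 t
    show "((\<lambda>r. Hs_norm crit_exp (\<lambda>x. ?w u' r x - ?w u' t x)) \<longlongrightarrow> 0) (at t within ?I)"
      by (auto simp: C1_HsM_def)
  qed
  moreover have "\<forall>k. fourier (?w u' t) k + proj_M (\<lambda>l. \<chi> i. distr_fourier (convection (?w u t) i) l) k = 0"
    if t: "t \<in> ?I" for t
    unfolding equation_iff[OF W(1)[OF t] W(2)[OF t]]
  proof
    fix k assume k: "k \<in> M_freq"
    have "coef (u' t) l = nonlin (coef (u t)) l" if "l \<in> M_freq" for l
      using equation_iff[OF H(1)[OF t] H(2)[OF t]] eq[OF t] that by blast
    moreover have "nonlin (coef (?w u t)) k = nonlin (twist (coef (u t))) k"
      using cW(1)[OF t] unfolding nonlin_def by (auto simp: triads_def intro!: sum.cong)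
    ultimately show "coef (?w u' t) k = nonlin (coef (?w u t)) k"
      using a_M[OF k] by (simp add: cW(2)[OF t k] nonlin_twist[OF k] twist_def[of "coef (u' t)"])
  qed
  moreover have "AE x in lebesgue. ?w u 0 x = u0 x"
  proof -
    have "coef (u 0) k = coef u0 k" for k
      by (rule coef_cong_AE[OF HsM_L2[OF H(1)[OF 0]] HsM_L2[OF u0] init])
    then have "synth (twist (coef (u 0))) x = synth (coef u0) x" for x
      using coef_symmetric[OF u0 sym] by (intro synth_cong) (simp add: twist_def)
    then show ?thesis using HsM_eq_synth[OF u0] by auto
  qed
  ultimately show ?thesis using T unfolding restricted_euler_solution_def by blast
qed

lemma unique_solution_symmetric:
  assumes u0: "u0 \<in> HsM crit_exp" and sym: "AE x in lebesgue. u0 (A x) = A (u0 x)"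
    and sol: "unique_maximal_solution crit_exp u0 T u" and t: "t \<in> time_interval T"
  shows "AE x in lebesgue. u t (A x) = A (u t x)"
proof -
  have sol': "restricted_euler_solution crit_exp u0 T u"
    using sol by (simp add: unique_maximal_solution_def)
  have H: "u t \<in> HsM crit_exp"
    using sol' t by (auto simp: restricted_euler_solution_def C1_HsM_def)
  have "AE x in lebesgue. synth (twist (coef (u t))) x = u t x"
    using sol solution_twist[OF u0 sym sol'] t by (auto simp: unique_maximal_solution_def)
  from coef_cong_AE[OF HsM_L2[OF synth_twist_HsM[OF H]] HsM_L2[OF H] this]
  have "coef (u t) k = twist (coef (u t)) k" if "k \<in> M_freq" for k
    using coef_synth_twist[OF H that] by simp
  from coef_symmetric_imp[OF H this] show ?thesis .
qed

end

section \<open>Oddness, permutations and the mirror as instances\<close>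

interpretation negation: shell_symmetry uminus uminus "-1"
  by unfold_locales
     (auto simp: orthogonal_transformation_def linear_uminus intro: linear_uminus)

lemma permutation_symmetry:
  assumes p: "bij p"
  shows "shell_symmetry (permute_vec p) (permute_vec p) 1"
proof
  have lin: "linear (permute_vec p :: real^3 \<Rightarrow> real^3)"
    by (rule linearI) (simp_all add: permute_vec_def vec_eq_iff)
  have inner: "permute_vec p x \<bullet> permute_vec p y = x \<bullet> y" for x y :: "real^3"
    unfolding inner_vec_def permute_vec_def by (simp add: sum.reindex_bij_betw[OF p, of "\<lambda>i. x $ i * y $ i"])
  show "orthogonal_transformation (permute_vec p :: real^3 \<Rightarrow> real^3)"
    by (simp add: orthogonal_transformation_def lin inner)
  have "sigma $ i = 1" for i
    using exhaust_3[of i] by (auto simp: sigma_def)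
  then show "permute_vec p sigma_vec = 1 *\<^sub>R sigma_vec"
    by (simp add: permute_vec_def vec_eq_iff)
  have perm: "permute_vec p k \<in> permutations_of_vec v" if k: "k \<in> permutations_of_vec v" for k v :: "int^3"
  proof -
    obtain q where "bij q" "k = permute_vec q v" using k by (auto simp: permutations_of_vec_def)
    moreover have "permute_vec p (permute_vec q v) = permute_vec (q \<circ> p) v"
      by (simp add: permute_vec_def)
    ultimately show ?thesis using p unfolding permutations_of_vec_def by (auto intro: bij_comp)
  qed
  then have "permute_vec p k \<in> shell n" if "k \<in> shell n" for k n
    using that by (auto simp: shell_def split: if_splits)
  moreover have "permute_vec p (- k) = - permute_vec p k" for k :: "int^3"
    by (simp add: permute_vec_def vec_eq_iff)
  ultimately show "permute_vec p k \<in> pm_shell n" if "k \<in> pm_shell n" for k n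
    using that by (auto simp: pm_shell_def)
  show "of_int_vec (permute_vec p k) = permute_vec p (of_int_vec k)" for k
    by (simp add: permute_vec_def vec_eq_iff)
qed simp

text \<open>The action of \<open>M_sigma\<close> on frequencies. Coordinate sums are multiples of 3
  on \<open>M_freq\<close>, so the division is exact there and the image is again an integer
  vector.\<close>

definition mirror_freq :: "int^3 \<Rightarrow> int^3" where
  "mirror_freq k = k - (2 * ((k $ 1 + k $ 2 + k $ 3) div 3)) *s sigma"

lemma M_sigma_eq: "M_sigma *v x = x - (2 / 3 * (x \<bullet> sigma_vec)) *\<^sub>R sigma_vec"
  by (simp add: M_sigma_def vec3_eq_iff matrix_vector_mult_def sum_3 mat_def sigma_def inner_vec_def algebra_simps)

lemma shell_dirs_uminus: "d \<in> shell_dirs n \<Longrightarrow> - d \<in> shell_dirs n"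
  by (cases "even n"; simp add: shell_dirs_def; elim disjE; simp add: vec3_eq_iff)

text \<open>Reflection followed by negation keeps the multiple of \<open>sigma\<close> and reverses
  the displacement, and the lists of displacements are closed under negation.\<close>

lemma mirror_freq_shell:
  assumes "k \<in> shell n"
  shows "- mirror_freq k \<in> shell n"
proof -
  obtain d where d: "d \<in> shell_dirs n" "k = shell_point n d" using assms by (auto simp: shell_eq)
  have "- mirror_freq k = shell_point n (- d)"
    using shell_total[OF assms] by (simp add: mirror_freq_def d(2) shell_point_def vec3_eq_iff sigma_def)
  then show ?thesis using shell_dirs_uminus[OF d(1)] by (simp add: shell_eq)
qed

lemma mirror_freq_uminus:
  assumes "k \<in> shell n"
  shows "mirror_freq (- k) = - mirror_freq k"
proof -
  have "(- k) $ 1 + (- k) $ 2 + (- k) $ 3 = 3 * (- (2 ^ n))" using shell_total[OF assms] by simp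
  then have "((- k) $ 1 + (- k) $ 2 + (- k) $ 3) div 3 = - (2 ^ n)" by (metis nonzero_mult_div_cancel_left zero_neq_numeral)
  moreover have "(k $ 1 + k $ 2 + k $ 3) div 3 = 2 ^ n" using shell_total[OF assms] by simp
  ultimately show ?thesis by (simp add: mirror_freq_def vec_eq_iff)
qed

lemma M_sigma_of_int_vec:
  assumes "k \<in> pm_shell n"
  shows "of_int_vec (mirror_freq k) = M_sigma *v of_int_vec k"
proof -
  have "k $ 1 + k $ 2 + k $ 3 = 3 * 2 ^ n \<or> k $ 1 + k $ 2 + k $ 3 = 3 * (- (2 ^ n))"
    using pm_shell_total_abs[OF assms] by linarith
  then obtain m where m: "k $ 1 + k $ 2 + k $ 3 = 3 * m" by blast
  have "of_int_vec k \<bullet> sigma_vec = of_int (k $ 1 + k $ 2 + k $ 3)"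
    by (simp add: inner_vec_def sum_3 sigma_def)
  then have "of_int_vec k \<bullet> sigma_vec = 3 * of_int m" unfolding m by simp
  moreover have "mirror_freq k = k - (2 * m) *s sigma" unfolding mirror_freq_def m by simp
  ultimately show ?thesis by (simp add: M_sigma_eq vec_eq_iff)
qed

interpretation mirror: shell_symmetry "(*v) M_sigma" mirror_freq "-1"
proof
  have "(M_sigma *v x) \<bullet> (M_sigma *v y) = x \<bullet> y" for x y
    by (simp add: M_sigma_eq inner_diff_left inner_diff_right sigma_inner_sigma inner_commute[of sigma_vec y])
  then show "orthogonal_transformation ((*v) M_sigma)"
    by (simp add: orthogonal_transformation_def)
  show "M_sigma *v sigma_vec = - 1 *\<^sub>R sigma_vec"
    by (simp add: M_sigma_eq sigma_inner_sigma vec_eq_iff)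
  show "mirror_freq k \<in> pm_shell n" if "k \<in> pm_shell n" for k n
    using that mirror_freq_shell mirror_freq_uminus
    by (auto simp: pm_shell_def image_iff) (metis minus_minus)+
qed (use M_sigma_of_int_vec in auto)

lemma M_sigma_involution: "M_sigma *v (M_sigma *v x) = x"
  by (simp add: M_sigma_eq inner_diff_left sigma_inner_sigma vec_eq_iff algebra_simps)

lemma sigma_mirror_symmetric_iff:
  "sigma_mirror_symmetric u \<longleftrightarrow> (AE x in lebesgue. u (M_sigma *v x) = M_sigma *v u x)"
  unfolding sigma_mirror_symmetric_def
  by (intro arg_cong[where f = "\<lambda>P. almost_everywhere lebesgue P"] ext) (metis M_sigma_involution)

section \<open>Shell amplitudes of a symmetric field\<close>

definition amplitude :: "(real^3 \<Rightarrow> real^3) \<Rightarrow> nat \<Rightarrow> real" where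
  "amplitude u n = Im (coef u (shell_rep n))"

text \<open>Oddness together with reality makes the coefficients imaginary. Permutations act
  transitively on an even shell; an odd shell consists of the two orbits of \<open>freq_h\<close>
  and \<open>freq_j\<close>, which the mirror combined with oddness interchanges.\<close>

lemma coef_eq_amplitude:
  assumes u: "u \<in> HsM crit_exp"
    and sym: "odd_field u" "permutation_symmetric u" "sigma_mirror_symmetric u" and k: "k \<in> shell n"
  shows "coef u k = \<i> * amplitude u n" and "coef u (- k) = - \<i> * amplitude u n"
proof -
  have odd: "coef u (- l) = - coef u l" if "l \<in> M_freq" for l
    using negation.coef_symmetric[OF u, of l] sym(1) that
    by (simp add: odd_field_def negation.twist_def)
  have perm: "coef u l = coef u v" if l: "l \<in> permutations_of_vec v" and v: "v \<in> M_freq" for l v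
  proof -
    obtain p where p: "bij p" "l = permute_vec p v" using l by (auto simp: permutations_of_vec_def)
    interpret shell_symmetry "permute_vec p" "permute_vec p" 1
      by (rule permutation_symmetry[OF p(1)])
    show ?thesis using coef_symmetric[OF u _ v] sym(2) p
      by (simp add: permutation_symmetric_def twist_def)
  qed
  have mirror: "coef u (- mirror_freq l) = coef u l" if l: "l \<in> M_freq" for l
    using mirror.coef_symmetric[OF u _ l] odd[OF mirror.a_M[OF l]] sym(3)
    by (simp add: sigma_mirror_symmetric_iff mirror.twist_def)
  have "coef u k = coef u (shell_rep n)"
  proof (cases "even n")
    case True
    then have "2 * (n div 2) = n" by simp
    then have "freq_k (n div 2) = shell_rep n"
      using True by (simp add: freq_k_def shell_rep_def shell_point_def)
    then show ?thesis
      using k True perm[of k "shell_rep n"] M_freqI[OF shell_subset_pm[OF shell_rep_in_shell]]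
      by (simp add: shell_def)
  next
    case False
    let ?m = "n div 2"
    have n: "Suc (2 * ?m) = n" using False by simp
    have h: "freq_h ?m = shell_rep n"
      using False n by (simp add: freq_h_def shell_rep_def shell_point_def)
    have hs: "freq_h ?m \<in> shell n" "freq_j ?m \<in> shell n"
    proof -
      have "v \<in> permutations_of_vec v" for v :: "int^3"
        unfolding permutations_of_vec_def by (auto intro!: exI[of _ id] simp: permute_vec_def vec_eq_iff)
      then show "freq_h ?m \<in> shell n" "freq_j ?m \<in> shell n" using False by (simp_all add: shell_def)
    qed
    note hM = hs[THEN shell_subset_pm, THEN M_freqI]
    have "- mirror_freq (freq_h ?m) \<in> permutations_of_vec (freq_j ?m)"
      using shell_total[OF hs(1)] n
      by (auto simp: mirror_freq_def permutations_of_vec_eq vec3_eq_iff freq_j_def freq_h_def sigma_def)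
    from perm[OF this hM(2)] have "coef u (freq_j ?m) = coef u (freq_h ?m)"
      using mirror[OF hM(1)] by simp
    then show ?thesis
      using k False perm[of k "freq_h ?m"] perm[of k "freq_j ?m"] hM unfolding h[symmetric]
      by (auto simp: shell_def)
  qed
  moreover have "Re (coef u (shell_rep n)) = 0"
    using odd[OF M_freqI[OF shell_subset_pm[OF shell_rep_in_shell]]]
    by (simp add: coef_uminus complex_eq_iff)
  ultimately show *: "coef u k = \<i> * amplitude u n"
    by (simp add: amplitude_def complex_eq_iff)
  show "coef u (- k) = - \<i> * amplitude u n"
    using odd[OF M_freqI[OF shell_subset_pm[OF k]]] * by simp
qed

lemma sum_pm_shell: "(\<Sum>k\<in>pm_shell n. f k) = (\<Sum>k\<in>shell n. f k) + (\<Sum>k\<in>shell n. f (- k))"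
proof -
  have "(\<Sum>k\<in>pm_shell n. f k) = (\<Sum>k\<in>shell n. f k) + (\<Sum>k\<in>uminus ` shell n. f k)"
    unfolding pm_shell_def using shell_uminus_disjoint by (intro sum.union_disjoint) auto
  also have "(\<Sum>k\<in>uminus ` shell n. f k) = (\<Sum>k\<in>shell n. f (- k))"
    by (subst sum.reindex) (auto simp: inj_on_def)
  finally show ?thesis .
qed

text \<open>The terms at \<open>k\<close> and \<open>- k\<close> have the same real part, the
  amplitude times minus the sine, whence the factor -2.\<close>

lemma shell_sum_amplitude:
  assumes "u \<in> HsM crit_exp" "odd_field u" "permutation_symmetric u" "sigma_mirror_symmetric u"
  shows "shell_sum (coef u) n x = (-2) *\<^sub>R (amplitude u n *\<^sub>R shell_mode n x)"
proof -
  have "shell_sum (coef u) n x = (\<Sum>k\<in>shell n. (Re (coef u k * wave k x) + Re (coef u (- k) * wave (- k) x)) *\<^sub>R v_dir k)"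
    by (simp add: shell_sum_def sum_pm_shell scaleR_left_distrib sum.distrib)
  also have "\<dots> = (\<Sum>k\<in>shell n. (-2) *\<^sub>R (amplitude u n *\<^sub>R (sin (2 * pi * (of_int_vec k \<bullet> x)) *\<^sub>R v_dir k)))"
  proof (intro sum.cong refl)
    fix k assume k: "k \<in> shell n"
    show "(Re (coef u k * wave k x) + Re (coef u (- k) * wave (- k) x)) *\<^sub>R v_dir k =
       (-2) *\<^sub>R (amplitude u n *\<^sub>R (sin (2 * pi * (of_int_vec k \<bullet> x)) *\<^sub>R v_dir k))"
      unfolding coef_eq_amplitude[OF assms k] by (simp add: wave_eq_cis)
  qed
  finally show ?thesis by (simp add: shell_mode_def scaleR_sum_right)
qed

text \<open>This links the unordered sum in \<open>Hs_norm\<close> to partial sums over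
  shells.\<close>

lemma freqs_below_filterlim: "filterlim freqs_below (finite_subsets_at_top M_freq) sequentially"
  unfolding filterlim_finite_subsets_at_top
proof (intro allI impI)
  fix X assume X: "finite X \<and> X \<subseteq> M_freq"
  then have "\<forall>k\<in>X. \<exists>n. k \<in> pm_shell n" using M_freq_pm_shell by blast
  then obtain f where f: "\<And>k. k \<in> X \<Longrightarrow> k \<in> pm_shell (f k)" by metis
  have "X \<subseteq> freqs_below N" if "N \<ge> Suc (Max (insert 0 (f ` X)))" for N
  proof
    fix k assume k: "k \<in> X"
    then have "f k \<le> Max (insert 0 (f ` X))" using X by (intro Max_ge) auto
    then show "k \<in> freqs_below N" using pm_shell_freqs_below[OF f[OF k]] that by simp
  qed
  then show "\<forall>\<^sub>F N in sequentially. finite (freqs_below N) \<and> X \<subseteq> freqs_below N \<and> freqs_below N \<subseteq> M_freq"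
    by (intro eventually_sequentiallyI) (auto intro: freqs_below_M)
qed

text \<open>Subtracting \<open>psum\<close> deletes the coefficients below the cutoff, so the
  squared norm is the tail of a convergent sum.\<close>

lemma Hs_norm_psum_diff_tendsto:
  assumes u: "u \<in> HsM crit_exp"
  shows "(\<lambda>N. Hs_norm crit_exp (\<lambda>x. u x - psum (coef u) N x)) \<longlonglongrightarrow> 0"
proof -
  note adm = coef_admissible[OF u]
  let ?f = "Hs_term crit_exp u"
  have sM: "?f summable_on M_freq"
    by (rule summable_on_subset_banach[OF HsM_summable[OF u]]) auto
  have eq: "Hs_norm crit_exp (\<lambda>x. u x - psum (coef u) N x) = sqrt (infsum ?f M_freq - sum ?f (freqs_below N))" for N
  proof -
    obtain C where C: "\<And>N x. norm (psum (coef u) N x) \<le> C" using psum_bounded[OF adm] by blast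
    have L: "L2_field (psum (coef u) N)"
      by (rule L2_field_bounded[OF psum_measurable _ C]) (simp add: periodic_def psum_eq wave_periodic)
    have F: "fourier (psum (coef u) N) k = (if k \<in> freqs_below N then fourier u k else 0)" for k
      by (auto simp: vec_eq_iff fourier_nth[of "psum _ _"] fourier_psum[OF adm] HsM_fourier[OF u] dest: freqs_below_M)
    have T: "Hs_term crit_exp (\<lambda>x. u x - psum (coef u) N x) k = (if k \<in> freqs_below N then 0 else ?f k)" for k
      by (simp add: Hs_term_def fourier_diff[OF HsM_L2[OF u] L] F)
    have "infsum (Hs_term crit_exp (\<lambda>x. u x - psum (coef u) N x)) (- {0}) = infsum ?f (M_freq - freqs_below N)"
      using HsM_Hs_term_0[OF u] by (intro infsum_cong_neutral) (auto simp: T)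
    also have "\<dots> = infsum ?f M_freq - infsum ?f (freqs_below N)"
      by (rule infsum_Diff[OF sM]) (auto intro: freqs_below_M)
    finally show ?thesis by (simp add: Hs_norm_def)
  qed
  have "(sum ?f \<longlongrightarrow> infsum ?f M_freq) (finite_subsets_at_top M_freq)"
    using has_sum_infsum[OF sM] by (simp add: has_sum_def)
  from filterlim_compose[OF this freqs_below_filterlim]
  have "(\<lambda>N. sqrt (infsum ?f M_freq - sum ?f (freqs_below N))) \<longlonglongrightarrow> sqrt (infsum ?f M_freq - infsum ?f M_freq)"
    by (intro tendsto_intros)
  then show ?thesis by (simp add: eq)
qed

lemma shell_expansion_amplitude:
  assumes "u \<in> HsM crit_exp" "odd_field u" "permutation_symmetric u" "sigma_mirror_symmetric u"
  shows "shell_expansion crit_exp (amplitude u) u"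
  unfolding shell_expansion_def
proof
  note S = shell_sum_amplitude[OF assms]
  have eq: "amplitude u n *\<^sub>R shell_mode n x = (-1/2) *\<^sub>R shell_sum (coef u) n x" for n x
    by (simp add: S)
  have sm: "summable (\<lambda>n. shell_sum (coef u) n x)" for x
    by (rule shell_sum_summable[OF coef_admissible[OF assms(1)]])
  have sums: "(\<lambda>n. amplitude u n *\<^sub>R shell_mode n x) sums ((-1/2) *\<^sub>R synth (coef u) x)" for x
    unfolding eq synth_def by (intro sums_scaleR_right summable_sums sm)
  show "AE x in lebesgue. summable (\<lambda>n. amplitude u n *\<^sub>R shell_mode n x) \<and>
      u x = (-2) *\<^sub>R (\<Sum>n. amplitude u n *\<^sub>R shell_mode n x)"
    using HsM_eq_synth[OF assms(1)]
    by eventually_elim (simp add: sums_summable[OF sums] sums_unique[OF sums, symmetric])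
  have "(-2) *\<^sub>R (\<Sum>n<N. amplitude u n *\<^sub>R shell_mode n x) = psum (coef u) N x" for N x
    by (simp add: psum_def S scaleR_sum_right)
  then show "(\<lambda>N. Hs_norm crit_exp (\<lambda>x. u x - (-2) *\<^sub>R (\<Sum>n<N. amplitude u n *\<^sub>R shell_mode n x))) \<longlonglongrightarrow> 0"
    using Hs_norm_psum_diff_tendsto[OF assms(1)] by simp
qed

section \<open>The shell equations\<close>

text \<open>The triads at \<open>k\<close> form three families: both members in the shell below, and
  the two orderings of a member above with a negated member of the same shell. The second ordering
  vanishes. Each other nonempty family has two members, which with the prefactor
  \<open>2 * pi\<close> gives \<open>4 * pi * c m = sqrt 2 * pi * beta m * sqrt 3 ^ Suc m\<close>;
  the signs come from multiplying imaginary coefficients.\<close>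

lemma nonlin_shell_rep:
  assumes pos: "\<And>m k. k \<in> shell m \<Longrightarrow> \<phi> k = \<i> * complex_of_real (\<psi> m)"
    and neg: "\<And>m k. k \<in> shell m \<Longrightarrow> \<phi> (- k) = - \<i> * complex_of_real (\<psi> m)"
  shows "nonlin \<phi> (shell_rep n) = \<i> * complex_of_real
    (sqrt 2 * pi * prev beta n * sqrt 3 ^ n * (prev \<psi> n)\<^sup>2
     - sqrt 2 * pi * beta n * sqrt 3 ^ (n + 1) * \<psi> n * \<psi> (n + 1))"
proof -
  define k where "k = shell_rep n"
  have k: "k \<in> shell n" unfolding k_def by (rule shell_rep_in_shell)
  define g where "g pq = complex_of_real ((of_int_vec k \<bullet> v_dir (snd pq)) * (v_dir k \<bullet> v_dir (fst pq)))
    * \<phi> (fst pq) * \<phi> (snd pq)" for pq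
  define c where "c m = sqrt 3 ^ Suc m / (2 * sqrt 2) * beta m" for m
  define D where "D = {q \<in> shell n. k + q \<in> shell (Suc n)}"
  \<comment> \<open>Empty for \<open>n = 0\<close>, in agreement with the convention in
    \<open>prev\<close>.\<close>
  define C where "C = (case n of 0 \<Rightarrow> {} | Suc m \<Rightarrow> {p \<in> shell m. k - p \<in> shell m})"
  let ?T1 = "(\<lambda>p. (p, k - p)) ` C" and ?T2 = "(\<lambda>q. (k + q, - q)) ` D" and ?T3 = "(\<lambda>q. (- q, k + q)) ` D"
  have fin: "finite C" "finite D" by (auto simp: C_def D_def split: nat.split)
  have cardD: "card D = 2" unfolding D_def k_def by (rule card_shell_add)
  have MI: "l \<in> shell m \<Longrightarrow> l \<in> M_freq" "- l \<in> shell m \<Longrightarrow> l \<in> M_freq" for l m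
    using M_freqI[OF shell_subset_pm] M_freq_uminus by blast+
  have T: "triads k = ?T1 \<union> (?T2 \<union> ?T3)"
  proof (intro equalityI subsetI)
    fix pq assume "pq \<in> triads k"
    then obtain p q where pq: "pq = (p, q)" "p \<in> M_freq" "q \<in> M_freq" "p + q = k"
      by (auto simp: triads_def)
    from triad_cases[OF k pq(2-4)]
    consider m where "n = Suc m" "p \<in> shell m" "q \<in> shell m" | "p \<in> shell (Suc n)" "- q \<in> shell n"
      | "q \<in> shell (Suc n)" "- p \<in> shell n" by blast
    then show "pq \<in> ?T1 \<union> (?T2 \<union> ?T3)"
    proof cases
      case (1 m)
      have "q = k - p" using pq(4) by (simp add: algebra_simps)
      then show ?thesis using 1 pq(1) by (auto simp: C_def)
    next
      case 2
      have "p = k + (- q)" using pq(4) by (simp add: algebra_simps)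
      then show ?thesis using 2 pq(1) by (auto simp: D_def intro!: image_eqI[of _ _ "- q"])
    next
      case 3
      have "q = k + (- p)" using pq(4) by (simp add: algebra_simps)
      then show ?thesis using 3 pq(1) by (auto simp: D_def intro!: image_eqI[of _ _ "- p"])
    qed
  next
    fix pq assume "pq \<in> ?T1 \<union> (?T2 \<union> ?T3)"
    then show "pq \<in> triads k" by (auto simp: triads_def C_def D_def MI split: nat.splits)
  qed
  have disj: "?T1 \<inter> (?T2 \<union> ?T3) = {}" "?T2 \<inter> ?T3 = {}"
  proof -
    have pC: "p \<in> shell (n - 1)" "k - p \<in> shell (n - 1)" if "p \<in> C" for p
      using that by (auto simp: C_def split: nat.splits)
    have pD: "q \<in> shell n" "k + q \<in> shell (Suc n)" if "q \<in> D" for q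
      using that by (auto simp: D_def)
    have ne: "k - p \<noteq> - q" "p \<noteq> - q" if "p \<in> C" "q \<in> D" for p q
      using pC[OF that(1)] pD[OF that(2)] shell_uminus_disjoint by metis+
    show "?T1 \<inter> (?T2 \<union> ?T3) = {}"
    proof (rule equals0I)
      fix x assume "x \<in> ?T1 \<inter> (?T2 \<union> ?T3)"
      then obtain p q where "p \<in> C" "q \<in> D" "x = (p, k - p)" "x = (k + q, - q) \<or> x = (- q, k + q)"
        by blast
      then show False using ne by (metis prod.inject)
    qed
    have ne': "k + q \<noteq> - q'" if "q \<in> D" "q' \<in> D" for q q'
      using pD(2)[OF that(1)] pD(1)[OF that(2)] shell_uminus_disjoint by metis
    then show "?T2 \<inter> ?T3 = {}" by blast
  qed
  have i: "\<i> * (x::complex) * (\<i> * y) = - (x * y)" "\<i> * x * (- \<i> * y) = x * y" for x y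
    by (simp_all add: algebra_simps)
  have "sum g ?T2 = (\<Sum>q\<in>D. complex_of_real (c n * \<psi> n * \<psi> (Suc n)))"
  proof (subst sum.reindex)
    show "inj_on (\<lambda>q. (k + q, - q)) D" by (auto simp: inj_on_def)
    show "sum (g \<circ> (\<lambda>q. (k + q, - q))) D = (\<Sum>q\<in>D. complex_of_real (c n * \<psi> n * \<psi> (Suc n)))"
    proof (intro sum.cong refl)
      fix q assume "q \<in> D"
      then have q: "q \<in> shell n" "k + q \<in> shell (Suc n)" by (auto simp: D_def)
      \<comment> \<open>As \<open>q\<close> is orthogonal to \<open>v_dir q\<close>, the first
        \<open>k\<close> may be replaced by \<open>k + q\<close>; what results is the coupling of
        the triad with sum \<open>k + q\<close>.\<close>
      have "(of_int_vec k \<bullet> v_dir q) * (v_dir k \<bullet> v_dir (k + q)) = c n"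
        using triad_coupling[OF k q] inner_v_dir_self[OF q(1)]
        by (simp add: c_def inner_add_left inner_commute[of "v_dir k"])
      then show "(g \<circ> (\<lambda>q. (k + q, - q))) q = complex_of_real (c n * \<psi> n * \<psi> (Suc n))"
        by (simp add: g_def pos[OF q(2)] neg[OF q(1)] algebra_simps flip: of_real_mult)
    qed
  qed
  then have T2: "sum g ?T2 = complex_of_real (2 * c n * \<psi> n * \<psi> (Suc n))" by (simp add: cardD)
  have T3: "sum g ?T3 = 0"
  proof (rule sum.neutral, rule ballI)
    fix pq assume "pq \<in> ?T3"
    then obtain q where "q \<in> D" and pq: "pq = (- q, k + q)" by auto
    then have q: "q \<in> shell n" "k + q \<in> shell (Suc n)" by (auto simp: D_def)
    \<comment> \<open>In this order \<open>k\<close> meets \<open>v_dir (k + q)\<close>, to which it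
      is orthogonal.\<close>
    show "g pq = 0" using triad_inner_v_dir_high[OF k q] by (simp add: g_def pq)
  qed
  have T1: "sum g ?T1 = - complex_of_real (2 * (case n of 0 \<Rightarrow> 0 | Suc m \<Rightarrow> c m * (\<psi> m)\<^sup>2))"
  proof (cases n)
    case 0
    then show ?thesis by (simp add: C_def)
  next
    case (Suc m)
    have "sum g ?T1 = (\<Sum>p\<in>C. - complex_of_real (c m * (\<psi> m)\<^sup>2))"
    proof (subst sum.reindex)
      show "inj_on (\<lambda>p. (p, k - p)) C" by (auto simp: inj_on_def)
      show "sum (g \<circ> (\<lambda>p. (p, k - p))) C = (\<Sum>p\<in>C. - complex_of_real (c m * (\<psi> m)\<^sup>2))"
      proof (intro sum.cong refl)
        fix p assume "p \<in> C"
        then have p: "p \<in> shell m" "k - p \<in> shell m" using Suc by (auto simp: C_def)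
        have "(of_int_vec k \<bullet> v_dir (k - p)) * (v_dir k \<bullet> v_dir p) = c m"
          using triad_coupling[OF p] k Suc by (simp add: c_def)
        then show "(g \<circ> (\<lambda>p. (p, k - p))) p = - complex_of_real (c m * (\<psi> m)\<^sup>2)"
          by (simp add: g_def pos[OF p(1)] pos[OF p(2)] power2_eq_square algebra_simps flip: of_real_mult)
      qed
    qed
    moreover have "card C = 2" using card_shell_diff[of m] Suc by (simp add: C_def k_def)
    ultimately show ?thesis using Suc by simp
  qed
  have "(\<Sum>pq\<in>triads k. g pq) = sum g ?T1 + (sum g ?T2 + sum g ?T3)"
    unfolding T using fin disj by (simp add: sum.union_disjoint)
  moreover have "nonlin \<phi> k = - 2 * pi * \<i> * (\<Sum>pq\<in>triads k. g pq)"
    by (simp add: nonlin_def case_prod_beta g_def)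
  ultimately have "nonlin \<phi> k = - 2 * pi * \<i> * (sum g ?T1 + sum g ?T2)"
    by (simp add: T3)
  also have "\<dots> = \<i> * complex_of_real (4 * pi * (case n of 0 \<Rightarrow> 0 | Suc m \<Rightarrow> c m * (\<psi> m)\<^sup>2)
      - 4 * pi * c n * \<psi> n * \<psi> (Suc n))"
    unfolding T1 T2 by (simp add: algebra_simps)
  also have "4 * pi * c n * \<psi> n * \<psi> (Suc n) = sqrt 2 * pi * beta n * sqrt 3 ^ (n + 1) * \<psi> n * \<psi> (n + 1)" for n
    by (simp add: c_def field_simps)
  also have "4 * pi * (case n of 0 \<Rightarrow> 0 | Suc m \<Rightarrow> c m * (\<psi> m)\<^sup>2) =
      sqrt 2 * pi * prev beta n * sqrt 3 ^ n * (prev \<psi> n)\<^sup>2"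
    by (cases n) (simp_all add: c_def prev_def field_simps)
  finally show ?thesis unfolding k_def .
qed

section \<open>Regularity and bounds of the amplitudes along a solution\<close>

lemma amplitude_diff: "L2_field u \<Longrightarrow> L2_field v \<Longrightarrow> amplitude (\<lambda>x. u x - v x) n = amplitude u n - amplitude v n"
  by (simp add: amplitude_def coef_diff)

lemma amplitude_scaleR: "amplitude (\<lambda>x. c *\<^sub>R u x) n = c * amplitude u n"
  by (simp add: amplitude_def coef_scaleR)

lemma amplitude_le_Hs_norm:
  assumes "u \<in> HsM crit_exp"
  shows "\<bar>amplitude u n\<bar> * sqrt 3 ^ n \<le> Hs_norm crit_exp u"
proof -
  have "\<bar>amplitude u n\<bar> * sqrt 3 ^ n \<le> norm (coef u (shell_rep n)) * sqrt 3 ^ n"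
    unfolding amplitude_def by (intro mult_right_mono abs_Im_le_cmod) auto
  also have "\<dots> \<le> Hs_norm crit_exp u"
    by (rule coef_le_Hs_norm[OF assms shell_subset_pm[OF shell_rep_in_shell]])
  finally show ?thesis .
qed

lemma C1_HsM_amplitude_quotient:
  assumes C1: "C1_HsM crit_exp T u u'" and t: "t \<in> time_interval T" and r: "r \<in> time_interval T"
  shows "\<bar>(amplitude (u r) n - amplitude (u t) n) / (r - t) - amplitude (u' t) n\<bar> * sqrt 3 ^ n
    \<le> Hs_norm crit_exp (\<lambda>x. (1 / (r - t)) *\<^sub>R (u r x - u t x) - u' t x)"
proof -
  have H: "u t \<in> HsM crit_exp" "u r \<in> HsM crit_exp" "u' t \<in> HsM crit_exp"
    using C1 t r by (auto simp: C1_HsM_def)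
  note L = H[THEN HsM_L2]
  have "(\<lambda>x. (1 / (r - t)) *\<^sub>R (u r x - u t x) - u' t x) \<in> HsM crit_exp"
    by (intro HsM_diff HsM_scaleR H)
  from amplitude_le_Hs_norm[OF this, of n] show ?thesis
    by (simp add: amplitude_diff amplitude_scaleR L L2_field_diff L2_field_scaleR)
qed

lemma amplitude_has_derivative:
  assumes C1: "C1_HsM crit_exp T u u'" and t: "t \<in> time_interval T"
  shows "((\<lambda>r. amplitude (u r) n) has_real_derivative amplitude (u' t) n) (at t within time_interval T)"
proof -
  have "((\<lambda>r. (amplitude (u r) n - amplitude (u t) n) / (r - t) - amplitude (u' t) n) \<longlongrightarrow> 0)
      (at t within time_interval T)"
  proof (rule Lim_null_comparison)
    show "\<forall>\<^sub>F r in at t within time_interval T.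
        norm ((amplitude (u r) n - amplitude (u t) n) / (r - t) - amplitude (u' t) n)
        \<le> Hs_norm crit_exp (\<lambda>x. (1 / (r - t)) *\<^sub>R (u r x - u t x) - u' t x)"
      using mem_time_interval_eventually
    proof eventually_elim
      case (elim r)
      let ?d = "\<bar>(amplitude (u r) n - amplitude (u t) n) / (r - t) - amplitude (u' t) n\<bar>"
      have "?d * 1 \<le> ?d * sqrt 3 ^ n" by (intro mult_left_mono one_le_power) auto
      then show ?case using C1_HsM_amplitude_quotient[OF C1 t elim, of n] by simp
    qed
    show "((\<lambda>r. Hs_norm crit_exp (\<lambda>x. (1 / (r - t)) *\<^sub>R (u r x - u t x) - u' t x)) \<longlongrightarrow> 0)
        (at t within time_interval T)"
      using C1 t by (simp add: C1_HsM_def)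
  qed
  then show ?thesis unfolding has_field_derivative_iff by (rule LIM_zero_cancel)
qed

text \<open>Near \<open>t\<close> the difference quotient is within 1 of the derivative in norm, so
  the amplitudes of \<open>u r\<close> are controlled by the norms of \<open>u t\<close> and
  \<open>u' t\<close>, uniformly in \<open>n\<close>.\<close>

lemma amplitude_locally_bounded:
  assumes C1: "C1_HsM crit_exp T u u'" and t: "t \<in> time_interval T"
  shows "\<exists>d>0. \<exists>B. \<forall>r\<in>time_interval T. \<bar>r - t\<bar> < d \<longrightarrow> (\<forall>n. \<bar>amplitude (u r) n\<bar> * sqrt 3 ^ n \<le> B)"
proof -
  let ?N = "\<lambda>r. Hs_norm crit_exp (\<lambda>x. (1 / (r - t)) *\<^sub>R (u r x - u t x) - u' t x)"
  have H: "u t \<in> HsM crit_exp" "u' t \<in> HsM crit_exp" using C1 t by (auto simp: C1_HsM_def)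
  have "(?N \<longlongrightarrow> 0) (at t within time_interval T)" using C1 t by (simp add: C1_HsM_def)
  then have "\<forall>\<^sub>F r in at t within time_interval T. ?N r < 1" by (rule order_tendstoD) simp
  then obtain d where d: "d > 0" "\<And>r. r \<in> time_interval T \<Longrightarrow> r \<noteq> t \<Longrightarrow> \<bar>r - t\<bar> < d \<Longrightarrow> ?N r < 1"
    unfolding eventually_at dist_real_def by blast
  let ?B = "Hs_norm crit_exp (u t) + 1 + Hs_norm crit_exp (u' t)"
  \<comment> \<open>The radius is at most 1 so that the factor \<open>r - t\<close> can be estimated
    by 1.\<close>
  have "\<bar>amplitude (u r) n\<bar> * sqrt 3 ^ n \<le> ?B"
    if r: "r \<in> time_interval T" "\<bar>r - t\<bar> < min d 1" for r n
  proof (cases "r = t")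
    case True
    then show ?thesis using amplitude_le_Hs_norm[OF H(1), of n] Hs_norm_nonneg[of crit_exp "u' t"] by simp
  next
    case False
    define q where "q = (amplitude (u r) n - amplitude (u t) n) / (r - t) - amplitude (u' t) n"
    have q: "\<bar>q\<bar> * sqrt 3 ^ n \<le> 1"
      using C1_HsM_amplitude_quotient[OF C1 t r(1), of n] d(2)[OF r(1) False] r(2) unfolding q_def by simp
    have "amplitude (u r) n = amplitude (u t) n + (r - t) * (q + amplitude (u' t) n)"
      using False by (simp add: q_def field_simps)
    moreover have "\<bar>(r - t) * (q + amplitude (u' t) n)\<bar> \<le> \<bar>r - t\<bar> * (\<bar>q\<bar> + \<bar>amplitude (u' t) n\<bar>)"
      unfolding abs_mult by (intro mult_left_mono abs_triangle_ineq) auto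
    ultimately have "\<bar>amplitude (u r) n\<bar> \<le> \<bar>amplitude (u t) n\<bar> + \<bar>r - t\<bar> * (\<bar>q\<bar> + \<bar>amplitude (u' t) n\<bar>)"
      by linarith
    also have "\<dots> \<le> \<bar>amplitude (u t) n\<bar> + 1 * (\<bar>q\<bar> + \<bar>amplitude (u' t) n\<bar>)"
      using r(2) by (intro add_left_mono mult_right_mono) auto
    finally have "\<bar>amplitude (u r) n\<bar> * sqrt 3 ^ n \<le>
        (\<bar>amplitude (u t) n\<bar> + 1 * (\<bar>q\<bar> + \<bar>amplitude (u' t) n\<bar>)) * sqrt 3 ^ n"
      by (intro mult_right_mono) auto
    then show ?thesis
      using q amplitude_le_Hs_norm[OF H(1), of n] amplitude_le_Hs_norm[OF H(2), of n]
      by (simp add: ring_distribs)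
  qed
  then show ?thesis using d(1) by (intro exI[of _ "min d 1"] conjI exI[of _ ?B]) auto
qed

lemma time_interval_subset: "\<tau> \<in> time_interval T \<Longrightarrow> {0..\<tau>} \<subseteq> time_interval T"
  by (auto simp: time_interval_def) (meson ereal_less_eq(3) le_less_trans)

lemma amplitude_bounded:
  assumes C1: "C1_HsM crit_exp T u u'" and \<tau>: "\<tau> \<in> time_interval T"
  shows "\<exists>B. \<forall>r\<in>{0..\<tau>}. \<forall>n. \<bar>amplitude (u r) n\<bar> * sqrt 3 ^ n \<le> B"
proof -
  define J where "J = {0..\<tau>}"
  have J: "J \<subseteq> time_interval T" unfolding J_def by (rule time_interval_subset[OF \<tau>])
  have "0 \<le> \<tau>" using \<tau> by (simp add: time_interval_def)
  \<comment> \<open>The small intervals in the local step of the bisection may stick out of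
    \<open>{0..\<tau>}\<close>, hence the guard \<open>r \<in> J\<close>.\<close>
  then have "\<exists>B. \<forall>r\<in>{0..\<tau>}. r \<in> J \<longrightarrow> (\<forall>n. \<bar>amplitude (u r) n\<bar> * sqrt 3 ^ n \<le> B)"
  proof (induction rule: Bolzano)
    case (trans a b c)
    then obtain B B' where B:
      "\<forall>r\<in>{a..b}. r \<in> J \<longrightarrow> (\<forall>n. \<bar>amplitude (u r) n\<bar> * sqrt 3 ^ n \<le> B)"
      "\<forall>r\<in>{b..c}. r \<in> J \<longrightarrow> (\<forall>n. \<bar>amplitude (u r) n\<bar> * sqrt 3 ^ n \<le> B')" by blast
    have "\<bar>amplitude (u r) n\<bar> * sqrt 3 ^ n \<le> max B B'" if "r \<in> {a..c}" "r \<in> J" for r n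
      using that B by (cases "r \<le> b") (auto simp: le_max_iff_disj)
    then show ?case by blast
  next
    case (local t)
    then have t: "t \<in> time_interval T" using time_interval_subset[OF \<tau>] by auto
    from amplitude_locally_bounded[OF C1 this] obtain d B where d: "d > 0"
      "\<forall>r\<in>time_interval T. \<bar>r - t\<bar> < d \<longrightarrow> (\<forall>n. \<bar>amplitude (u r) n\<bar> * sqrt 3 ^ n \<le> B)" by blast
    have "\<bar>amplitude (u r) n\<bar> * sqrt 3 ^ n \<le> B"
      if "a \<le> t \<and> t \<le> b \<and> b - a < d" "r \<in> {a..b}" "r \<in> J" for a b r n
    proof -
      have "r \<in> time_interval T" using that J by auto
      moreover have "\<bar>r - t\<bar> < d" using that by auto
      ultimately show ?thesis using d(2) by blast
    qed
    then show ?case using d(1) by blast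
  qed
  then show ?thesis by (auto simp: J_def)
qed

section \<open>Blow-up for the shell equations\<close>

lemma beta_pos: "beta n > 0"
  by (simp add: beta_eq add_pos_pos)

lemma beta_le_1: "beta n \<le> 1"
proof -
  have "1 \<le> sqrt (1 + 1 / 2 * (3 / 4) ^ n)" by simp
  then show ?thesis unfolding beta_eq by (subst divide_le_eq_1_pos) (auto simp: add_pos_pos)
qed

lemma beta_mono: "m \<le> n \<Longrightarrow> beta m \<le> beta n"
  unfolding beta_eq
  by (intro divide_left_mono real_sqrt_le_mono add_left_mono mult_left_mono power_decreasing mult_pos_pos)
     (auto simp: add_pos_pos)

text \<open>The decay \<open>bounded\<close> is what boundedness in the critical space gives; it makes the energy flux
  through high shells vanish.\<close>

locale shell_solution =
  fixes \<psi> :: "nat \<Rightarrow> real \<Rightarrow> real" and \<tau> B :: real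
  assumes \<tau>: "0 \<le> \<tau>"
    and deriv: "t \<in> {0..\<tau>} \<Longrightarrow> (\<psi> n has_real_derivative
        sqrt 2 * pi * prev beta n * sqrt 3 ^ n * (prev (\<lambda>m. \<psi> m t) n)\<^sup>2
        - sqrt 2 * pi * beta n * sqrt 3 ^ (n + 1) * \<psi> n t * \<psi> (n + 1) t) (at t within {0..\<tau>})"
    and bounded: "t \<in> {0..\<tau>} \<Longrightarrow> \<bar>\<psi> n t\<bar> * sqrt 3 ^ n \<le> B"
begin

abbreviation c :: real where "c \<equiv> sqrt 2 * pi"

definition rate :: "nat \<Rightarrow> real \<Rightarrow> real" where
  "rate n t = c * prev beta n * sqrt 3 ^ n * (prev (\<lambda>m. \<psi> m t) n)\<^sup>2
     - c * beta n * sqrt 3 ^ (n + 1) * \<psi> n t * \<psi> (n + 1) t"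

lemma has_rate: "t \<in> {0..\<tau>} \<Longrightarrow> (\<psi> n has_real_derivative rate n t) (at t within {0..\<tau>})"
  unfolding rate_def by (rule deriv)

lemma B_nonneg: "0 \<le> B"
  using bounded[of 0 0] \<tau> by simp

lemma abs_le: "t \<in> {0..\<tau>} \<Longrightarrow> \<bar>\<psi> n t\<bar> \<le> B / sqrt 3 ^ n"
  using bounded[of t n] by (simp add: field_simps)

lemma square_le: "t \<in> {0..\<tau>} \<Longrightarrow> (\<psi> n t)\<^sup>2 \<le> B\<^sup>2 / 3 ^ n"
proof -
  assume "t \<in> {0..\<tau>}"
  then have "\<bar>\<psi> n t\<bar>\<^sup>2 \<le> (B / sqrt 3 ^ n)\<^sup>2" by (intro power_mono abs_le) auto
  then show ?thesis by (simp add: power_divide sqrt3_power_square)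
qed

section \<open>Conservation of energy\<close>

definition E :: "nat \<Rightarrow> real \<Rightarrow> real" where
  "E N t = (\<Sum>n<N. (\<psi> n t)\<^sup>2)"

text \<open>Telescoping: what leaves one shell enters the next, and only the transfer out of the
  last shell remains.\<close>

lemma energy_flux:
  "(\<Sum>n<Suc N. \<psi> n t * rate n t) = - (c * beta N * sqrt 3 ^ (N + 1) * (\<psi> N t)\<^sup>2 * \<psi> (N + 1) t)"
proof (induction N)
  case 0
  then show ?case by (simp add: rate_def prev_def power2_eq_square)
next
  case (Suc N)
  have "(\<Sum>n<Suc (Suc N). \<psi> n t * rate n t) =
      - (c * beta N * sqrt 3 ^ (N + 1) * (\<psi> N t)\<^sup>2 * \<psi> (N + 1) t) + \<psi> (Suc N) t * rate (Suc N) t"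
    using Suc by simp
  also have "\<dots> = - (c * beta (Suc N) * sqrt 3 ^ (Suc N + 1) * (\<psi> (Suc N) t)\<^sup>2 * \<psi> (Suc N + 1) t)"
    by (simp add: rate_def prev_def algebra_simps power2_eq_square)
  finally show ?case .
qed

text \<open>The factor \<open>sqrt 3 ^ (N + 1)\<close> is absorbed by \<open>\<psi> (N + 1)\<close>,
  and the square of \<open>\<psi> N\<close> supplies the decay \<open>3 ^ N\<close>.\<close>

lemma flux_le:
  assumes t: "t \<in> {0..\<tau>}"
  shows "\<bar>c * beta N * sqrt 3 ^ (N + 1) * (\<psi> N t)\<^sup>2 * \<psi> (N + 1) t\<bar> \<le> c * B ^ 3 / 3 ^ N"
proof -
  have "\<bar>c * beta N * sqrt 3 ^ (N + 1) * (\<psi> N t)\<^sup>2 * \<psi> (N + 1) t\<bar> =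
      c * (beta N * ((\<psi> N t)\<^sup>2 * (\<bar>\<psi> (N + 1) t\<bar> * sqrt 3 ^ (N + 1))))"
    using beta_pos[of N] by (simp add: abs_mult)
  also have "\<dots> \<le> c * (1 * (B\<^sup>2 / 3 ^ N * B))"
    using beta_pos[of N] B_nonneg
    by (intro mult_left_mono mult_mono beta_le_1 square_le bounded t mult_nonneg_nonneg) auto
  also have "\<dots> = c * B ^ 3 / 3 ^ N" by (simp add: power2_eq_square power3_eq_cube)
  finally show ?thesis .
qed

lemma energy_change:
  assumes t: "t \<in> {0..\<tau>}"
  shows "\<bar>E (Suc N) t - E (Suc N) 0\<bar> \<le> 2 * \<tau> * (c * B ^ 3 / 3 ^ N)"
proof -
  have "norm (E (Suc N) t - E (Suc N) 0) \<le> 2 * (c * B ^ 3 / 3 ^ N) * norm (t - 0)"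
  proof (rule field_differentiable_bound)
    fix r assume r: "r \<in> {0..\<tau>}"
    have "((\<lambda>r. (\<psi> n r)\<^sup>2) has_real_derivative 2 * (\<psi> n r * rate n r)) (at r within {0..\<tau>})" for n
      using DERIV_power[OF has_rate[OF r, of n], of 2] by (simp add: mult_ac)
    then show "(E (Suc N) has_field_derivative 2 * (\<Sum>n<Suc N. \<psi> n r * rate n r)) (at r within {0..\<tau>})"
      unfolding E_def sum_distrib_left by (intro DERIV_sum)
    show "norm (2 * (\<Sum>n<Suc N. \<psi> n r * rate n r)) \<le> 2 * (c * B ^ 3 / 3 ^ N)"
      unfolding energy_flux using flux_le[OF r, of N] by simp
  qed (use t \<tau> in auto)
  also have "\<dots> \<le> 2 * (c * B ^ 3 / 3 ^ N) * \<tau>"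
    using t B_nonneg by (intro mult_left_mono) auto
  finally show ?thesis by (simp add: mult_ac)
qed

lemma energy_summable: "t \<in> {0..\<tau>} \<Longrightarrow> summable (\<lambda>n. (\<psi> n t)\<^sup>2)"
proof -
  assume "t \<in> {0..\<tau>}"
  from square_le[OF this] have "norm ((\<psi> n t)\<^sup>2) \<le> B\<^sup>2 * (1 / 3) ^ n" for n
    by (simp add: power_one_over)
  moreover have "summable (\<lambda>n. B\<^sup>2 * (1 / 3) ^ n)"
    by (intro summable_mult summable_geometric) simp
  ultimately show ?thesis by (rule_tac summable_comparison_test'[of _ 0])
qed

lemma geometric_tendsto: "(\<lambda>N. K / 3 ^ N) \<longlonglongrightarrow> (0::real)"
proof -
  have "(\<lambda>N. K * (1 / 3) ^ N) \<longlonglongrightarrow> K * (0::real)"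
    by (intro tendsto_mult_left LIMSEQ_realpow_zero) auto
  then show ?thesis by (simp add: power_one_over)
qed

definition energy :: real where
  "energy = (\<Sum>n. (\<psi> n 0)\<^sup>2)"

text \<open>The limit is the same for every \<open>t\<close>: the mean value estimate
  \<open>energy_change\<close> tends to 0 with the flux.\<close>

lemma E_tendsto:
  assumes t: "t \<in> {0..\<tau>}"
  shows "(\<lambda>N. E (Suc N) t) \<longlonglongrightarrow> energy"
proof -
  have 0: "(\<lambda>N. E (Suc N) 0) \<longlonglongrightarrow> energy"
    unfolding E_def energy_def using \<tau> by (intro LIMSEQ_Suc summable_LIMSEQ energy_summable) auto
  have "(\<lambda>N. E (Suc N) t - E (Suc N) 0) \<longlonglongrightarrow> 0"
  proof (rule Lim_null_comparison)
    show "\<forall>\<^sub>F N in sequentially. norm (E (Suc N) t - E (Suc N) 0) \<le> 2 * \<tau> * (c * B ^ 3) / 3 ^ N"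
      using energy_change[OF t] by simp
  qed (rule geometric_tendsto)
  from tendsto_add[OF this 0] show ?thesis by simp
qed

section \<open>The growing functional and the bound on the time\<close>

definition h :: "nat \<Rightarrow> real" where
  "h n = sqrt 3 powr (- real n / 4)"

definition H :: "nat \<Rightarrow> real \<Rightarrow> real" where
  "H N t = (\<Sum>n<N. h n * \<psi> n t)"

lemma h_square: "(h n)\<^sup>2 = (3 powr (-1/4)) ^ n"
  by (simp add: h_def powr_half_sqrt[symmetric] powr_powr powr_realpow[symmetric]
      power2_eq_square powr_add[symmetric])

text \<open>Summation by parts: the gain of shell \<open>n + 1\<close> and the loss of shell
  \<open>n\<close> share the factor \<open>beta n * sqrt 3 ^ (n + 1)\<close> and are collected in
  one term, leaving the loss of the last shell.\<close>

lemma H_rate: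
  "(\<Sum>n<Suc N. h n * rate n t) =
    c * (\<Sum>n<N. beta n * sqrt 3 ^ (n + 1) * (h (Suc n) * (\<psi> n t)\<^sup>2 - h n * \<psi> n t * \<psi> (n + 1) t))
    - c * beta N * sqrt 3 ^ (N + 1) * h N * \<psi> N t * \<psi> (N + 1) t"
proof (induction N)
  case 0
  then show ?case by (simp add: rate_def prev_def)
next
  case (Suc N)
  have "(\<Sum>n<Suc (Suc N). h n * rate n t) = (\<Sum>n<Suc N. h n * rate n t) + h (Suc N) * rate (Suc N) t"
    by simp
  also have "h (Suc N) * rate (Suc N) t = c * beta N * sqrt 3 ^ (N + 1) * h (Suc N) * (\<psi> N t)\<^sup>2
      - c * beta (Suc N) * sqrt 3 ^ (Suc N + 1) * h (Suc N) * \<psi> (Suc N) t * \<psi> (Suc N + 1) t"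
    by (simp add: rate_def prev_def right_diff_distrib mult_ac)
  finally show ?case unfolding Suc by (simp add: algebra_simps)
qed

text \<open>The weight is the square root of \<open>sqrt 3 ^ n * h n\<close>. In these variables
  both quadratic terms of \<open>H_rate\<close> have coefficients that depend on \<open>n\<close>
  only through \<open>beta n\<close>.\<close>

definition a :: "nat \<Rightarrow> real \<Rightarrow> real" where
  "a n t = sqrt 3 powr (3 * real n / 8) * \<psi> n t"

text \<open>\<open>P\<close> belongs to the squares and \<open>Q\<close> to the products of
  neighbours, see \<open>a_diag\<close> and \<open>a_off\<close>. Their difference drives the growth
  and ends up in the bound on the time.\<close>

abbreviation P :: real where "P \<equiv> 3 powr (3/8)"
abbreviation Q :: real where "Q \<equiv> 3 powr (5/16)"

lemma Q_less_P: "Q < P"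
  by simp

lemma sqrt3_powr: "sqrt 3 powr x = 3 powr (x / 2)"
  by (simp add: powr_half_sqrt[symmetric] powr_powr)

lemma sqrt3_power: "sqrt 3 ^ n = 3 powr (real n / 2)"
  by (simp add: sqrt3_powr[symmetric] powr_realpow)

lemma a_diag: "sqrt 3 ^ (n + 1) * (h (Suc n) * (\<psi> n t)\<^sup>2) = P * (a n t)\<^sup>2"
proof -
  have "sqrt 3 ^ (n + 1) * h (Suc n) = P * (sqrt 3 powr (3 * real n / 8))\<^sup>2"
    by (simp only: sqrt3_power h_def sqrt3_powr power2_eq_square powr_add[symmetric])
       (intro arg_cong[where f = "\<lambda>x. 3 powr x"], simp add: field_simps)
  then show ?thesis by (simp add: a_def power_mult_distrib)
qed

lemma a_off: "sqrt 3 ^ (n + 1) * (h n * \<psi> n t * \<psi> (n + 1) t) = Q * (a n t * a (n + 1) t)"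
proof -
  have "sqrt 3 ^ (n + 1) * h n = Q * (sqrt 3 powr (3 * real n / 8) * sqrt 3 powr (3 * real (n + 1) / 8))"
    by (simp only: sqrt3_power h_def sqrt3_powr powr_add[symmetric])
       (intro arg_cong[where f = "\<lambda>x. 3 powr x"], simp add: field_simps)
  then show ?thesis by (simp add: a_def mult_ac)
qed

text \<open>Weight and decay combine to the ratio \<open>3 powr (-5/8)\<close>; it is weakened to
  the ratio \<open>3 powr (-1/4)\<close> of \<open>h_square\<close>, so that one geometric sequence
  serves both.\<close>

lemma a_square_le:
  assumes t: "t \<in> {0..\<tau>}"
  shows "(a n t)\<^sup>2 \<le> B\<^sup>2 * (3 powr (-1/4)) ^ n"
proof -
  have "(a n t)\<^sup>2 \<le> (sqrt 3 powr (3 * real n / 8))\<^sup>2 * (B\<^sup>2 / 3 ^ n)"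
    unfolding a_def power_mult_distrib by (intro mult_left_mono square_le[OF t]) auto
  also have "(sqrt 3 powr (3 * real n / 8))\<^sup>2 = 3 powr (3 * real n / 8)"
    by (simp add: sqrt3_powr power2_eq_square powr_add[symmetric])
  also have "3 powr (3 * real n / 8) * (B\<^sup>2 / 3 ^ n) = B\<^sup>2 * 3 powr (3 * real n / 8 - real n)"
    by (subst powr_diff) (simp add: powr_realpow)
  also have "\<dots> \<le> B\<^sup>2 * 3 powr ((-1/4) * real n)"
    by (intro mult_left_mono powr_mono) auto
  also have "3 powr ((-1/4) * real n) = (3 powr (-1/4)) ^ n"
    by (simp add: powr_realpow[symmetric] powr_powr)
  finally show ?thesis .
qed

lemma a_square_ge: "(\<psi> n t)\<^sup>2 \<le> (a n t)\<^sup>2"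
proof -
  have "1 \<le> sqrt 3 powr (3 * real n / 8)" by (intro ge_one_powr_ge_zero) auto
  then have "1 * (\<psi> n t)\<^sup>2 \<le> (sqrt 3 powr (3 * real n / 8))\<^sup>2 * (\<psi> n t)\<^sup>2"
    by (intro mult_right_mono one_le_power) auto
  then show ?thesis by (simp add: a_def power_mult_distrib)
qed

lemma AM_GM_products: "\<bar>x * y\<bar> \<le> (x\<^sup>2 + y\<^sup>2) / (2::real)"
proof -
  have "0 \<le> (\<bar>x\<bar> - \<bar>y\<bar>)\<^sup>2" by simp
  then show ?thesis by (simp add: power2_diff abs_mult)
qed

text \<open>Because \<open>beta\<close> is increasing, the off-diagonal terms are absorbed by the diagonal ones.\<close>

lemma H_rate_ge:
  assumes t: "t \<in> {0..\<tau>}"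
  shows "(\<Sum>n<Suc N. h n * rate n t) \<ge>
    c * ((P - Q) * beta 0 * E N t) - 2 * c * Q * (B\<^sup>2 * (3 powr (-1/4)) ^ N)"
proof -
  let ?S = "\<Sum>n<N. beta n * (a n t)\<^sup>2" and ?d = "B\<^sup>2 * (3 powr (-1/4)) ^ N"
  have shift: "(\<Sum>n<N. beta n * (a (n + 1) t)\<^sup>2) \<le> ?S + (a N t)\<^sup>2"
  proof -
    have "(\<Sum>n<N. beta n * (a (n + 1) t)\<^sup>2) \<le> (\<Sum>n<N. beta (Suc n) * (a (Suc n) t)\<^sup>2)"
      by (intro sum_mono) (auto intro!: mult_right_mono beta_mono)
    also have "\<dots> = (\<Sum>n<Suc N. beta n * (a n t)\<^sup>2) - beta 0 * (a 0 t)\<^sup>2"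
      by (subst sum.lessThan_Suc_shift) simp
    also have "\<dots> \<le> (\<Sum>n<Suc N. beta n * (a n t)\<^sup>2)"
      using beta_pos[of 0] by simp
    also have "\<dots> \<le> ?S + (a N t)\<^sup>2"
      using mult_right_mono[OF beta_le_1[of N], of "(a N t)\<^sup>2"] by simp
    finally show ?thesis .
  qed
  have off: "(\<Sum>n<N. beta n * (a n t * a (n + 1) t)) \<le> ?S + (a N t)\<^sup>2 / 2"
  proof -
    have "(\<Sum>n<N. beta n * (a n t * a (n + 1) t)) \<le> (\<Sum>n<N. beta n * (((a n t)\<^sup>2 + (a (n + 1) t)\<^sup>2) / 2))"
      by (intro sum_mono mult_left_mono order_trans[OF abs_ge_self AM_GM_products])
         (simp add: beta_pos less_imp_le)
    also have "\<dots> = (?S + (\<Sum>n<N. beta n * (a (n + 1) t)\<^sup>2)) / 2"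
      by (simp add: sum.distrib[symmetric] sum_divide_distrib algebra_simps add_divide_distrib)
    finally show ?thesis using shift by simp
  qed
  \<comment> \<open>This is the boundary term of \<open>H_rate\<close>. Together with the end term
    of \<open>off\<close> it forms the error \<open>2 * c * Q * ?d\<close>.\<close>
  have last: "beta N * \<bar>a N t * a (N + 1) t\<bar> \<le> ?d"
  proof -
    have "beta N * \<bar>a N t * a (N + 1) t\<bar> \<le> 1 * (((a N t)\<^sup>2 + (a (N + 1) t)\<^sup>2) / 2)"
      using beta_pos[of N] by (intro mult_mono beta_le_1 AM_GM_products) auto
    also have "(a (N + 1) t)\<^sup>2 \<le> ?d"
    proof -
      have "(3::real) powr (-1/4) \<le> 1" using powr_mono[of "-1/4" 0 "3::real"] by simp
      then have "B\<^sup>2 * (3 powr (-1/4)) ^ (N + 1) \<le> ?d"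
        by (intro mult_left_mono power_decreasing) auto
      then show ?thesis using a_square_le[OF t, of "N + 1"] by linarith
    qed
    finally show ?thesis using a_square_le[OF t, of N] by simp
  qed
  have diag: "beta 0 * E N t \<le> ?S"
    unfolding E_def sum_distrib_left
    using beta_pos by (intro sum_mono mult_mono beta_mono a_square_ge) (auto intro: less_imp_le)
  have "(\<Sum>n<Suc N. h n * rate n t) =
      c * (P * ?S - Q * (\<Sum>n<N. beta n * (a n t * a (n + 1) t))) - c * (Q * (beta N * (a N t * a (N + 1) t)))"
  proof -
    have "(\<Sum>n<N. beta n * sqrt 3 ^ (n + 1) * (h (Suc n) * (\<psi> n t)\<^sup>2 - h n * \<psi> n t * \<psi> (n + 1) t)) =
        (\<Sum>n<N. P * (beta n * (a n t)\<^sup>2) - Q * (beta n * (a n t * a (n + 1) t)))"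
    proof (intro sum.cong refl)
      fix n
      have "beta n * sqrt 3 ^ (n + 1) * (h (Suc n) * (\<psi> n t)\<^sup>2 - h n * \<psi> n t * \<psi> (n + 1) t) =
        beta n * (sqrt 3 ^ (n + 1) * (h (Suc n) * (\<psi> n t)\<^sup>2)) - beta n * (sqrt 3 ^ (n + 1) * (h n * \<psi> n t * \<psi> (n + 1) t))"
        by (simp only: right_diff_distrib mult.assoc)
      then show "beta n * sqrt 3 ^ (n + 1) * (h (Suc n) * (\<psi> n t)\<^sup>2 - h n * \<psi> n t * \<psi> (n + 1) t) =
          P * (beta n * (a n t)\<^sup>2) - Q * (beta n * (a n t * a (n + 1) t))"
        unfolding a_diag a_off by (simp only: mult.left_commute)
    qed
    moreover have "c * beta N * sqrt 3 ^ (N + 1) * h N * \<psi> N t * \<psi> (N + 1) t =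
        c * (beta N * (sqrt 3 ^ (N + 1) * (h N * \<psi> N t * \<psi> (N + 1) t)))"
      by (simp only: mult.assoc)
    ultimately show ?thesis
      unfolding H_rate a_off by (simp add: sum_subtractf sum_distrib_left mult.left_commute)
  qed
  moreover have "c * (P * ?S - Q * (\<Sum>n<N. beta n * (a n t * a (n + 1) t))) \<ge>
      c * ((P - Q) * (beta 0 * E N t) - Q * ?d)"
  proof (intro mult_left_mono)
    have "(\<Sum>n<N. beta n * (a n t * a (n + 1) t)) \<le> ?S + ?d"
      using off a_square_le[OF t, of N] zero_le_power2[of "a N t"] by linarith
    then have "Q * (\<Sum>n<N. beta n * (a n t * a (n + 1) t)) \<le> Q * (?S + ?d)"
      by (intro mult_left_mono) auto
    moreover have "(P - Q) * (beta 0 * E N t) \<le> (P - Q) * ?S"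
      using diag Q_less_P by (intro mult_left_mono) auto
    ultimately show "(P - Q) * (beta 0 * E N t) - Q * ?d \<le> P * ?S - Q * (\<Sum>n<N. beta n * (a n t * a (n + 1) t))"
      by (simp add: algebra_simps)
  qed simp
  moreover have "c * (Q * (beta N * (a N t * a (N + 1) t))) \<le> c * (Q * ?d)"
  proof (intro mult_left_mono)
    have "beta N * (a N t * a (N + 1) t) \<le> beta N * \<bar>a N t * a (N + 1) t\<bar>"
      using beta_pos[of N] by (intro mult_left_mono) auto
    then show "beta N * (a N t * a (N + 1) t) \<le> ?d" using last by linarith
  qed auto
  ultimately have "(\<Sum>n<Suc N. h n * rate n t) \<ge> c * ((P - Q) * (beta 0 * E N t) - Q * ?d) - c * (Q * ?d)"
    by linarith
  then show ?thesis by (simp add: algebra_simps)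
qed

text \<open>The mean value theorem for the truncated sum. Replacing \<open>E N t\<close> by
  \<open>E (Suc N) 0\<close> costs the flux bound of \<open>energy_change\<close> and one square;
  every error tends to 0 with growing \<open>N\<close>.\<close>

lemma H_increase:
  "H (Suc N) \<tau> - H (Suc N) 0 \<ge> \<tau> * (c * ((P - Q) * beta 0 *
     (E (Suc N) 0 - 2 * \<tau> * (c * B ^ 3 / 3 ^ N) - B\<^sup>2 / 3 ^ N)) - 2 * c * Q * (B\<^sup>2 * (3 powr (-1/4)) ^ N))"
  (is "_ \<ge> \<tau> * ?m")
proof (cases "\<tau> = 0")
  case False
  then have pos: "0 < \<tau>" using \<tau> by simp
  have "\<exists>t\<in>{0<..<\<tau>}. H (Suc N) \<tau> - H (Suc N) 0 = (\<lambda>x. x * (\<Sum>n<Suc N. h n * rate n t)) (\<tau> - 0)"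
  proof (rule mvt_simple[OF pos])
    fix t assume "0 \<le> t" "t \<le> \<tau>"
    then have t: "t \<in> {0..\<tau>}" by simp
    have "(H (Suc N) has_real_derivative (\<Sum>n<Suc N. h n * rate n t)) (at t within {0..\<tau>})"
      unfolding H_def using has_rate[OF t] by (intro DERIV_sum DERIV_cmult)
    then show "(H (Suc N) has_derivative (\<lambda>x. x * (\<Sum>n<Suc N. h n * rate n t))) (at t within {0..\<tau>})"
      unfolding has_field_derivative_def
      by (rule has_derivative_eq_rhs) (simp add: fun_eq_iff mult.commute)
  qed
  then obtain t where t: "t \<in> {0<..<\<tau>}" "H (Suc N) \<tau> - H (Suc N) 0 = \<tau> * (\<Sum>n<Suc N. h n * rate n t)"
    by auto
  then have t': "t \<in> {0..\<tau>}" by auto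
  have "E N t = E (Suc N) t - (\<psi> N t)\<^sup>2" by (simp add: E_def)
  also have "\<dots> \<ge> E (Suc N) 0 - 2 * \<tau> * (c * B ^ 3 / 3 ^ N) - B\<^sup>2 / 3 ^ N"
    using energy_change[OF t', of N] square_le[OF t', of N] by linarith
  finally have "c * ((P - Q) * beta 0 * (E (Suc N) 0 - 2 * \<tau> * (c * B ^ 3 / 3 ^ N) - B\<^sup>2 / 3 ^ N))
      \<le> c * ((P - Q) * beta 0 * E N t)"
    using Q_less_P beta_pos[of 0] by (intro mult_left_mono mult_nonneg_nonneg) auto
  then have "?m \<le> (\<Sum>n<Suc N. h n * rate n t)" using H_rate_ge[OF t', of N] by linarith
  then show ?thesis unfolding t(2) using \<tau> by (intro mult_left_mono)
qed simp

lemma geometric_powr: "norm ((3::real) powr (-1/4)) < 1"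
  using powr_less_mono[of "-1/4" 0 "3::real"] by simp

lemma H_summable: "t \<in> {0..\<tau>} \<Longrightarrow> summable (\<lambda>n. h n * \<psi> n t)"
proof -
  assume t: "t \<in> {0..\<tau>}"
  have s: "summable (\<lambda>n. ((h n)\<^sup>2 + (\<psi> n t)\<^sup>2) / 2)"
    unfolding h_square by (intro summable_divide summable_add energy_summable[OF t] summable_geometric geometric_powr)
  have "norm (h n * \<psi> n t) \<le> ((h n)\<^sup>2 + (\<psi> n t)\<^sup>2) / 2" for n
    using AM_GM_products[of "h n" "\<psi> n t"] by simp
  then show ?thesis by (intro summable_comparison_test'[OF s, of 0])
qed

lemma H_tendsto: "t \<in> {0..\<tau>} \<Longrightarrow> (\<lambda>N. H (Suc N) t) \<longlonglongrightarrow> (\<Sum>n. h n * \<psi> n t)"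
  unfolding H_def by (intro LIMSEQ_Suc summable_LIMSEQ H_summable)

lemma H_growth: "(\<Sum>n. h n * \<psi> n \<tau>) - (\<Sum>n. h n * \<psi> n 0) \<ge> \<tau> * (c * ((P - Q) * beta 0 * energy))"
proof (rule LIMSEQ_le)
  show "(\<lambda>N. H (Suc N) \<tau> - H (Suc N) 0) \<longlonglongrightarrow> (\<Sum>n. h n * \<psi> n \<tau>) - (\<Sum>n. h n * \<psi> n 0)"
    using \<tau> by (intro tendsto_diff H_tendsto) auto
  have "(\<lambda>N. \<tau> * (c * ((P - Q) * beta 0 *
     (E (Suc N) 0 - 2 * \<tau> * (c * B ^ 3 / 3 ^ N) - B\<^sup>2 / 3 ^ N)) - 2 * c * Q * (B\<^sup>2 * (3 powr (-1/4)) ^ N))) \<longlonglongrightarrow>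
     \<tau> * (c * ((P - Q) * beta 0 * (energy - 2 * \<tau> * 0 - 0)) - 2 * c * Q * (B\<^sup>2 * 0))"
    using \<tau> by (intro tendsto_intros E_tendsto geometric_tendsto LIMSEQ_power_zero geometric_powr) auto
  then show "(\<lambda>N. \<tau> * (c * ((P - Q) * beta 0 *
     (E (Suc N) 0 - 2 * \<tau> * (c * B ^ 3 / 3 ^ N) - B\<^sup>2 / 3 ^ N)) - 2 * c * Q * (B\<^sup>2 * (3 powr (-1/4)) ^ N))) \<longlonglongrightarrow>
     \<tau> * (c * ((P - Q) * beta 0 * energy))" by simp
qed (use H_increase in blast)

text \<open>Cauchy--Schwarz, with the geometric sum of the squares of \<open>h\<close> and the
  conserved energy.\<close>

lemma H_upper: "(\<Sum>n. h n * \<psi> n \<tau>) \<le> sqrt (3 powr (1/4) / (3 powr (1/4) - 1)) * sqrt energy"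
proof (rule LIMSEQ_le)
  have \<tau>': "\<tau> \<in> {0..\<tau>}" using \<tau> by simp
  show "(\<lambda>N. H (Suc N) \<tau>) \<longlonglongrightarrow> (\<Sum>n. h n * \<psi> n \<tau>)" by (rule H_tendsto[OF \<tau>'])
  have "(\<Sum>n. (3 powr (-1/4)) ^ n) = 1 / (1 - 3 powr (-1/4) :: real)"
    by (rule suminf_geometric[OF geometric_powr])
  also have "\<dots> = 3 powr (1/4) / (3 powr (1/4) - 1)"
  proof -
    have "(3::real) powr (-1/4) = 1 / 3 powr (1/4)" by (simp add: powr_minus_divide[symmetric])
    moreover have "(1::real) < 3 powr (1/4)" using powr_less_mono[of 0 "1/4" "3::real"] by simp
    ultimately show ?thesis by (simp add: field_simps)
  qed
  finally have "(\<lambda>N. \<Sum>n<Suc N. (h n)\<^sup>2) \<longlonglongrightarrow> 3 powr (1/4) / (3 powr (1/4) - 1)"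
    unfolding h_square using LIMSEQ_Suc[OF summable_LIMSEQ[OF summable_geometric[OF geometric_powr]]] by simp
  then show "(\<lambda>N. sqrt (\<Sum>n<Suc N. (h n)\<^sup>2) * sqrt (E (Suc N) \<tau>)) \<longlonglongrightarrow>
      sqrt (3 powr (1/4) / (3 powr (1/4) - 1)) * sqrt energy"
    by (intro tendsto_intros E_tendsto \<tau>')
  have "H (Suc N) \<tau> \<le> sqrt (\<Sum>n<Suc N. (h n)\<^sup>2) * sqrt (E (Suc N) \<tau>)" for N
  proof -
    have "H (Suc N) \<tau> \<le> (\<Sum>n<Suc N. \<bar>h n\<bar> * \<bar>\<psi> n \<tau>\<bar>)"
      unfolding H_def by (intro sum_mono) (simp flip: abs_mult)
    also have "\<dots> \<le> L2_set h {..<Suc N} * L2_set (\<lambda>n. \<psi> n \<tau>) {..<Suc N}"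
      by (rule L2_set_mult_ineq)
    finally show ?thesis by (simp add: L2_set_def E_def)
  qed
  then show "\<exists>N. \<forall>n\<ge>N. H (Suc n) \<tau> \<le> sqrt (\<Sum>m<Suc n. (h m)\<^sup>2) * sqrt (E (Suc n) \<tau>)" by blast
qed

text \<open>Linear growth against the upper bound, solved for \<open>\<tau>\<close>. The 12 relates
  energy and \<open>L2\<close> norm, see \<open>L2_norm_amplitude\<close>; the \<open>sqrt 3\<close>
  comes from \<open>beta 0 = sqrt (2 / 3)\<close>.\<close>

lemma time_bound:
  assumes L: "L > 0" "L\<^sup>2 = 12 * energy"
  shows "\<tau> \<le> ((3 powr (1/4) / (12 * (3 powr (1/4) - 1))) powr (1/2) * L - H_sum (\<lambda>n. \<psi> n 0))
     * (6 * sqrt 3 / (pi * (3 powr (3/8) - 3 powr (5/16)) * L\<^sup>2))"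
proof -
  define K where "K = 3 powr (1/4) / (3 powr (1/4) - 1 :: real)"
  have "(1::real) < 3 powr (1/4)" using powr_less_mono[of 0 "1/4" "3::real"] by simp
  then have K: "K \<ge> 0" unfolding K_def by (intro divide_nonneg_pos) auto
  have energy: "energy = L\<^sup>2 / 12" using L by simp
  have "sqrt energy = L / sqrt 12" unfolding energy real_sqrt_divide using L(1) by simp
  moreover have "(3 powr (1/4) / (12 * (3 powr (1/4) - 1))) powr (1/2) = sqrt K / sqrt (12::real)"
  proof -
    have eq: "3 powr (1/4) / (12 * (3 powr (1/4) - 1)) = K / (12::real)" by (simp add: K_def)
    show ?thesis unfolding eq using K by (subst powr_half_sqrt) (auto simp: real_sqrt_divide)
  qed
  ultimately have up: "(\<Sum>n. h n * \<psi> n \<tau>) \<le> (3 powr (1/4) / (12 * (3 powr (1/4) - 1))) powr (1/2) * L"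
    using H_upper by (simp add: K_def)
  have c\<beta>: "c * beta 0 = 2 * pi / sqrt 3"
  proof -
    have "beta 0 = sqrt 2 / sqrt 3" by (simp add: beta_eq real_sqrt_divide)
    then show ?thesis by simp
  qed
  have "c * ((P - Q) * beta 0 * energy) = (c * beta 0) * (P - Q) * energy" by (simp only: mult_ac)
  also have "\<dots> = pi * (P - Q) * L\<^sup>2 / (6 * sqrt 3)"
    unfolding c\<beta> energy by simp
  finally have "\<tau> * (pi * (P - Q) * L\<^sup>2 / (6 * sqrt 3)) \<le>
      (3 powr (1/4) / (12 * (3 powr (1/4) - 1))) powr (1/2) * L - H_sum (\<lambda>n. \<psi> n 0)"
    using H_growth up by (simp add: H_sum_def h_def)
  moreover have "pi * (P - Q) * L\<^sup>2 > 0" using L(1) Q_less_P by (intro mult_pos_pos) auto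
  ultimately show ?thesis by (simp add: field_simps)
qed

end

section \<open>From the Euler equation to the shell equations, and blow-up\<close>

lemma solution_amplitude_equation:
  assumes u: "u \<in> HsM crit_exp" "odd_field u" "permutation_symmetric u" "sigma_mirror_symmetric u"
    and u': "u' \<in> HsM crit_exp"
    and eq: "\<And>k. fourier u' k + proj_M (\<lambda>l. \<chi> i. distr_fourier (convection u i) l) k = 0"
  shows "amplitude u' n = sqrt 2 * pi * prev beta n * sqrt 3 ^ n * (prev (amplitude u) n)\<^sup>2
    - sqrt 2 * pi * beta n * sqrt 3 ^ (n + 1) * amplitude u n * amplitude u (n + 1)"
proof -
  have "coef u' (shell_rep n) = nonlin (coef u) (shell_rep n)"
    using equation_iff[OF u(1) u'] eq M_freqI[OF shell_subset_pm[OF shell_rep_in_shell]] by blast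
  also have "\<dots> = \<i> * complex_of_real (sqrt 2 * pi * prev beta n * sqrt 3 ^ n * (prev (amplitude u) n)\<^sup>2
    - sqrt 2 * pi * beta n * sqrt 3 ^ (n + 1) * amplitude u n * amplitude u (n + 1))"
    using coef_eq_amplitude[OF u] by (rule nonlin_shell_rep)
  finally show ?thesis by (simp add: amplitude_def[of u'])
qed

text \<open>Parseval: six frequencies and their negatives on each shell, all with coefficients of
  the same modulus.\<close>

lemma L2_norm_amplitude:
  assumes u: "u \<in> HsM crit_exp" "odd_field u" "permutation_symmetric u" "sigma_mirror_symmetric u"
  shows "(\<lambda>n. 12 * (amplitude u n)\<^sup>2) sums (L2_norm_field u)\<^sup>2"
proof -
  note adm = coef_admissible[OF u(1)]
  have "(LINT x|torus. (norm (u x))\<^sup>2) = (LINT x|torus. (norm (synth (coef u) x))\<^sup>2)"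
  proof (rule integral_cong_AE)
    show "AE x in torus. (norm (u x))\<^sup>2 = (norm (synth (coef u) x))\<^sup>2"
      using AE_lebesgue_imp_torus[OF HsM_eq_synth[OF u(1)]] by eventually_elim simp
  qed (use L2_field_measurable[OF HsM_L2[OF u(1)]] L2_field_measurable[OF L2_field_synth[OF adm]] in measurable)
  then have L: "(L2_norm_field u)\<^sup>2 = (LINT x|torus. (norm (synth (coef u) x))\<^sup>2)"
    by (simp add: L2_norm_field_def integral_nonneg_AE)
  have "(\<Sum>k\<in>freqs_below N. (norm (coef u k))\<^sup>2) = (\<Sum>n<N. 12 * (amplitude u n)\<^sup>2)" for N
  proof -
    have "(\<Sum>k\<in>freqs_below N. (norm (coef u k))\<^sup>2) = (\<Sum>n<N. \<Sum>k\<in>pm_shell n. (norm (coef u k))\<^sup>2)"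
      unfolding freqs_below_def using pm_shell_disjoint by (subst sum.UNION_disjoint) auto
    also have "\<dots> = (\<Sum>n<N. 12 * (amplitude u n)\<^sup>2)"
    proof (intro sum.cong refl)
      fix n
      have "(\<Sum>k\<in>pm_shell n. (norm (coef u k))\<^sup>2) = (\<Sum>k\<in>shell n. (amplitude u n)\<^sup>2) + (\<Sum>k\<in>shell n. (amplitude u n)\<^sup>2)"
        unfolding sum_pm_shell
        by (intro arg_cong2[where f = "(+)"] sum.cong refl) (simp_all add: coef_eq_amplitude[OF u] norm_mult)
      then show "(\<Sum>k\<in>pm_shell n. (norm (coef u k))\<^sup>2) = 12 * (amplitude u n)\<^sup>2" by (simp add: card_shell)
    qed
    finally show ?thesis .
  qed
  then show ?thesis using norm2_synth_integral[OF adm] by (simp add: sums_def L)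
qed

theorem theorem1p11:
  fixes u0 :: "real^3 \<Rightarrow> real^3" and s :: real
  defines "s \<equiv> ln 3 / (2 * ln 2)"
  assumes "u0 \<in> HsM s"
    and "odd_field u0" and "permutation_symmetric u0" and "sigma_mirror_symmetric u0"
  shows "\<exists>\<psi>0 :: nat \<Rightarrow> real. shell_expansion s \<psi>0 u0 \<and>
    (\<forall>(Tmax :: ereal) (u :: real \<Rightarrow> real^3 \<Rightarrow> real^3). unique_maximal_solution s u0 Tmax u \<longrightarrow>
      (\<forall>t\<in>time_interval Tmax.
         odd_field (u t) \<and> permutation_symmetric (u t) \<and> sigma_mirror_symmetric (u t)) \<and>
      (\<exists>\<psi> :: nat \<Rightarrow> real \<Rightarrow> real.
        (\<forall>n. \<psi> n 0 = \<psi>0 n) \<and>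
        (\<forall>t\<in>time_interval Tmax. shell_expansion s (\<lambda>n. \<psi> n t) (u t)) \<and>
        (\<forall>t\<in>time_interval Tmax. \<forall>n.
           (\<psi> n has_real_derivative
              sqrt 2 * pi * prev beta n * sqrt 3 ^ n * (prev (\<lambda>m. \<psi> m t) n)\<^sup>2
              - sqrt 2 * pi * beta n * sqrt 3 ^ (n + 1) * \<psi> n t * \<psi> (n + 1) t)
             (at t within time_interval Tmax))) \<and>
      (\<not> (AE x in lebesgue. u0 x = 0) \<longrightarrow>
        summable (\<lambda>n. sqrt 3 powr (- real n / 4) * \<psi>0 n) \<and>
        Tmax \<le> ereal (((3 powr (1/4) / (12 * (3 powr (1/4) - 1))) powr (1/2) * L2_norm_field u0
                         - H_sum \<psi>0)
                      * (6 * sqrt 3 / (pi * (3 powr (3/8) - 3 powr (5/16)) * (L2_norm_field u0)\<^sup>2)))))"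
proof -
  have s: "s = crit_exp" by (simp add: s_def crit_exp_def)
  note u0 = assms(2-5)[unfolded s]
  show ?thesis
    unfolding s
  \<comment> \<open>The initial amplitudes depend on \<open>u0\<close> alone and are chosen before
    any solution is considered.\<close>
  proof (intro exI[of _ "amplitude u0"] conjI allI impI)
    show "shell_expansion crit_exp (amplitude u0) u0" by (rule shell_expansion_amplitude[OF u0])
  next
    fix T u
    assume sol: "unique_maximal_solution crit_exp u0 T u"
    then have "restricted_euler_solution crit_exp u0 T u" by (simp add: unique_maximal_solution_def)
    then obtain u' where T: "0 < T" and C1: "C1_HsM crit_exp T u u'"
      and eq: "\<And>t k. t \<in> time_interval T \<Longrightarrow>
        fourier (u' t) k + proj_M (\<lambda>l. \<chi> i. distr_fourier (convection (u t) i) l) k = 0"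
      and init: "AE x in lebesgue. u 0 x = u0 x"
      unfolding restricted_euler_solution_def by blast
    have H: "u t \<in> HsM crit_exp" "u' t \<in> HsM crit_exp" if "t \<in> time_interval T" for t
      using C1 that by (auto simp: C1_HsM_def)
    have sym: "odd_field (u t)" "permutation_symmetric (u t)" "sigma_mirror_symmetric (u t)"
      if t: "t \<in> time_interval T" for t
    proof -
      show "odd_field (u t)"
        using negation.unique_solution_symmetric[OF u0(1) _ sol t] u0(2) by (simp add: odd_field_def)
      show "permutation_symmetric (u t)"
        unfolding permutation_symmetric_def
      proof (intro allI impI)
        fix p :: "3 \<Rightarrow> 3" assume p: "bij p"
        interpret shell_symmetry "permute_vec p" "permute_vec p" 1
          by (rule permutation_symmetry[OF p])
        show "AE x in lebesgue. u t (permute_vec p x) = permute_vec p (u t x)"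
          by (rule unique_solution_symmetric[OF u0(1) _ sol t])
             (use u0(3) p in \<open>simp add: permutation_symmetric_def\<close>)
      qed
      show "sigma_mirror_symmetric (u t)"
        using mirror.unique_solution_symmetric[OF u0(1) _ sol t] u0(4) by (simp add: sigma_mirror_symmetric_iff)
    qed
    then show "\<forall>t\<in>time_interval T. odd_field (u t) \<and> permutation_symmetric (u t) \<and> sigma_mirror_symmetric (u t)"
      by blast
    define \<psi> where "\<psi> n t = amplitude (u t) n" for n t
    have zero: "0 \<in> time_interval T" using T by (simp add: time_interval_def zero_ereal_def)
    have \<psi>0: "\<psi> n 0 = amplitude u0 n" for n
      unfolding \<psi>_def amplitude_def
      by (rule arg_cong[where f = Im], rule coef_cong_AE[OF HsM_L2[OF H(1)[OF zero]] HsM_L2[OF u0(1)] init])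
    have ode: "(\<psi> n has_real_derivative
          sqrt 2 * pi * prev beta n * sqrt 3 ^ n * (prev (\<lambda>m. \<psi> m t) n)\<^sup>2
          - sqrt 2 * pi * beta n * sqrt 3 ^ (n + 1) * \<psi> n t * \<psi> (n + 1) t)
         (at t within time_interval T)" if t: "t \<in> time_interval T" for t n
      using amplitude_has_derivative[OF C1 t, of n]
        solution_amplitude_equation[OF H(1)[OF t] sym[OF t] H(2)[OF t] eq[OF t], of n]
      by (simp add: \<psi>_def[abs_def])
    show "\<exists>\<psi>. (\<forall>n. \<psi> n 0 = amplitude u0 n) \<and>
        (\<forall>t\<in>time_interval T. shell_expansion crit_exp (\<lambda>n. \<psi> n t) (u t)) \<and>
        (\<forall>t\<in>time_interval T. \<forall>n.
           (\<psi> n has_real_derivative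
              sqrt 2 * pi * prev beta n * sqrt 3 ^ n * (prev (\<lambda>m. \<psi> m t) n)\<^sup>2
              - sqrt 2 * pi * beta n * sqrt 3 ^ (n + 1) * \<psi> n t * \<psi> (n + 1) t)
             (at t within time_interval T))"
      using \<psi>0 ode shell_expansion_amplitude[OF H(1) sym]
      by (intro exI[of _ \<psi>]) (simp add: \<psi>_def)
    \<comment> \<open>The constant \<open>B\<close> may depend on \<open>\<tau>\<close>; the bound
      on the time does not contain it, so it holds uniformly up to \<open>T\<close>.\<close>
    have loc: "\<exists>B. shell_solution \<psi> \<tau> B" if \<tau>: "\<tau> \<in> time_interval T" for \<tau>
    proof -
      obtain B where B: "\<And>r n. r \<in> {0..\<tau>} \<Longrightarrow> \<bar>amplitude (u r) n\<bar> * sqrt 3 ^ n \<le> B"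
        using amplitude_bounded[OF C1 \<tau>] by blast
      have "shell_solution \<psi> \<tau> B"
      proof
        show "0 \<le> \<tau>" using \<tau> by (simp add: time_interval_def)
        fix t n assume t: "t \<in> {0..\<tau>}"
        then have "t \<in> time_interval T" using time_interval_subset[OF \<tau>] by blast
        from has_field_derivative_subset[OF ode[OF this] time_interval_subset[OF \<tau>]]
        show "(\<psi> n has_real_derivative
            sqrt 2 * pi * prev beta n * sqrt 3 ^ n * (prev (\<lambda>m. \<psi> m t) n)\<^sup>2
            - sqrt 2 * pi * beta n * sqrt 3 ^ (n + 1) * \<psi> n t * \<psi> (n + 1) t) (at t within {0..\<tau>})" .
        show "\<bar>\<psi> n t\<bar> * sqrt 3 ^ n \<le> B" unfolding \<psi>_def by (rule B[OF t])
      qed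
      then show ?thesis by blast
    qed
    assume nz: "\<not> (AE x in lebesgue. u0 x = 0)"
    show "summable (\<lambda>n. sqrt 3 powr (- real n / 4) * amplitude u0 n)"
    proof -
      \<comment> \<open>The degenerate interval at time 0 is enough for the summability of the
        initial series.\<close>
      obtain B where "shell_solution \<psi> 0 B" using loc[OF zero] by blast
      then interpret shell_solution \<psi> 0 B .
      show ?thesis using H_summable[of 0] by (simp add: h_def \<psi>0)
    qed
    let ?L = "L2_norm_field u0"
    note sums = L2_norm_amplitude[OF u0]
    \<comment> \<open>A vanishing norm makes all amplitudes 0, and then the expansion forces
      \<open>u0\<close> to vanish almost everywhere.\<close>
    have "?L \<noteq> 0"
    proof
      assume "?L = 0"
      then have "(\<lambda>n. 12 * (amplitude u0 n)\<^sup>2) sums 0" using sums by simp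
      then have "12 * (amplitude u0 n)\<^sup>2 = 0" for n
        using sums_unique[of "\<lambda>n. 12 * (amplitude u0 n)\<^sup>2" 0] sums_summable
          suminf_eq_zero_iff[of "\<lambda>n. 12 * (amplitude u0 n)\<^sup>2"] by fastforce
      then have z: "amplitude u0 n = 0" for n by simp
      have "AE x in lebesgue. u0 x = 0"
        using shell_expansion_amplitude[OF u0] unfolding shell_expansion_def
        by (auto simp: z elim: eventually_mono)
      with nz show False by simp
    qed
    then have L: "?L > 0"
      by (simp add: L2_norm_field_def less_le integral_nonneg_AE)
    let ?b = "((3 powr (1/4) / (12 * (3 powr (1/4) - 1))) powr (1/2) * ?L - H_sum (amplitude u0))
        * (6 * sqrt 3 / (pi * (3 powr (3/8) - 3 powr (5/16)) * ?L\<^sup>2))"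
    have bound: "\<tau> \<le> ?b" if \<tau>: "\<tau> \<in> time_interval T" for \<tau>
    proof -
      obtain B where "shell_solution \<psi> \<tau> B" using loc[OF \<tau>] by blast
      then interpret shell_solution \<psi> \<tau> B .
      have "(\<lambda>n. 12 * (\<psi> n 0)\<^sup>2) sums (12 * energy)"
        unfolding energy_def using \<tau> by (intro sums_mult summable_sums energy_summable) (simp add: time_interval_def)
      then have "?L\<^sup>2 = 12 * energy" using sums sums_unique2 by (simp add: \<psi>0) blast
      from time_bound[OF L this] show ?thesis by (simp add: \<psi>0)
    qed
    show "T \<le> ereal ?b"
    proof (rule ccontr)
      assume "\<not> T \<le> ereal ?b"
      then obtain \<tau> where \<tau>: "ereal ?b < ereal \<tau>" "ereal \<tau> < T"
        using ereal_dense2[of "ereal ?b" T] by (auto simp: not_le)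
      \<comment> \<open>The bound at time 0 says that \<open>?b\<close> is nonnegative.\<close>
      have "0 \<le> \<tau>" using bound[OF zero] \<tau>(1) by simp
      then have "\<tau> \<in> time_interval T" using \<tau>(2) by (simp add: time_interval_def)
      from bound[OF this] \<tau>(1) show False by simp
    qed
  qed
qed

end
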